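(* Suppose $1\le p\le2$ and $f\in L^p(\mathbb{R})$. Then $f\in H^p_{+1}(\mathbb{R})$ if and only if $\operatorname{supp}\hat f\subset[0,+\infty)$. Moreover, under such conditions the integral representation $$f(z)=\frac{1}{\sqrt{2\pi}}\int_0^\infty e^{itz}\hat f(t)\,dt\qquad(z\in\mathbb{C}_{+1})$$ holds, where $f(z)$ denotes the function in $H^p(\mathbb{C}_{+1})$ whose non-tangential boundary limit is $f$.
   Context: $\mathbb{C}_{+1}=\{z=x+iy: y>0\}$. For $0<p<\infty$, $H^p(\mathbb{C}_{+1})$ is the space of functions $f$ analytic in $\mathbb{C}_{+1}$ with $\|f\|_{H^p_{+1}}=\sup_{y>0}\left(\int_{-\infty}^{\infty}|f(x+iy)|^p\,dx\right)^{1/p}<\infty$. Every such function has non-tangential boundary limits at almost every $x\in\mathbb{R}$, and the boundary function belongs to $L^p(\mathbb{R})$; $H^p_{+1}(\mathbb{R})$ denotes the set of functions on $\mathbb{R}$ that are the non-tangential boundary limit of some function in $H^p(\mathbb{C}_{+1})$. The Fourier transform of $f\in L^1(\mathbb{R})$ is $\hat f(x)=\frac{1}{\sqrt{2\pi}}\int_{\mathbb{R}}f(t)e^{-ixt}\,dt$, extended in the usual way to $L^p(\mathbb{R})$, $1\le p\le2$ (this agrees with the tempered-distribution Fourier transform $(\hat T,\varphi)=(T,\hat\varphi)$ for Schwartz functions $\varphi$). *)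

theory Defs
  imports "HOL-Analysis.Analysis"
begin

definition upper_half_plane :: "complex set" where
  "upper_half_plane = {z. Im z > 0}"

text \<open>Functions are not identified almost everywhere; \<open>lebesgue\<close> is the completed measure, so every
  representative of a class in $L^p$ is included.\<close>

definition Lp :: "real \<Rightarrow> (real \<Rightarrow> complex) set" where
  "Lp p = {f \<in> borel_measurable lebesgue. integrable lebesgue (\<lambda>x. norm (f x) powr p)}"

definition hardy_space :: "real \<Rightarrow> (complex \<Rightarrow> complex) set" where
  "hardy_space p = {F. F holomorphic_on upper_half_plane \<and>
     (\<forall>y>0. integrable lebesgue (\<lambda>x. norm (F (Complex x y)) powr p)) \<and>
     bdd_above ((\<lambda>y. (LINT x|lebesgue. norm (F (Complex x y)) powr p) powr (1 / p)) ` {0<..})}"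

text \<open>For positive \<open>a\<close> this is an open cone in the upper half-plane with vertex \<open>x\<close>; a larger \<open>a\<close> gives
  a wider cone.\<close>

definition nontangential_cone :: "real \<Rightarrow> real \<Rightarrow> complex set" where
  "nontangential_cone a x = {z. \<bar>Re z - x\<bar> < a * Im z}"

definition has_nontangential_limit :: "(complex \<Rightarrow> complex) \<Rightarrow> complex \<Rightarrow> real \<Rightarrow> bool" where
  "has_nontangential_limit F l x \<longleftrightarrow>
     (\<forall>a>0. (F \<longlongrightarrow> l) (at (complex_of_real x) within nontangential_cone a x))"

definition has_boundary_function :: "(complex \<Rightarrow> complex) \<Rightarrow> (real \<Rightarrow> complex) \<Rightarrow> bool" where
  "has_boundary_function F f \<longleftrightarrow> (AE x in lebesgue. has_nontangential_limit F (f x) x)"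

definition hardy_boundary_space :: "real \<Rightarrow> (real \<Rightarrow> complex) set" where
  "hardy_boundary_space p = {f. \<exists>F \<in> hardy_space p. has_boundary_function F f}"

definition schwartz :: "(real \<Rightarrow> complex) \<Rightarrow> bool" where
  "schwartz \<phi> \<longleftrightarrow> (\<exists>D :: nat \<Rightarrow> real \<Rightarrow> complex. D 0 = \<phi> \<and>
     (\<forall>n x. (D n has_vector_derivative D (Suc n) x) (at x)) \<and>
     (\<forall>m n. bounded (range (\<lambda>x. x ^ m *\<^sub>R D n x))))"

definition fourier_integral :: "(real \<Rightarrow> complex) \<Rightarrow> real \<Rightarrow> complex" where
  "fourier_integral f x =
     1 / complex_of_real (sqrt (2 * pi)) *
       (LINT t|lebesgue. f t * exp (- (\<i> * complex_of_real x * complex_of_real t)))"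

text \<open>For $f \in L^p$ with $1 \le p \le 2$, write $f = f_1 + f_2$ with $f_1 \in L^1$ and $f_2 \in L^2$:
  by Plancherel's theorem the tempered distribution $\varphi \mapsto \int f \hat\varphi$ is given by a function,
  which is unique up to null sets, and the second branch below selects it. For integrable \<open>f\<close> the
  function defined by the integral satisfies the same conditions. The integrability requirement
  (for instance with a Gaussian as \<open>\<phi>\<close>) makes \<open>g\<close> locally integrable.\<close>

definition fourier :: "(real \<Rightarrow> complex) \<Rightarrow> real \<Rightarrow> complex" where
  "fourier f =
     (if integrable lebesgue f then fourier_integral f
      else (SOME g. g \<in> borel_measurable lebesgue \<and>
             (\<forall>\<phi>. schwartz \<phi> \<longrightarrow> integrable lebesgue (\<lambda>t. g t * \<phi> t) \<and>
               (LINT t|lebesgue. g t * \<phi> t) = (LINT t|lebesgue. f t * fourier_integral \<phi> t))))"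

text \<open>The support of a function defined up to null sets: the complement of the largest open set on
  which it vanishes almost everywhere. It agrees with the support in the sense of distributions
  for locally integrable functions.\<close>

definition ess_support :: "(real \<Rightarrow> complex) \<Rightarrow> real set" where
  "ess_support g = - \<Union>{U. open U \<and> (AE t in lebesgue. t \<in> U \<longrightarrow> g t = 0)}"

end

theory Submission
  imports Defs "HOL-Complex_Analysis.Complex_Analysis" "HOL-Real_Asymp.Real_Asymp"
begin

text \<open>
  For \<open>f\<close> in $L^p$ the Cauchy integral of \<open>f\<close> is holomorphic off the real line, and in the upper half-plane
  the Poisson integral is the jump \<open>cauchy_integral f z - cauchy_integral f (cnj z)\<close>. Both Cauchy
  integrals are Fourier integrals: $e^{itz}$ restricted to $t \geq 0$ and $e^{it\bar z}$ restricted to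
  $t \leq 0$ have the two Cauchy kernels as transforms, so that moving the transform from the test function
  to \<open>f\<close> expresses \<open>cauchy_integral f z\<close> by the values of \<open>fourier f\<close> on the right half-line and
  \<open>cauchy_integral f (cnj z)\<close> by those on the left half-line. By uniqueness of the transform of integrable
  functions, the second expression vanishes for all \<open>z\<close> iff \<open>fourier f\<close> vanishes almost everywhere on the
  left half-line (\<open>cauchy_lower_eq_0_iff_spectrum\<close>).

  If the spectrum of \<open>f\<close> lies in the right half-line, the Poisson integral of \<open>f\<close> is therefore the Cauchy
  integral, hence holomorphic. It lies in the Hardy space by Jensen's inequality and it has the boundary
  function \<open>f\<close> by Lebesgue's differentiation theorem (\<open>poisson_boundary_function\<close>).

  Conversely, let \<open>F\<close> be in the Hardy space with boundary function \<open>f\<close>. The main step is that \<open>F\<close> is the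
  Poisson integral of \<open>f\<close> (\<open>hardy_space_eq_poisson_integral\<close>). On each half-plane \<open>Im z \<ge> h\<close> the function
  \<open>F\<close> is bounded, so that a maximum principle of Phragmen-Lindelof type gives two facts about the translate
  $F_h(z) = F(z + ih)$: it is the Poisson integral of its values on the real line, and $|F_h|^{p/2}$ is at
  most the Poisson integral of its values there. The second fact survives the limit $h \to 0$ because the
  functions $|F_h|^{p/2}$ are bounded in $L^2$; it yields $\|F_h\|_p \leq \|f\|_p$. Together with
  convergence almost everywhere this forces $F_h \to f$ in $L^p$, also for $p = 1$, where boundedness of
  the norms alone would only give a limit measure. The Poisson formula for $F_h$ then passes to the limit.
  Once the Poisson integral of \<open>f\<close> is holomorphic, \<open>cauchy_integral f (cnj z)\<close> is at the same time
  holomorphic and antiholomorphic in \<open>z\<close>, so it is constant, and it tends to 0 along the imaginary axis.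

  The transform of a function that is not integrable is only given by a choice, so its existence and its
  uniqueness have to be established. Existence follows from Bessel's inequality in $L^2$ by writing \<open>f\<close> as
  the sum of an integrable function and of a series of compactly supported pieces with geometrically small
  $L^2$ norms; uniqueness follows by testing against modulated Gaussians.
\<close>

section \<open>The Poisson and Cauchy kernels\<close>

text \<open>Tonelli's theorem is used for \<open>lebesgue\<close> itself, since the representatives of a class in $L^p$
  need not be Borel measurable.\<close>

lemma sigma_finite_lebesgue: "sigma_finite_measure (lebesgue :: real measure)"
proof
  obtain A :: "real set set" where A: "countable A" "A \<subseteq> sets lborel" "\<Union> A = space lborel"
    "\<forall>a\<in>A. emeasure lborel a \<noteq> \<infinity>"
    using sigma_finite_lborel unfolding sigma_finite_measure_def by blast
  then show "\<exists>A. countable A \<and> A \<subseteq> sets (lebesgue :: real measure) \<and> \<Union> A = space (lebesgue :: real measure) \<and>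
      (\<forall>a\<in>A. emeasure lebesgue a \<noteq> \<infinity>)"
    by (intro exI[of _ A]) (auto simp: space_completion)
qed

interpretation leb: sigma_finite_measure "lebesgue :: real measure"
  by (rule sigma_finite_lebesgue)

interpretation leb2: pair_sigma_finite "lebesgue :: real measure" "lebesgue :: real measure" ..

lemma borel_imp_lebesgue_measurable [measurable (raw)]:
  "f \<in> borel_measurable borel \<Longrightarrow> f \<in> borel_measurable lebesgue"
  by (rule measurable_completion) simp

lemma id_lebesgue_borel [measurable]: "(\<lambda>x::real. x) \<in> lebesgue \<rightarrow>\<^sub>M borel"
  by (rule borel_imp_lebesgue_measurable) simp

definition poisson_kernel :: "complex \<Rightarrow> real \<Rightarrow> real" where
  "poisson_kernel z s = Im z / (pi * ((s - Re z)\<^sup>2 + (Im z)\<^sup>2))"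

definition poisson_integral :: "(real \<Rightarrow> 'a::{banach, second_countable_topology}) \<Rightarrow> complex \<Rightarrow> 'a" where
  "poisson_integral f z = (LINT s|lebesgue. poisson_kernel z s *\<^sub>R f s)"

definition cauchy_integral :: "(real \<Rightarrow> complex) \<Rightarrow> complex \<Rightarrow> complex" where
  "cauchy_integral f z = 1 / (2 * pi * \<i>) * (LINT s|lebesgue. f s * (1 / (of_real s - z)))"

text \<open>Kernels of this kind can be integrated against every function in $L^p$ with $1 \leq p \leq 2$: one
  class of kernels serves all these exponents.\<close>

definition bounded_L2 :: "(real \<Rightarrow> 'a::{real_normed_vector}) \<Rightarrow> bool" where
  "bounded_L2 k \<longleftrightarrow> k \<in> borel_measurable lebesgue \<and> bounded (range k) \<and> integrable lebesgue (\<lambda>s. (norm (k s))\<^sup>2)"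

lemma poisson_kernel_measurable [measurable]: "poisson_kernel z \<in> borel_measurable borel"
  unfolding poisson_kernel_def by measurable

lemma poisson_kernel_measurable_pair [measurable]:
  "(\<lambda>(x, s). poisson_kernel (Complex x y) s) \<in> borel_measurable (lebesgue \<Otimes>\<^sub>M lebesgue)"
  unfolding poisson_kernel_def complex.sel by measurable

lemma poisson_kernel_pos: "0 < Im z \<Longrightarrow> 0 < poisson_kernel z s"
  unfolding poisson_kernel_def
  by (intro divide_pos_pos mult_pos_pos) (auto intro: add_nonneg_pos)

lemma poisson_kernel_le:
  assumes "0 < Im z"
  shows "poisson_kernel z s \<le> 1 / (pi * Im z)"
proof -
  have "poisson_kernel z s \<le> Im z / (pi * (Im z)\<^sup>2)"
    unfolding poisson_kernel_def using assms
    by (intro divide_left_mono mult_left_mono mult_pos_pos) (auto intro: add_nonneg_pos)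
  also have "\<dots> = 1 / (pi * Im z)"
    using assms by (simp add: power2_eq_square)
  finally show ?thesis .
qed

lemma poisson_kernel_swap: "poisson_kernel (Complex x y) s = poisson_kernel (Complex s y) x"
  by (simp add: poisson_kernel_def power2_commute)

text \<open>An antiderivative is $\arctan((s - x)/y)/\pi$. Each of the half-lines on either side of $x$
  contributes one half, the left one by reflection.\<close>

lemma nn_integral_poisson_kernel:
  assumes "0 < Im z"
  shows "(\<integral>\<^sup>+s. ennreal (poisson_kernel z s) \<partial>lborel) = 1"
proof -
  let ?x = "Re z" and ?y = "Im z"
  define F where "F s = arctan ((s - ?x) / ?y) / pi" for s
  have D: "(F has_real_derivative poisson_kernel z s) (at s)" for s
    unfolding F_def poisson_kernel_def using assms
    by (auto intro!: derivative_eq_intros simp: divide_simps) (auto simp: power2_eq_square algebra_simps)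
  have "filterlim (\<lambda>s. (s - ?x) / ?y) at_top at_top"
    using assms by real_asymp
  then have "(F \<longlongrightarrow> (pi / 2) / pi) at_top"
    unfolding F_def by (intro tendsto_divide filterlim_compose[OF tendsto_arctan_at_top] tendsto_const) auto
  then have lim: "(F \<longlongrightarrow> 1 / 2) at_top" by simp
  have half: "(\<integral>\<^sup>+s. ennreal (poisson_kernel z s) * indicator {?x ..} s \<partial>lborel) = ennreal (1 / 2)"
    using poisson_kernel_pos[OF assms]
    by (subst nn_integral_FTC_atLeast[OF _ D _ lim]) (auto simp: F_def less_imp_le)
  have "(\<integral>\<^sup>+s. ennreal (poisson_kernel z s) * indicator {..< ?x} s \<partial>lborel)
    = ennreal \<bar>-1::real\<bar> * (\<integral>\<^sup>+s. ennreal (poisson_kernel z (2 * ?x + -1 * s)) * indicator {..< ?x} (2 * ?x + -1 * s) \<partial>lborel)"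
    by (rule nn_integral_real_affine) auto
  also have "\<dots> = (\<integral>\<^sup>+s. ennreal (poisson_kernel z s) * indicator {?x ..} s \<partial>lborel)"
  proof -
    have "poisson_kernel z (2 * ?x + -1 * s) = poisson_kernel z s" for s
    proof -
      have "(2 * ?x + -1 * s - ?x)\<^sup>2 = (s - ?x)\<^sup>2" by (simp add: power2_eq_square algebra_simps)
      then show ?thesis by (simp add: poisson_kernel_def)
    qed
    moreover have "AE s in lborel. s \<noteq> ?x" by (rule AE_lborel_singleton)
    ultimately show ?thesis
      unfolding abs_neg_one ennreal_1 mult_1_left
      by (intro nn_integral_cong_AE) (auto elim!: eventually_mono simp: indicator_def)
  qed
  finally have half': "(\<integral>\<^sup>+s. ennreal (poisson_kernel z s) * indicator {..< ?x} s \<partial>lborel) = ennreal (1 / 2)"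
    using half by simp
  have "(\<integral>\<^sup>+s. ennreal (poisson_kernel z s) \<partial>lborel) =
    (\<integral>\<^sup>+s. ennreal (poisson_kernel z s) * indicator {?x ..} s + ennreal (poisson_kernel z s) * indicator {..< ?x} s \<partial>lborel)"
    by (intro nn_integral_cong) (auto simp: indicator_def)
  also have "\<dots> = ennreal (1 / 2) + ennreal (1 / 2)"
    by (subst nn_integral_add) (auto simp: half half')
  also have "\<dots> = 1"
    by (subst ennreal_plus[symmetric]) auto
  finally show ?thesis .
qed

lemma poisson_kernel_integral:
  assumes "0 < Im z"
  shows "has_bochner_integral lebesgue (poisson_kernel z) 1"
proof (rule has_bochner_integral_nn_integral)
  show "(\<integral>\<^sup>+s. ennreal (poisson_kernel z s) \<partial>lebesgue) = ennreal 1"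
    using nn_integral_poisson_kernel[OF assms] by (simp add: nn_integral_completion)
qed (use poisson_kernel_pos[OF assms] in \<open>auto intro: less_imp_le\<close>)

lemma bounded_L2I:
  assumes "k \<in> borel_measurable lebesgue" "\<And>s. norm (k s) \<le> K" "integrable lebesgue (\<lambda>s. (norm (k s))\<^sup>2)"
  shows "bounded_L2 k"
  using assms unfolding bounded_L2_def bounded_iff by auto

lemma bounded_L2_bounded_integrable:
  assumes [measurable]: "k \<in> borel_measurable lebesgue" and b: "\<And>s. norm (k s) \<le> K" and i: "integrable lebesgue (\<lambda>s. norm (k s))"
  shows "bounded_L2 k"
proof (rule bounded_L2I[OF assms(1) b])
  show "integrable lebesgue (\<lambda>s. (norm (k s))\<^sup>2)"
  proof (rule Bochner_Integration.integrable_bound[OF integrable_mult_right[OF i, of K]])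
    show "AE s in lebesgue. norm ((norm (k s))\<^sup>2) \<le> norm (K * norm (k s))"
      using b order_trans[OF norm_ge_zero b]
      by (auto simp: power2_eq_square abs_mult intro!: mult_right_mono AE_I2)
  qed measurable
qed

lemma poisson_kernel_bounded_L2:
  assumes "0 < Im z"
  shows "bounded_L2 (poisson_kernel z)"
proof (rule bounded_L2_bounded_integrable)
  show "norm (poisson_kernel z s) \<le> 1 / (pi * Im z)" for s
    using poisson_kernel_le[OF assms, of s] poisson_kernel_pos[OF assms, of s] by simp
  show "integrable lebesgue (\<lambda>s. norm (poisson_kernel z s))"
    using poisson_kernel_integral[OF assms] by (auto simp: has_bochner_integral_iff)
qed measurable

text \<open>This plays the part of Hoelder's inequality for all exponents between 1 and 2 at once: where
  $a \geq 1$ the factor \<open>\<bar>k\<bar>\<close> is at most \<open>K\<close> and $a \leq a^p$, and where $a \leq 1$ the arithmetic-geometric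
  mean inequality applies with $a^2 \leq a^p$. The free parameter \<open>\<eta>\<close> makes the contribution of \<open>k\<close> as small as
  desired, which is what convergence in $L^p$ needs later.\<close>

lemma powr_mult_bound:
  fixes a k :: real
  assumes "0 \<le> a" "1 \<le> p" "p \<le> 2" "\<bar>k\<bar> \<le> K" "0 < \<eta>"
  shows "a * \<bar>k\<bar> \<le> (K + 1 / (2 * \<eta>)) * a powr p + \<eta> / 2 * k\<^sup>2"
proof (cases "a \<le> 1")
  case True
  have "a\<^sup>2 \<le> a powr p"
  proof (cases "a = 0")
    case False
    with True assms have "a powr 2 \<le> a powr p" by (intro powr_mono') auto
    with False assms show ?thesis by (simp add: powr_numeral)
  qed auto
  moreover have "0 \<le> (a / sqrt \<eta> - sqrt \<eta> * \<bar>k\<bar>)\<^sup>2" by simp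
  then have "2 * (a * \<bar>k\<bar>) \<le> a\<^sup>2 / \<eta> + \<eta> * k\<^sup>2"
    using assms by (simp add: power2_diff power_mult_distrib power_divide)
  ultimately have "a * \<bar>k\<bar> \<le> 1 / (2 * \<eta>) * a powr p + \<eta> / 2 * k\<^sup>2"
    using assms by (simp add: field_simps)
  moreover have "0 \<le> K * a powr p" using assms by (intro mult_nonneg_nonneg) auto
  ultimately show ?thesis by (simp add: algebra_simps)
next
  case False
  then have "a powr 1 \<le> a powr p" using assms by (intro powr_mono) auto
  then have "a * \<bar>k\<bar> \<le> a powr p * K" using assms False by (intro mult_mono) auto
  moreover have "0 \<le> 1 / (2 * \<eta>) * a powr p" "0 \<le> \<eta> / 2 * k\<^sup>2" using assms by auto
  ultimately show ?thesis by (simp add: algebra_simps)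
qed

lemma Lp_mult_bounded_L2:
  fixes k :: "real \<Rightarrow> 'b::{real_normed_vector}" and f :: "real \<Rightarrow> complex"
  assumes "1 \<le> p" "p \<le> 2" "f \<in> Lp p" "bounded_L2 k"
  shows "integrable lebesgue (\<lambda>s. norm (f s) * norm (k s))"
proof -
  from assms(4) obtain K where K: "\<And>s. norm (k s) \<le> K" unfolding bounded_L2_def bounded_iff by auto
  have [measurable]: "f \<in> borel_measurable lebesgue" "k \<in> borel_measurable lebesgue"
    using assms by (auto simp: Lp_def bounded_L2_def)
  have "integrable lebesgue (\<lambda>s. (K + 1 / 2) * norm (f s) powr p + 1 / 2 * (norm (k s))\<^sup>2)"
    using assms by (intro Bochner_Integration.integrable_add integrable_mult_right) (auto simp: Lp_def bounded_L2_def)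
  then show ?thesis
  proof (rule Bochner_Integration.integrable_bound)
    show "AE s in lebesgue. norm (norm (f s) * norm (k s)) \<le> norm ((K + 1 / 2) * norm (f s) powr p + 1 / 2 * (norm (k s))\<^sup>2)"
    proof (rule AE_I2)
      fix s
      have "norm (f s) * norm (k s) \<le> (K + 1 / 2) * norm (f s) powr p + 1 / 2 * (norm (k s))\<^sup>2"
        using powr_mult_bound[of "norm (f s)" p "norm (k s)" K 1] assms K[of s] by simp
      then show "norm (norm (f s) * norm (k s)) \<le> norm ((K + 1 / 2) * norm (f s) powr p + 1 / 2 * (norm (k s))\<^sup>2)"
        by (smt (verit) real_norm_def mult_nonneg_nonneg norm_ge_zero)
    qed
  qed measurable
qed

section \<open>Cauchy integrals\<close>

lemma norm_cauchy_kernel_sq: "(norm (1 / (complex_of_real s - z)))\<^sup>2 = 1 / ((s - Re z)\<^sup>2 + (Im z)\<^sup>2)"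
  by (simp add: norm_divide power_divide cmod_power2)

lemma norm_cauchy_kernel_le: "Im z \<noteq> 0 \<Longrightarrow> norm (1 / (complex_of_real s - z)) \<le> 1 / \<bar>Im z\<bar>"
  using abs_Im_le_cmod[of "complex_of_real s - z"] by (simp add: norm_divide divide_simps)

text \<open>The squared modulus of the Cauchy kernel is a multiple of a Poisson kernel.\<close>

lemma cauchy_kernel_bounded_L2:
  assumes "Im z \<noteq> 0"
  shows "bounded_L2 (\<lambda>s. 1 / (complex_of_real s - z))"
proof (rule bounded_L2I)
  define w where "w = Complex (Re z) \<bar>Im z\<bar>"
  have w: "0 < Im w" using assms by (simp add: w_def)
  have "integrable lebesgue (\<lambda>s. pi / \<bar>Im z\<bar> * poisson_kernel w s)"
    using poisson_kernel_integral[OF w] by (intro integrable_mult_right) (simp add: has_bochner_integral_iff)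
  also have "(\<lambda>s. pi / \<bar>Im z\<bar> * poisson_kernel w s) = (\<lambda>s. (norm (1 / (complex_of_real s - z)))\<^sup>2)"
    using assms unfolding norm_cauchy_kernel_sq by (auto simp: poisson_kernel_def w_def)
  finally show "integrable lebesgue (\<lambda>s. (norm (1 / (complex_of_real s - z)))\<^sup>2)" .
  show "norm (1 / (complex_of_real s - z)) \<le> 1 / \<bar>Im z\<bar>" for s
    by (rule norm_cauchy_kernel_le[OF assms])
qed measurable

lemma norm_integral_le_of_bound:
  fixes f :: "'a \<Rightarrow> 'b::{banach, second_countable_topology}"
  assumes g: "integrable M g" and b: "\<And>x. norm (f x) \<le> g x"
  shows "norm (integral\<^sup>L M f) \<le> integral\<^sup>L M g"
proof (cases "integrable M f")
  case True
  have "norm (integral\<^sup>L M f) \<le> (\<integral>x. norm (f x) \<partial>M)" by (rule integral_norm_bound)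
  also have "\<dots> \<le> integral\<^sup>L M g"
    using True g b by (intro integral_mono) auto
  finally show ?thesis .
next
  case False
  have "0 \<le> g x" for x using b[of x] norm_ge_zero order_trans by blast
  with False show ?thesis by (simp add: not_integrable_integral_eq)
qed

lemma Lp_mult_integrable:
  fixes f k :: "real \<Rightarrow> complex"
  assumes "1 \<le> p" "p \<le> 2" "f \<in> Lp p" "bounded_L2 k"
  shows "integrable lebesgue (\<lambda>s. f s * k s)"
proof (rule Bochner_Integration.integrable_bound[OF Lp_mult_bounded_L2[OF assms]])
  have [measurable]: "f \<in> borel_measurable lebesgue" "k \<in> borel_measurable lebesgue"
    using assms by (auto simp: Lp_def bounded_L2_def)
  show "(\<lambda>s. f s * k s) \<in> borel_measurable lebesgue" by measurable
qed (auto simp: norm_mult)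

lemma Lp_poisson_integrable:
  fixes f :: "real \<Rightarrow> complex"
  assumes "1 \<le> p" "p \<le> 2" "f \<in> Lp p" "0 < Im z"
  shows "integrable lebesgue (\<lambda>s. poisson_kernel z s *\<^sub>R f s)"
proof (rule Bochner_Integration.integrable_bound[OF Lp_mult_bounded_L2[OF assms(1-3) poisson_kernel_bounded_L2[OF assms(4)]]])
  have [measurable]: "f \<in> borel_measurable lebesgue"
    using assms by (auto simp: Lp_def)
  show "(\<lambda>s. poisson_kernel z s *\<^sub>R f s) \<in> borel_measurable lebesgue" by measurable
qed (auto simp: abs_mult)

lemma Lp_cauchy_integrable:
  assumes "1 \<le> p" "p \<le> 2" "f \<in> Lp p" "Im z \<noteq> 0"
  shows "integrable lebesgue (\<lambda>s. f s * (1 / (of_real s - z)))"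
  by (rule Lp_mult_integrable[OF assms(1-3) cauchy_kernel_bounded_L2[OF assms(4)]])

lemma poisson_kernel_eq_cauchy:
  assumes "0 < Im z"
  shows "complex_of_real (poisson_kernel z s) =
    1 / (2 * pi * \<i>) * (1 / (of_real s - z) - 1 / (of_real s - cnj z))"
proof -
  have nz: "of_real s - z \<noteq> 0" "of_real s - cnj z \<noteq> 0" 
    using assms by (auto simp: complex_eq_iff)
  have "1 / (of_real s - z) - 1 / (of_real s - cnj z) = (z - cnj z) / ((of_real s - z) * cnj (of_real s - z))"
    using nz by (simp add: field_simps)
  also have "\<dots> = of_real (2 * Im z) * \<i> / of_real ((s - Re z)\<^sup>2 + (Im z)\<^sup>2)"
    unfolding complex_diff_cnj complex_mult_cnj by (simp add: mult.commute)
  finally show ?thesis unfolding poisson_kernel_def by (simp)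
qed

text \<open>The Poisson kernel is the jump of the Cauchy kernel across the real line. This splits the Poisson
  integral into a holomorphic and an antiholomorphic part.\<close>

lemma poisson_integral_eq_cauchy:
  fixes f :: "real \<Rightarrow> complex"
  assumes "1 \<le> p" "p \<le> 2" "f \<in> Lp p" "0 < Im z"
  shows "poisson_integral f z = cauchy_integral f z - cauchy_integral f (cnj z)"
proof -
  have i: "integrable lebesgue (\<lambda>s. f s * (1 / (of_real s - z)))"
    "integrable lebesgue (\<lambda>s. f s * (1 / (of_real s - cnj z)))"
    using Lp_cauchy_integrable[OF assms(1-3)] assms(4) by auto
  have "poisson_integral f z = (LINT s|lebesgue. 1 / (2 * pi * \<i>) * (f s * (1 / (of_real s - z)) - f s * (1 / (of_real s - cnj z))))"
    unfolding poisson_integral_def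
    by (intro Bochner_Integration.integral_cong refl)
       (simp only: scaleR_conv_of_real poisson_kernel_eq_cauchy[OF assms(4)] right_diff_distrib mult_ac)
  also have "\<dots> = cauchy_integral f z - cauchy_integral f (cnj z)"
    unfolding cauchy_integral_def integral_mult_right_zero Bochner_Integration.integral_diff[OF i]
    by (simp only: right_diff_distrib)
  finally show ?thesis .
qed

text \<open>The difference quotient of the kernel differs from its derivative by $(w - z)/((s - w)(s - z)^2)$, so
  the error is at most a constant times $|w - z|$ near \<open>z\<close>.\<close>

lemma cauchy_integral_has_derivative:
  assumes "1 \<le> p" "p \<le> 2" "f \<in> Lp p" "Im z \<noteq> 0"
  shows "(cauchy_integral f has_field_derivative
    1 / (2 * pi * \<i>) * (LINT s|lebesgue. f s * (1 / (of_real s - z))\<^sup>2)) (at z)"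
proof -
  define r where "r = \<bar>Im z\<bar> / 2"
  define A where "A = (LINT s|lebesgue. norm (f s) * norm (1 / (of_real s - z)))"
  define D where "D = (LINT s|lebesgue. f s * (1 / (of_real s - z))\<^sup>2)"
  define c where "c w = (LINT s|lebesgue. f s * (1 / (of_real s - w)))" for w
  have r: "0 < r" using assms by (simp add: r_def)
  have [measurable]: "f \<in> borel_measurable lebesgue" using assms by (auto simp: Lp_def)
  have iA: "integrable lebesgue (\<lambda>s. norm (f s) * norm (1 / (of_real s - z)))"
    by (rule Lp_mult_bounded_L2[OF assms(1-3) cauchy_kernel_bounded_L2[OF assms(4)]])
  have iD: "integrable lebesgue (\<lambda>s. f s * (1 / (of_real s - z))\<^sup>2)"
  proof (rule Bochner_Integration.integrable_bound[OF integrable_mult_right[OF iA, of "1 / \<bar>Im z\<bar>"]])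
    show "AE s in lebesgue. norm (f s * (1 / (of_real s - z))\<^sup>2)
      \<le> norm (1 / \<bar>Im z\<bar> * (norm (f s) * norm (1 / (of_real s - z))))"
    proof (rule AE_I2)
      fix s
      have "norm (f s * (1 / (of_real s - z))\<^sup>2) = norm (1 / (of_real s - z)) * (norm (f s) * norm (1 / (of_real s - z)))"
        by (simp add: norm_mult norm_divide power2_eq_square)
      also have "\<dots> \<le> 1 / \<bar>Im z\<bar> * (norm (f s) * norm (1 / (of_real s - z)))"
        by (intro mult_right_mono norm_cauchy_kernel_le assms) auto
      finally show "norm (f s * (1 / (of_real s - z))\<^sup>2)
        \<le> norm (1 / \<bar>Im z\<bar> * (norm (f s) * norm (1 / (of_real s - z))))" by simp
    qed
  qed measurable
  have bound: "norm ((c w - c z) / (w - z) - D) \<le> norm (w - z) * (1 / (r * \<bar>Im z\<bar>) * A)"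
    if "dist w z < r" "w \<noteq> z" for w
  proof -
    have "\<bar>Im w - Im z\<bar> < r" using that abs_Im_le_cmod[of "w - z"] by (simp add: dist_norm)
    then have Imw: "r \<le> \<bar>Im w\<bar>" unfolding r_def by arith
    with r have Imw0: "Im w \<noteq> 0" by auto
    have iw: "integrable lebesgue (\<lambda>s. f s * (1 / (of_real s - w)))"
      "integrable lebesgue (\<lambda>s. f s * (1 / (of_real s - z)))"
      using Lp_cauchy_integrable[OF assms(1-3)] Imw0 assms(4) by auto
    have "(c w - c z) / (w - z) - D =
      (LINT s|lebesgue. (f s * (1 / (of_real s - w)) - f s * (1 / (of_real s - z))) / (w - z) - f s * (1 / (of_real s - z))\<^sup>2)"
      unfolding c_def D_def using iw iD by simp
    also have "\<dots> = (LINT s|lebesgue. f s * ((w - z) * (1 / (of_real s - w)) * (1 / (of_real s - z))\<^sup>2))"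
    proof (intro Bochner_Integration.integral_cong refl)
      fix s
      have nz: "of_real s - w \<noteq> 0" "of_real s - z \<noteq> 0" "w - z \<noteq> 0"
        using that Imw0 assms(4) by (auto simp: complex_eq_iff)
      have d: "1 / (of_real s - w) - 1 / (of_real s - z) = (w - z) * (1 / (of_real s - w)) * (1 / (of_real s - z))"
        using nz by (simp add: divide_simps)
      have "(f s * (1 / (of_real s - w)) - f s * (1 / (of_real s - z))) / (w - z) =
         f s * ((1 / (of_real s - w) - 1 / (of_real s - z)) / (w - z))"
        by (simp add: right_diff_distrib diff_divide_distrib)
      also have "\<dots> = f s * ((1 / (of_real s - w)) * (1 / (of_real s - z)))"
        unfolding d using nz by simp
      finally have "(f s * (1 / (of_real s - w)) - f s * (1 / (of_real s - z))) / (w - z) - f s * (1 / (of_real s - z))\<^sup>2 =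
        f s * (1 / (of_real s - z)) * (1 / (of_real s - w) - 1 / (of_real s - z))"
        by (simp only: power2_eq_square right_diff_distrib mult_ac)
      also have "\<dots> = f s * ((w - z) * (1 / (of_real s - w)) * (1 / (of_real s - z))\<^sup>2)"
        unfolding d by (simp only: power2_eq_square mult_ac)
      finally show "(f s * (1 / (of_real s - w)) - f s * (1 / (of_real s - z))) / (w - z) - f s * (1 / (of_real s - z))\<^sup>2 =
        f s * ((w - z) * (1 / (of_real s - w)) * (1 / (of_real s - z))\<^sup>2)" .
    qed
    also have "norm \<dots> \<le> (LINT s|lebesgue. norm (w - z) * (1 / (r * \<bar>Im z\<bar>) * (norm (f s) * norm (1 / (of_real s - z)))))"
    proof (rule norm_integral_le_of_bound)
      show "integrable lebesgue (\<lambda>s. norm (w - z) * (1 / (r * \<bar>Im z\<bar>) * (norm (f s) * norm (1 / (of_real s - z)))))"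
        using iA by (intro integrable_mult_right)
      show "norm (f s * ((w - z) * (1 / (of_real s - w)) * (1 / (of_real s - z))\<^sup>2))
        \<le> norm (w - z) * (1 / (r * \<bar>Im z\<bar>) * (norm (f s) * norm (1 / (of_real s - z))))" for s
      proof -
        have "norm (1 / (of_real s - w)) \<le> 1 / \<bar>Im w\<bar>" by (rule norm_cauchy_kernel_le[OF Imw0])
        also have "\<dots> \<le> 1 / r" using Imw r by (intro divide_left_mono) auto
        finally have "norm (1 / (of_real s - w)) * norm (1 / (of_real s - z)) \<le> 1 / r * (1 / \<bar>Im z\<bar>)"
          using r by (intro mult_mono norm_cauchy_kernel_le assms) auto
        then have "norm (w - z) * ((norm (1 / (of_real s - w)) * norm (1 / (of_real s - z))) * (norm (f s) * norm (1 / (of_real s - z))))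
          \<le> norm (w - z) * ((1 / (r * \<bar>Im z\<bar>)) * (norm (f s) * norm (1 / (of_real s - z))))"
          by (intro mult_left_mono mult_right_mono) auto
        then show "norm (f s * ((w - z) * (1 / (of_real s - w)) * (1 / (of_real s - z))\<^sup>2))
        \<le> norm (w - z) * (1 / (r * \<bar>Im z\<bar>) * (norm (f s) * norm (1 / (of_real s - z))))"
          by (simp only: norm_mult norm_power power2_eq_square mult_ac)
      qed
    qed
    also have "\<dots> = norm (w - z) * (1 / (r * \<bar>Im z\<bar>) * A)"
      unfolding A_def by simp
    finally show ?thesis .
  qed
  have "((\<lambda>w. norm (w - z) * (1 / (r * \<bar>Im z\<bar>) * A)) \<longlongrightarrow> norm (z - z) * (1 / (r * \<bar>Im z\<bar>) * A)) (at z)"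
    by (intro tendsto_intros)
  then have z0: "((\<lambda>w. norm (w - z) * (1 / (r * \<bar>Im z\<bar>) * A)) \<longlongrightarrow> 0) (at z)" by simp
  have "((\<lambda>w. (c w - c z) / (w - z) - D) \<longlongrightarrow> 0) (at z)"
    by (rule Lim_null_comparison[OF _ z0]) (use bound r in \<open>auto simp: eventually_at intro!: exI[of _ r]\<close>)
  then have "((\<lambda>w. (c w - c z) / (w - z)) \<longlongrightarrow> D) (at z)"
    by (rule LIM_zero_cancel)
  then have "(c has_field_derivative D) (at z)"
    by (simp add: has_field_derivative_iff)
  then have "((\<lambda>w. 1 / (2 * pi * \<i>) * c w) has_field_derivative 1 / (2 * pi * \<i>) * D) (at z)"
    by (rule DERIV_cmult)
  then show ?thesis
    unfolding c_def D_def cauchy_integral_def[abs_def] .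
qed

lemma cauchy_integral_holomorphic:
  assumes "1 \<le> p" "p \<le> 2" "f \<in> Lp p"
  shows "cauchy_integral f holomorphic_on {z. Im z \<noteq> 0}"
  using cauchy_integral_has_derivative[OF assms]
  by (auto simp: holomorphic_on_def field_differentiable_def intro: DERIV_subset)

section \<open>Poisson integrals of functions in Lp\<close>

text \<open>The graph of a convex power lies above its tangents; the point 0, where the power need not be
  differentiable, is treated separately.\<close>

lemma powr_tangent_le:
  fixes u A p :: real
  assumes "1 \<le> p" "0 \<le> u" "0 < A"
  shows "A powr p + p * A powr (p - 1) * (u - A) \<le> u powr p"
proof (cases "u = 0")
  case True
  have "A powr (p - 1) * A = A powr p"
    using assms powr_add[of A "p - 1" 1] by simp
  then have "A powr p + p * A powr (p - 1) * (u - A) = (1 - p) * A powr p"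
    using True by (simp add: algebra_simps)
  also have "\<dots> \<le> 0" using assms by (intro mult_nonpos_nonneg) auto
  finally show ?thesis using True by simp
next
  case False
  have "u powr p - A powr p \<ge> p * A powr (p - 1) * (u - A)"
  proof (rule convex_on_imp_above_tangent[OF powr_convex[OF assms(1)]])
    show "((\<lambda>x. x powr p) has_field_derivative p * A powr (p - 1)) (at A within {0<..})"
      using assms by (auto intro!: derivative_eq_intros)
  qed (use assms False in \<open>auto simp: interior_open\<close>)
  then show ?thesis by simp
qed

text \<open>Integrate the tangent inequality at the mean value \<open>A\<close> of \<open>norm (f s)\<close> against the probability
  density \<open>poisson_kernel z\<close>: the linear term disappears.\<close>

lemma poisson_integral_Jensen:
  fixes f :: "real \<Rightarrow> complex"
  assumes p: "1 \<le> p" "p \<le> 2" "f \<in> Lp p" and z: "0 < Im z"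
  shows "integrable lebesgue (\<lambda>s. poisson_kernel z s * norm (f s) powr p)"
    and "norm (poisson_integral f z) powr p \<le> (LINT s|lebesgue. poisson_kernel z s * norm (f s) powr p)"
proof -
  have [measurable]: "f \<in> borel_measurable lebesgue" using p by (auto simp: Lp_def)
  show i: "integrable lebesgue (\<lambda>s. poisson_kernel z s * norm (f s) powr p)"
  proof (rule Bochner_Integration.integrable_bound)
    show "integrable lebesgue (\<lambda>s. 1 / (pi * Im z) * norm (f s) powr p)"
      using p by (intro integrable_mult_right) (auto simp: Lp_def)
    show "AE s in lebesgue. norm (poisson_kernel z s * norm (f s) powr p) \<le> norm (1 / (pi * Im z) * norm (f s) powr p)"
      unfolding norm_mult using poisson_kernel_le[OF z] poisson_kernel_pos[OF z] z
      by (intro AE_I2 mult_right_mono) (auto simp: less_imp_le)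
  qed measurable
  define A where "A = (LINT s|lebesgue. poisson_kernel z s * norm (f s))"
  have k: "integrable lebesgue (poisson_kernel z)" "integral\<^sup>L lebesgue (poisson_kernel z) = 1"
    using poisson_kernel_integral[OF z] by (auto simp: has_bochner_integral_iff)
  have iA: "integrable lebesgue (\<lambda>s. poisson_kernel z s * norm (f s))"
    using integrable_norm[OF Lp_poisson_integrable[OF p z]] poisson_kernel_pos[OF z]
    by (simp add: less_imp_le)
  have le: "norm (poisson_integral f z) \<le> A"
    unfolding poisson_integral_def A_def
    by (rule norm_integral_le_of_bound[OF iA]) (use poisson_kernel_pos[OF z] in \<open>simp add: less_imp_le\<close>)
  show "norm (poisson_integral f z) powr p \<le> (LINT s|lebesgue. poisson_kernel z s * norm (f s) powr p)"
  proof (cases "A > 0")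
    case False
    then have "norm (poisson_integral f z) = 0" using le norm_ge_zero[of "poisson_integral f z"] by linarith
    moreover have "0 \<le> (LINT s|lebesgue. poisson_kernel z s * norm (f s) powr p)"
      using poisson_kernel_pos[OF z] by (intro Bochner_Integration.integral_nonneg) (auto simp: less_imp_le)
    ultimately show ?thesis by simp
  next
    case True
    let ?B = "p * A powr (p - 1)"
    have "A powr p = (LINT s|lebesgue. (A powr p - ?B * A) * poisson_kernel z s + ?B * (poisson_kernel z s * norm (f s)))"
      using k iA by (subst Bochner_Integration.integral_add) (auto simp: A_def[symmetric])
    also have "\<dots> \<le> (LINT s|lebesgue. poisson_kernel z s * norm (f s) powr p)"
    proof (rule integral_mono[OF _ i])
      show "integrable lebesgue (\<lambda>s. (A powr p - ?B * A) * poisson_kernel z s + ?B * (poisson_kernel z s * norm (f s)))"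
        using k iA by auto
      fix s
      have "(A powr p - ?B * A) * poisson_kernel z s + ?B * (poisson_kernel z s * norm (f s)) =
        poisson_kernel z s * (A powr p + ?B * (norm (f s) - A))" by (simp add: algebra_simps)
      also have "\<dots> \<le> poisson_kernel z s * norm (f s) powr p"
        using poisson_kernel_pos[OF z, of s] powr_tangent_le[OF p(1) _ True, of "norm (f s)"]
        by (intro mult_left_mono) auto
      finally show "(A powr p - ?B * A) * poisson_kernel z s + ?B * (poisson_kernel z s * norm (f s))
        \<le> poisson_kernel z s * norm (f s) powr p" .
    qed
    finally have "A powr p \<le> (LINT s|lebesgue. poisson_kernel z s * norm (f s) powr p)" .
    moreover have "norm (poisson_integral f z) powr p \<le> A powr p"
      using le p by (intro powr_mono2) auto
    ultimately show ?thesis by linarith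
  qed
qed

lemma poisson_integral_measurable_line:
  fixes f :: "real \<Rightarrow> complex"
  assumes [measurable]: "f \<in> borel_measurable lebesgue"
  shows "(\<lambda>x. poisson_integral f (Complex x y)) \<in> borel_measurable lebesgue"
proof -
  have "(\<lambda>(x, s). poisson_kernel (Complex x y) s *\<^sub>R f s) \<in> borel_measurable (lebesgue \<Otimes>\<^sub>M lebesgue)"
    by measurable
  then show ?thesis unfolding poisson_integral_def
    by (rule leb.borel_measurable_lebesgue_integral)
qed

text \<open>After Jensen's inequality the order of integration is exchanged; the kernel is symmetric in \<open>x\<close>
  and \<open>s\<close>, so its integral over \<open>x\<close> is 1 as well.\<close>

lemma poisson_integral_Lp_contraction:
  fixes f :: "real \<Rightarrow> complex"
  assumes p: "1 \<le> p" "p \<le> 2" "f \<in> Lp p" and y: "0 < y"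
  shows "integrable lebesgue (\<lambda>x. norm (poisson_integral f (Complex x y)) powr p)"
    and "(LINT x|lebesgue. norm (poisson_integral f (Complex x y)) powr p) \<le> (LINT x|lebesgue. norm (f x) powr p)"
proof -
  have [measurable]: "f \<in> borel_measurable lebesgue" using p by (auto simp: Lp_def)
  note [measurable] = poisson_integral_measurable_line[of f y]
  have fint: "integrable lebesgue (\<lambda>x. norm (f x) powr p)" using p by (auto simp: Lp_def)
  have "(\<integral>\<^sup>+x. ennreal (norm (poisson_integral f (Complex x y)) powr p) \<partial>lebesgue) \<le>
    (\<integral>\<^sup>+x. \<integral>\<^sup>+s. ennreal (poisson_kernel (Complex x y) s * norm (f s) powr p) \<partial>lebesgue \<partial>lebesgue)"
  proof (rule nn_integral_mono)
    fix x
    have z: "0 < Im (Complex x y)" using y by simp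
    have "ennreal (norm (poisson_integral f (Complex x y)) powr p) \<le>
      ennreal (LINT s|lebesgue. poisson_kernel (Complex x y) s * norm (f s) powr p)"
      by (intro ennreal_leI poisson_integral_Jensen p z)
    also have "\<dots> = (\<integral>\<^sup>+s. ennreal (poisson_kernel (Complex x y) s * norm (f s) powr p) \<partial>lebesgue)"
      using poisson_kernel_pos[OF z]
      by (intro nn_integral_eq_integral[symmetric] poisson_integral_Jensen p z) (auto simp: less_imp_le)
    finally show "ennreal (norm (poisson_integral f (Complex x y)) powr p) \<le>
       (\<integral>\<^sup>+s. ennreal (poisson_kernel (Complex x y) s * norm (f s) powr p) \<partial>lebesgue)" .
  qed
  also have "\<dots> = (\<integral>\<^sup>+s. \<integral>\<^sup>+x. ennreal (poisson_kernel (Complex x y) s * norm (f s) powr p) \<partial>lebesgue \<partial>lebesgue)"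
  proof (rule leb2.Fubini'[symmetric])
    have "(\<lambda>(x, s). ennreal (poisson_kernel (Complex x y) s * norm (f s) powr p)) \<in> borel_measurable (lebesgue \<Otimes>\<^sub>M lebesgue)"
      by measurable
    then show "(\<lambda>(x, s). ennreal (poisson_kernel (Complex x y) s * norm (f s) powr p)) \<in> borel_measurable (lebesgue \<Otimes>\<^sub>M lebesgue)" .
  qed
  also have "\<dots> = (\<integral>\<^sup>+s. ennreal (norm (f s) powr p) \<partial>lebesgue)"
  proof (rule nn_integral_cong)
    fix s
    have "(\<integral>\<^sup>+x. ennreal (poisson_kernel (Complex x y) s * norm (f s) powr p) \<partial>lebesgue) =
      (\<integral>\<^sup>+x. ennreal (norm (f s) powr p) * ennreal (poisson_kernel (Complex s y) x) \<partial>lebesgue)"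
      by (intro nn_integral_cong) (simp add: poisson_kernel_swap[of _ y s] ennreal_mult'' mult.commute)
    also have "\<dots> = ennreal (norm (f s) powr p)"
      using nn_integral_poisson_kernel[of "Complex s y"] y by (subst nn_integral_cmult) (auto simp: nn_integral_completion)
    finally show "(\<integral>\<^sup>+x. ennreal (poisson_kernel (Complex x y) s * norm (f s) powr p) \<partial>lebesgue) = ennreal (norm (f s) powr p)" .
  qed
  also have "\<dots> = ennreal (LINT s|lebesgue. norm (f s) powr p)"
    by (intro nn_integral_eq_integral fint) auto
  finally have le: "(\<integral>\<^sup>+x. ennreal (norm (poisson_integral f (Complex x y)) powr p) \<partial>lebesgue)
    \<le> ennreal (LINT s|lebesgue. norm (f s) powr p)" .
  show i: "integrable lebesgue (\<lambda>x. norm (poisson_integral f (Complex x y)) powr p)"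
    by (rule integrableI_nonneg) (use le in \<open>auto simp: top_unique less_top[symmetric]\<close>)
  have "ennreal (LINT x|lebesgue. norm (poisson_integral f (Complex x y)) powr p) \<le> ennreal (LINT s|lebesgue. norm (f s) powr p)"
    using le by (subst nn_integral_eq_integral[OF i, symmetric]) auto
  then show "(LINT x|lebesgue. norm (poisson_integral f (Complex x y)) powr p) \<le> (LINT x|lebesgue. norm (f x) powr p)"
    by (subst (asm) ennreal_le_iff) (auto intro!: Bochner_Integration.integral_nonneg)
qed

section \<open>Lebesgue points and non-tangential limits\<close>

text \<open>The left-hand statement is the right-hand one for the reflected function.\<close>

lemma one_sided_lebesgue_derivative:
  fixes g :: "real \<Rightarrow> real"
  assumes "\<And>a b. g integrable_on {a..b}"
  shows "AE x in lebesgue. \<forall>e>0. \<exists>d>0. \<forall>r. 0 < r \<and> r < d \<longrightarrow> integral {x..x+r} g \<le> (g x + e) * r \<and> integral {x-r..x} g \<le> (g x + e) * r"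
proof -
  have int: "\<And>a b. g integrable_on cbox a b" using assms by simp
  have int': "\<And>a b. (\<lambda>x. g (- x)) integrable_on cbox a b"
    using assms by (metis Henstock_Kurzweil_Integration.integrable_reflect_real box_real(2) minus_minus)
  obtain N where N: "negligible N" "\<And>x e. \<lbrakk>x \<notin> N; 0 < e\<rbrakk> \<Longrightarrow>
      \<exists>d>0. \<forall>h. 0 < h \<and> h < d \<longrightarrow> norm (integral (cbox x (x + h *\<^sub>R One)) g /\<^sub>R h ^ DIM(real) - g x) < e"
    using integrable_ccontinuous_explicit[OF int] by metis
  obtain N' where N': "negligible N'" "\<And>x e. \<lbrakk>x \<notin> N'; 0 < e\<rbrakk> \<Longrightarrow>
      \<exists>d>0. \<forall>h. 0 < h \<and> h < d \<longrightarrow> norm (integral (cbox x (x + h *\<^sub>R One)) (\<lambda>x. g (- x)) /\<^sub>R h ^ DIM(real) - g (- x)) < e"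
    using integrable_ccontinuous_explicit[OF int'] by metis
  have "negligible (uminus ` N')"
    by (rule negligible_differentiable_image_negligible[OF order_refl N'(1)])
       (auto intro!: differentiable_on_minus differentiable_on_ident)
  then have "negligible (N \<union> uminus ` N')" using N(1) by simp
  then have "AE x in lebesgue. x \<notin> N \<union> uminus ` N'"
    by (intro AE_not_in) (simp add: negligible_iff_null_sets)
  then show ?thesis
  proof eventually_elim
    fix x assume x: "x \<notin> N \<union> uminus ` N'"
    have x': "- x \<notin> N'" using x by (metis UnI2 imageI minus_minus)
    show "\<forall>e>0. \<exists>d>0. \<forall>r. 0 < r \<and> r < d \<longrightarrow> integral {x..x+r} g \<le> (g x + e) * r \<and> integral {x-r..x} g \<le> (g x + e) * r"
    proof (intro allI impI)
      fix e :: real assume e: "0 < e"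
      obtain d where d: "d > 0" "\<And>r. 0 < r \<Longrightarrow> r < d \<Longrightarrow> \<bar>integral {x..x+r} g / r - g x\<bar> < e"
        using N(2)[of x e] x e by (auto simp: divide_inverse mult.commute)
      obtain d' where d': "d' > 0" "\<And>r. 0 < r \<Longrightarrow> r < d' \<Longrightarrow> \<bar>integral {-x..-x+r} (\<lambda>x. g (- x)) / r - g x\<bar> < e"
        using N'(2)[of "-x" e] x' e by (auto simp: divide_inverse mult.commute)
      show "\<exists>d>0. \<forall>r. 0 < r \<and> r < d \<longrightarrow> integral {x..x+r} g \<le> (g x + e) * r \<and> integral {x-r..x} g \<le> (g x + e) * r"
      proof (intro exI[of _ "min d d'"] conjI allI impI)
        fix r assume r: "0 < r \<and> r < min d d'"
        have "integral {x..x+r} g / r \<le> g x + e" using d(2)[of r] r by auto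
        then show "integral {x..x+r} g \<le> (g x + e) * r" using r by (simp add: divide_le_eq)
        have "integral {-x..-x+r} (\<lambda>x. g (- x)) = integral {x-r..x} g"
          using Henstock_Kurzweil_Integration.integral_reflect_real[of x "x - r" g] by simp
        moreover have "integral {-x..-x+r} (\<lambda>x. g (- x)) / r \<le> g x + e" using d'(2)[of r] r by auto
        ultimately show "integral {x-r..x} g \<le> (g x + e) * r" using r by (simp add: divide_le_eq)
      qed (use d d' in auto)
    qed
  qed
qed

text \<open>The mean oscillation over symmetric intervals around \<open>x\<close> tends to 0; the integral is written
  as a nonnegative one because it is later summed over dyadic intervals.\<close>

definition lebesgue_point :: "(real \<Rightarrow> complex) \<Rightarrow> real \<Rightarrow> bool" where
  "lebesgue_point f x \<longleftrightarrow> (\<forall>e>0. \<exists>d>0. \<forall>r. 0 < r \<and> r < d \<longrightarrow>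
     (\<integral>\<^sup>+s. ennreal (norm (f s - f x)) * indicator {x-r..x+r} s \<partial>lebesgue) \<le> ennreal (e * r))"

text \<open>The differentiation theorem is applied to \<open>norm (f s - q)\<close> for all \<open>q\<close> in a countable dense set. Outside
  the countable union of the exceptional sets, \<open>f x\<close> may be replaced by a nearby \<open>q\<close>.\<close>

lemma AE_lebesgue_point:
  fixes f :: "real \<Rightarrow> complex"
  assumes [measurable]: "f \<in> borel_measurable lebesgue"
    and loc: "\<And>a b. set_integrable lebesgue {a..b} f"
  shows "AE x in lebesgue. lebesgue_point f x"
proof -
  obtain D :: "complex set" where D: "countable D" "\<And>X. open X \<Longrightarrow> X \<noteq> {} \<Longrightarrow> \<exists>d\<in>D. d \<in> X"
    using countable_dense_exists by auto
  have int: "(\<lambda>s. norm (f s - q)) integrable_on {a..b}" for q a b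
  proof -
    have "set_integrable lebesgue {a..b} (\<lambda>s. f s - q)"
      by (intro set_integral_diff loc)
         (auto simp: set_integrable_def emeasure_lborel_Icc_eq intro!: integrable_scaleR_left integrable_real_indicator)
    then show ?thesis
      using absolutely_integrable_norm set_lebesgue_integral_eq_integral(1) by (auto simp: o_def)
  qed
  have "AE x in lebesgue. \<forall>q\<in>D. \<forall>e>0. \<exists>d>0. \<forall>r. 0 < r \<and> r < d \<longrightarrow>
      integral {x..x+r} (\<lambda>s. norm (f s - q)) \<le> (norm (f x - q) + e) * r \<and>
      integral {x-r..x} (\<lambda>s. norm (f s - q)) \<le> (norm (f x - q) + e) * r"
    using D(1) by (intro AE_ball_countable[THEN iffD2] ballI one_sided_lebesgue_derivative int)
  then show ?thesis
  proof eventually_elim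
    fix x
    assume *: "\<forall>q\<in>D. \<forall>e>0. \<exists>d>0. \<forall>r. 0 < r \<and> r < d \<longrightarrow>
      integral {x..x+r} (\<lambda>s. norm (f s - q)) \<le> (norm (f x - q) + e) * r \<and>
      integral {x-r..x} (\<lambda>s. norm (f s - q)) \<le> (norm (f x - q) + e) * r"
    show "lebesgue_point f x"
      unfolding lebesgue_point_def
    proof (intro allI impI)
      fix e :: real assume e: "0 < e"
      obtain q where q: "q \<in> D" "q \<in> ball (f x) (e / 8)"
        using D(2)[of "ball (f x) (e / 8)"] e by auto
      then have c: "norm (f x - q) < e / 8" by (simp add: dist_norm)
      obtain d where d: "d > 0" "\<And>r. 0 < r \<Longrightarrow> r < d \<Longrightarrow> 
         integral {x..x+r} (\<lambda>s. norm (f s - q)) \<le> (norm (f x - q) + e/4) * r \<and>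
         integral {x-r..x} (\<lambda>s. norm (f s - q)) \<le> (norm (f x - q) + e/4) * r"
        using *[rule_format, OF q(1), of "e/4"] e by auto
      have nn: "(\<integral>\<^sup>+s. ennreal (norm (f s - q)) * indicator {a..b} s \<partial>lebesgue) = ennreal (integral {a..b} (\<lambda>s. norm (f s - q)))" for a b
        by (subst nn_integral_completion, rule nn_integral_has_integral_lebesgue')
           (use int in \<open>auto intro: integrable_integral\<close>)
      show "\<exists>d>0. \<forall>r. 0 < r \<and> r < d \<longrightarrow>
        (\<integral>\<^sup>+s. ennreal (norm (f s - f x)) * indicator {x-r..x+r} s \<partial>lebesgue) \<le> ennreal (e * r)"
      proof (intro exI[of _ d] conjI allI impI d(1))
        fix r assume r: "0 < r \<and> r < d"
        have "(\<integral>\<^sup>+s. ennreal (norm (f s - f x)) * indicator {x-r..x+r} s \<partial>lebesgue)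
          \<le> (\<integral>\<^sup>+s. ennreal (norm (f s - q)) * indicator {x..x+r} s + (ennreal (norm (f s - q)) * indicator {x-r..x} s
              + ennreal (norm (f x - q)) * indicator {x-r..x+r} s) \<partial>lebesgue)"
        proof (rule nn_integral_mono)
          fix s
          have "norm (f s - f x) \<le> norm (f s - q) + norm (f x - q)"
            using norm_triangle_ineq4[of "f s - q" "f x - q"] by simp
          then have "ennreal (norm (f s - f x)) \<le> ennreal (norm (f s - q)) + ennreal (norm (f x - q))"
            by (simp add: ennreal_plus[symmetric] del: ennreal_plus)
          then show "ennreal (norm (f s - f x)) * indicator {x-r..x+r} s
            \<le> ennreal (norm (f s - q)) * indicator {x..x+r} s + (ennreal (norm (f s - q)) * indicator {x-r..x} s
              + ennreal (norm (f x - q)) * indicator {x-r..x+r} s)"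
            by (auto simp: indicator_def intro: order_trans add_left_mono simp: add.assoc)
        qed
        also have "\<dots> = ennreal (integral {x..x+r} (\<lambda>s. norm (f s - q))) + (ennreal (integral {x-r..x} (\<lambda>s. norm (f s - q)))
           + ennreal (norm (f x - q)) * ennreal (2 * r))"
          using r by (simp add: nn_integral_add nn nn_integral_cmult)
        also have "\<dots> \<le> ennreal ((norm (f x - q) + e/4) * r) + (ennreal ((norm (f x - q) + e/4) * r) + ennreal (norm (f x - q)) * ennreal (2 * r))"
          using d(2)[of r] r by (intro add_mono ennreal_leI order_refl) auto
        also have "\<dots> = ennreal ((norm (f x - q) + e/4) * r + ((norm (f x - q) + e/4) * r + norm (f x - q) * (2 * r)))"
          using r e by (simp add: ennreal_plus[symmetric] ennreal_mult'[symmetric] del: ennreal_plus)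
        also have "\<dots> \<le> ennreal (e * r)"
        proof (rule ennreal_leI)
          have "(norm (f x - q) + e/4) * r + ((norm (f x - q) + e/4) * r + norm (f x - q) * (2 * r)) = (4 * norm (f x - q) + e / 2) * r"
            by (simp add: algebra_simps)
          also have "\<dots> \<le> e * r" using c r by (intro mult_right_mono) auto
          finally show "(norm (f x - q) + e/4) * r + ((norm (f x - q) + e/4) * r + norm (f x - q) * (2 * r)) \<le> e * r" .
        qed
        finally show "(\<integral>\<^sup>+s. ennreal (norm (f s - f x)) * indicator {x-r..x+r} s \<partial>lebesgue) \<le> ennreal (e * r)" .
      qed
    qed
  qed
qed

text \<open>For the least \<open>k\<close> with $|u| \leq 2^k y$ one has $|u| > 2^{k-1} y$ unless $k = 0$.\<close>

lemma dyadic_kernel_bound: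
  fixes y u :: real
  assumes y: "0 < y"
  obtains k :: nat where "\<bar>u\<bar> \<le> 2 ^ k * y" "y / (u\<^sup>2 + y\<^sup>2) \<le> 4 / (4 ^ k * y)"
proof -
  obtain n where "\<bar>u\<bar> / y < 2 ^ n" using real_arch_pow[of 2 "\<bar>u\<bar> / y"] by auto
  then have ex: "\<bar>u\<bar> \<le> 2 ^ n * y" using y by (simp add: divide_less_eq)
  define k where "k = (LEAST n. \<bar>u\<bar> \<le> 2 ^ n * y)"
  have k: "\<bar>u\<bar> \<le> 2 ^ k * y" unfolding k_def by (rule LeastI[of "\<lambda>n. \<bar>u\<bar> \<le> 2 ^ n * y", OF ex])
  have pos: "0 < u\<^sup>2 + y\<^sup>2" using y by (intro add_nonneg_pos) auto
  have "y / (u\<^sup>2 + y\<^sup>2) \<le> 4 / (4 ^ k * y)"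
  proof (cases k)
    case 0
    have "y * y \<le> 4 * (u\<^sup>2 + y\<^sup>2)" by (simp add: power2_eq_square)
    then show ?thesis using 0 y pos by (simp add: divide_simps)
  next
    case (Suc j)
    then have "\<not> \<bar>u\<bar> \<le> 2 ^ j * y" unfolding k_def using not_less_Least[of j "\<lambda>n. \<bar>u\<bar> \<le> 2 ^ n * y"] by auto
    then have "(2 ^ j * y)\<^sup>2 \<le> \<bar>u\<bar>\<^sup>2" using y by (intro power_mono) auto
    then have "4 ^ j * y\<^sup>2 \<le> u\<^sup>2" by (simp add: power_mult_distrib power_mult[symmetric] mult.commute[of j 2] power_mult)
    then have "4 ^ j * y\<^sup>2 \<le> u\<^sup>2 + y\<^sup>2" by (simp add: add_increasing2)
    then have "y * (4 ^ k * y) \<le> 4 * (u\<^sup>2 + y\<^sup>2)" using Suc by (simp add: power2_eq_square algebra_simps)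
    then show ?thesis using y pos by (simp add: divide_simps)
  qed
  with k show ?thesis using that by blast
qed

text \<open>The kernel is dominated by a sum of multiples of indicators of the intervals of radius $2^k y$,
  with heights that decrease like $4^{-k}$, while the integral of \<open>h\<close> over them grows at most like $2^k$.\<close>

lemma poisson_average_near_le:
  fixes h :: "real \<Rightarrow> real"
  assumes [measurable]: "h \<in> borel_measurable lebesgue" and y: "0 < y" and e: "0 \<le> e"
    and h: "\<And>s. 0 \<le> h s"
    and A: "\<And>r. 0 < r \<Longrightarrow> r \<le> d \<Longrightarrow> (\<integral>\<^sup>+s. ennreal (h s) * indicator {x-r..x+r} s \<partial>lebesgue) \<le> ennreal (e * r)"
    and d: "0 < d"
  shows "(\<integral>\<^sup>+s. ennreal (poisson_kernel (Complex x y) s * h s) * indicator {x-d..x+d} s \<partial>lebesgue) \<le> ennreal (8 * e)"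
proof -
  let ?T = "\<lambda>(k::nat) s. ennreal (4 / (4 ^ k * y)) * (ennreal (h s) * indicator {x - min (2^k*y) d..x + min (2^k*y) d} s)"
  have "(\<integral>\<^sup>+s. ennreal (poisson_kernel (Complex x y) s * h s) * indicator {x-d..x+d} s \<partial>lebesgue) \<le> (\<integral>\<^sup>+s. (\<Sum>k. ?T k s) \<partial>lebesgue)"
  proof (rule nn_integral_mono)
    fix s
    obtain k :: nat where k: "\<bar>s - x\<bar> \<le> 2 ^ k * y" "y / ((s - x)\<^sup>2 + y\<^sup>2) \<le> 4 / (4 ^ k * y)"
      using dyadic_kernel_bound[OF y] by blast
    have "poisson_kernel (Complex x y) s = y / ((s - x)\<^sup>2 + y\<^sup>2) / pi"
      by (simp add: poisson_kernel_def mult.commute)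
    also have "\<dots> \<le> y / ((s - x)\<^sup>2 + y\<^sup>2) / 1"
      using y pi_ge_two by (intro divide_left_mono) auto
    finally have "poisson_kernel (Complex x y) s \<le> y / ((s - x)\<^sup>2 + y\<^sup>2)" by simp
    with k(2) have kk: "poisson_kernel (Complex x y) s \<le> 4 / (4 ^ k * y)" by linarith
    have "ennreal (poisson_kernel (Complex x y) s * h s) * indicator {x-d..x+d} s \<le> ?T k s"
    proof (cases "s \<in> {x-d..x+d}")
      case True
      then have "s \<in> {x - min (2^k*y) d..x + min (2^k*y) d}" using k(1) by auto
      then show ?thesis using True y h[of s] mult_right_mono[OF kk h[of s]]
        by (simp add: ennreal_mult'[symmetric] ennreal_leI)
    qed auto
    also have "\<dots> \<le> (\<Sum>k. ?T k s)"
      using sum_le_suminf[of "\<lambda>k. ?T k s" "{k}"] by simp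
    finally show "ennreal (poisson_kernel (Complex x y) s * h s) * indicator {x-d..x+d} s \<le> (\<Sum>k. ?T k s)" .
  qed
  also have "\<dots> = (\<Sum>k. \<integral>\<^sup>+s. ?T k s \<partial>lebesgue)"
    by (rule nn_integral_suminf) measurable
  also have "\<dots> \<le> (\<Sum>k. ennreal (4 * e * (1/2) ^ k))"
  proof (rule suminf_le)
    fix k :: nat
    have "(\<integral>\<^sup>+s. ?T k s \<partial>lebesgue) = ennreal (4 / (4 ^ k * y)) * (\<integral>\<^sup>+s. ennreal (h s) * indicator {x - min (2^k*y) d..x + min (2^k*y) d} s \<partial>lebesgue)"
      by (rule nn_integral_cmult) measurable
    also have "\<dots> \<le> ennreal (4 / (4 ^ k * y)) * ennreal (e * min (2^k*y) d)"
      using y d by (intro mult_left_mono A) auto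
    also have "\<dots> = ennreal (4 / (4 ^ k * y) * (e * min (2^k*y) d))"
      using y d e by (simp add: ennreal_mult'[symmetric])
    also have "\<dots> \<le> ennreal (4 / (4 ^ k * y) * (e * (2^k*y)))"
      using y e by (intro ennreal_leI mult_left_mono) auto
    also have "4 / (4 ^ k * y) * (e * (2^k*y)) = 4 * e * (1/2) ^ k"
    proof -
      have "(4::real) ^ k = 2 ^ k * 2 ^ k" by (simp add: power_mult_distrib[symmetric])
      then show ?thesis using y by (simp add: field_simps)
    qed
    finally show "(\<integral>\<^sup>+s. ?T k s \<partial>lebesgue) \<le> ennreal (4 * e * (1/2) ^ k)" .
  qed auto
  also have "\<dots> = ennreal (8 * e)"
  proof (rule suminf_ennreal_eq)
    show "(\<lambda>k. 4 * e * (1/2) ^ k) sums (8 * e)"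
      using sums_mult[OF geometric_sums[of "1/2::real"], of "4 * e"] by simp
  qed (use e in auto)
  finally show ?thesis .
qed

text \<open>Away from the centre the kernel is small of the order of \<open>Im z\<close>, uniformly in comparison with the
  kernel at height 1. This controls the part of a Poisson integral that is not local.\<close>

lemma poisson_kernel_far_le:
  assumes z: "0 < Im z" and d: "0 < d" "d \<le> \<bar>s - Re z\<bar>"
  shows "poisson_kernel z s \<le> (1 + 1 / d\<^sup>2) * Im z * poisson_kernel (Complex (Re z) 1) s"
proof -
  let ?u = "(s - Re z)\<^sup>2"
  have sq: "d\<^sup>2 \<le> ?u" using d by (metis abs_le_square_iff abs_of_pos)
  have d2: "0 < d\<^sup>2" using d by simp
  then have u: "0 < ?u" using sq by linarith
  have "1 \<le> ?u / d\<^sup>2" using sq d2 by (simp add: divide_simps)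
  then have "?u + 1 \<le> (1 + 1 / d\<^sup>2) * ?u" by (simp add: algebra_simps)
  moreover have "1 / U \<le> c / V" if "V \<le> c * U" "0 < U" "0 < V" for U V c :: real
    using that by (simp add: field_simps)
  ultimately have "1 / ?u \<le> (1 + 1 / d\<^sup>2) / (?u + 1)" using u by (meson add_pos_pos zero_less_one)
  moreover have "1 / (?u + (Im z)\<^sup>2) \<le> 1 / ?u"
    using u z by (intro divide_left_mono mult_pos_pos add_pos_nonneg) auto
  ultimately have "1 / (?u + (Im z)\<^sup>2) \<le> (1 + 1 / d\<^sup>2) / (?u + 1)" by linarith
  then have "Im z / pi * (1 / (?u + (Im z)\<^sup>2)) \<le> Im z / pi * ((1 + 1 / d\<^sup>2) / (?u + 1))"
    using z by (intro mult_left_mono) auto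
  then show ?thesis by (simp add: poisson_kernel_def mult.commute)
qed

text \<open>In a cone the horizontal displacement is controlled by the height, so approach within the cone
  reduces to vertical approach at the cost of a constant.\<close>

lemma poisson_kernel_cone_le:
  assumes z: "0 < Im z" "\<bar>Re z - x\<bar> < a * Im z"
  shows "poisson_kernel z s \<le> (2 * a\<^sup>2 + 2) * poisson_kernel (Complex x (Im z)) s"
proof -
  let ?C = "2 * a\<^sup>2 + 2"
  have C: "0 < ?C" by (intro add_nonneg_pos) auto
  have "(Re z - x)\<^sup>2 \<le> (a * Im z)\<^sup>2" using z by (intro power2_le_iff_abs_le[THEN iffD2]) auto
  moreover have "(s - x)\<^sup>2 \<le> 2 * (s - Re z)\<^sup>2 + 2 * (Re z - x)\<^sup>2"
    using zero_le_power2[of "(s - Re z) - (Re z - x)"] by (simp add: power2_eq_square algebra_simps)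
  ultimately have "(s - x)\<^sup>2 + (Im z)\<^sup>2 \<le> 2 * (s - Re z)\<^sup>2 + (2 * a\<^sup>2 + 1) * (Im z)\<^sup>2"
    by (simp add: power_mult_distrib algebra_simps)
  also have "\<dots> \<le> ?C * ((s - Re z)\<^sup>2 + (Im z)\<^sup>2)" by (simp add: algebra_simps)
  finally have le: "(s - x)\<^sup>2 + (Im z)\<^sup>2 \<le> ?C * ((s - Re z)\<^sup>2 + (Im z)\<^sup>2)" .
  have "V / B \<le> C * (V / A)" if "A \<le> C * B" "0 < A" "0 < B" "0 < V" for A B C V :: real
    using that by (simp add: field_simps)
  from this[OF le, of "Im z / pi"] show ?thesis
    using z by (simp add: poisson_kernel_def add_nonneg_pos)
qed

lemma poisson_integral_diff_le:
  fixes f :: "real \<Rightarrow> complex"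
  assumes z: "0 < Im z" and f: "integrable lebesgue (\<lambda>s. poisson_kernel z s *\<^sub>R f s)"
  shows "integrable lebesgue (\<lambda>s. poisson_kernel z s * norm (f s - w))"
    and "norm (poisson_integral f z - w) \<le> (LINT s|lebesgue. poisson_kernel z s * norm (f s - w))"
proof -
  have k: "integrable lebesgue (poisson_kernel z)" "integral\<^sup>L lebesgue (poisson_kernel z) = 1"
    using poisson_kernel_integral[OF z] by (auto simp: has_bochner_integral_iff)
  have eq: "norm (poisson_kernel z s *\<^sub>R f s - poisson_kernel z s *\<^sub>R w) = poisson_kernel z s * norm (f s - w)" for s
    using poisson_kernel_pos[OF z, of s] by (simp add: scaleR_diff_right[symmetric])
  have i: "integrable lebesgue (\<lambda>s. poisson_kernel z s *\<^sub>R f s - poisson_kernel z s *\<^sub>R w)"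
    by (intro Bochner_Integration.integrable_diff f integrable_scaleR_left k)
  show "integrable lebesgue (\<lambda>s. poisson_kernel z s * norm (f s - w))"
    using integrable_norm[OF i] unfolding eq .
  have "poisson_integral f z - w = (LINT s|lebesgue. poisson_kernel z s *\<^sub>R f s - poisson_kernel z s *\<^sub>R w)"
    unfolding poisson_integral_def using k f by simp
  then show "norm (poisson_integral f z - w) \<le> (LINT s|lebesgue. poisson_kernel z s * norm (f s - w))"
    using integral_norm_bound[of lebesgue "\<lambda>s. poisson_kernel z s *\<^sub>R f s - poisson_kernel z s *\<^sub>R w"]
    unfolding eq by simp
qed

text \<open>After the reduction to vertical approach, the mean of \<open>h s = norm (f s - f x)\<close> over the kernel
  splits at distance \<open>d\<close> from \<open>x\<close>. The near part is small because \<open>x\<close> is a Lebesgue point, the far part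
  because it is proportional to the height.\<close>

lemma poisson_nontangential_at_lebesgue_point:
  fixes f :: "real \<Rightarrow> complex"
  assumes p: "1 \<le> p" "p \<le> 2" "f \<in> Lp p" and x: "lebesgue_point f x"
  shows "has_nontangential_limit (poisson_integral f) (f x) x"
  unfolding has_nontangential_limit_def tendsto_iff
proof (intro allI impI)
  fix a e :: real assume a: "0 < a" and e: "0 < e"
  have [measurable]: "f \<in> borel_measurable lebesgue" using p by (auto simp: Lp_def)
  define C where "C = 2 * a\<^sup>2 + 2"
  define h where "h s = norm (f s - f x)" for s
  have [measurable]: "h \<in> borel_measurable lebesgue" unfolding h_def by measurable
  have C: "0 < C" unfolding C_def by (intro add_nonneg_pos) auto
  have pint: "integrable lebesgue (\<lambda>s. poisson_kernel z s * h s)" if "0 < Im z" for z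
    unfolding h_def by (rule poisson_integral_diff_le(1)[OF that Lp_poisson_integrable[OF p that]])
  have pos: "0 \<le> poisson_kernel z s * h s" if "0 < Im z" for z s
    using poisson_kernel_pos[OF that] by (simp add: h_def less_imp_le)
  have i1: "0 < Im (Complex x 1)" by simp
  define B where "B = (LINT s|lebesgue. poisson_kernel (Complex x 1) s * h s)"
  have B: "0 \<le> B" unfolding B_def using pos[OF i1] by (intro Bochner_Integration.integral_nonneg) auto
  \<comment> \<open>the near part contributes at most \<open>C * (8 * e')\<close>, which is \<open>e / 2\<close>\<close>
  define e' where "e' = e / 2 / (8 * C)"
  have e': "0 < e'" using e C by (simp add: e'_def)
  obtain d0 where d0: "0 < d0" "\<And>r. 0 < r \<Longrightarrow> r < d0 \<Longrightarrow> (\<integral>\<^sup>+s. ennreal (h s) * indicator {x-r..x+r} s \<partial>lebesgue) \<le> ennreal (e' * r)"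
    using x e' unfolding lebesgue_point_def h_def by metis
  define d where "d = d0 / 2"
  have d: "0 < d" "d < d0" using d0 by (auto simp: d_def)
  define M where "M = (1 + 1 / d\<^sup>2) * B"
  have M: "0 \<le> M" using B by (simp add: M_def)
  have vertical: "(LINT s|lebesgue. poisson_kernel (Complex x y) s * h s) \<le> 8 * e' + M * y" if y: "0 < y" for y
  proof -
    let ?z = "Complex x y"
    have z: "0 < Im ?z" using y by simp
    have "ennreal (LINT s|lebesgue. poisson_kernel ?z s * h s) = (\<integral>\<^sup>+s. ennreal (poisson_kernel ?z s * h s) \<partial>lebesgue)"
      using pos[OF z] by (intro nn_integral_eq_integral[symmetric] pint z) auto
    also have "\<dots> \<le> (\<integral>\<^sup>+s. ennreal (poisson_kernel ?z s * h s) * indicator {x-d..x+d} s +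
         ennreal ((1 + 1 / d\<^sup>2) * y * (poisson_kernel (Complex x 1) s * h s)) \<partial>lebesgue)"
    proof (rule nn_integral_mono)
      fix s
      show "ennreal (poisson_kernel ?z s * h s) \<le> ennreal (poisson_kernel ?z s * h s) * indicator {x-d..x+d} s +
         ennreal ((1 + 1 / d\<^sup>2) * y * (poisson_kernel (Complex x 1) s * h s))"
      proof (cases "s \<in> {x-d..x+d}")
        case False
        then have "d \<le> \<bar>s - Re ?z\<bar>" by auto
        from mult_right_mono[OF poisson_kernel_far_le[OF z d(1) this], of "h s"]
        show ?thesis using False by (simp add: h_def mult.assoc ennreal_leI)
      qed (simp add: add_increasing2)
    qed
    also have "\<dots> = (\<integral>\<^sup>+s. ennreal (poisson_kernel ?z s * h s) * indicator {x-d..x+d} s \<partial>lebesgue) +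
         (\<integral>\<^sup>+s. ennreal ((1 + 1 / d\<^sup>2) * y * (poisson_kernel (Complex x 1) s * h s)) \<partial>lebesgue)"
      by (rule nn_integral_add) measurable
    also have "\<dots> \<le> ennreal (8 * e') + ennreal (M * y)"
    proof (intro add_mono)
      show "(\<integral>\<^sup>+s. ennreal (poisson_kernel ?z s * h s) * indicator {x-d..x+d} s \<partial>lebesgue) \<le> ennreal (8 * e')"
        by (rule poisson_average_near_le) (use d d0 e' y in \<open>auto simp: h_def\<close>)
      have "(\<integral>\<^sup>+s. ennreal ((1 + 1 / d\<^sup>2) * y * (poisson_kernel (Complex x 1) s * h s)) \<partial>lebesgue) =
        ennreal (LINT s|lebesgue. (1 + 1 / d\<^sup>2) * y * (poisson_kernel (Complex x 1) s * h s))"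
        using pos[OF i1] y by (intro nn_integral_eq_integral integrable_mult_right pint i1) auto
      also have "(LINT s|lebesgue. (1 + 1 / d\<^sup>2) * y * (poisson_kernel (Complex x 1) s * h s)) = (1 + 1 / d\<^sup>2) * y * B"
        unfolding B_def by (rule integral_mult_right_zero)
      also have "\<dots> = M * y" by (simp add: M_def)
      finally show "(\<integral>\<^sup>+s. ennreal ((1 + 1 / d\<^sup>2) * y * (poisson_kernel (Complex x 1) s * h s)) \<partial>lebesgue) \<le> ennreal (M * y)"
        by simp
    qed
    also have "\<dots> = ennreal (8 * e' + M * y)" using e' M y by (intro ennreal_plus[symmetric]) auto
    finally show ?thesis using e' M y by (subst (asm) ennreal_le_iff) auto
  qed
  \<comment> \<open>below this height the far part contributes less than \<open>e / 2\<close>\<close>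
  define \<eta> where "\<eta> = e / 2 / C / (M + 1)"
  have \<eta>: "0 < \<eta>" using e M C by (simp add: \<eta>_def)
  show "\<forall>\<^sub>F z in at (complex_of_real x) within nontangential_cone a x. dist (poisson_integral f z) (f x) < e"
    unfolding eventually_at
  proof (intro exI[of _ \<eta>] conjI ballI impI \<eta>)
    fix z assume z: "z \<in> nontangential_cone a x" "z \<noteq> complex_of_real x \<and> dist z (complex_of_real x) < \<eta>"
    have c: "\<bar>Re z - x\<bar> < a * Im z" using z by (simp add: nontangential_cone_def)
    then have "0 < a * Im z" by linarith
    then have Im: "0 < Im z" using a by (simp add: zero_less_mult_iff)
    have "Im z < \<eta>" using z(2) abs_Im_le_cmod[of "z - of_real x"] by (auto simp: dist_norm)
    then have "Im z * (M + 1) < e / 2 / C"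
      unfolding \<eta>_def using M by (intro pos_less_divide_eq[THEN iffD1]) auto
    then have "M * Im z < e / 2 / C" using Im by (simp add: algebra_simps)
    then have MC: "M * Im z * C < e / 2" by (rule pos_less_divide_eq[OF C, THEN iffD1])
    have "dist (poisson_integral f z) (f x) \<le> (LINT s|lebesgue. poisson_kernel z s * h s)"
      unfolding dist_norm h_def by (rule poisson_integral_diff_le(2)[OF Im Lp_poisson_integrable[OF p Im]])
    also have "\<dots> \<le> (LINT s|lebesgue. C * (poisson_kernel (Complex x (Im z)) s * h s))"
    proof (intro integral_mono pint Im integrable_mult_right)
      show "poisson_kernel z s * h s \<le> C * (poisson_kernel (Complex x (Im z)) s * h s)" for s
        using mult_right_mono[OF poisson_kernel_cone_le[OF Im c, of s], of "h s"] by (simp add: h_def C_def mult.assoc)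
    qed (use Im in simp)
    also have "\<dots> = C * (LINT s|lebesgue. poisson_kernel (Complex x (Im z)) s * h s)"
      by (rule integral_mult_right_zero)
    also have "\<dots> \<le> C * (8 * e' + M * Im z)"
      using vertical[OF Im] C by (intro mult_left_mono) auto
    also have "\<dots> = e / 2 + M * Im z * C" using C by (simp add: e'_def algebra_simps)
    also have "\<dots> < e" using MC by linarith
    finally show "dist (poisson_integral f z) (f x) < e" .
  qed
qed

lemma indicator_bounded_L2: "bounded_L2 (indicator {a..b::real} :: real \<Rightarrow> complex)"
proof (rule bounded_L2_bounded_integrable)
  show "integrable lebesgue (\<lambda>s. norm (indicator {a..b} s :: complex))"
  proof -
    have "(\<lambda>s. norm (indicator {a..b} s :: complex)) = indicat_real {a..b}"
      by (auto simp: indicator_def)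
    moreover have "integrable lebesgue (indicat_real {a..b})"
      by (intro integrable_real_indicator) (auto simp: emeasure_lborel_Icc_eq)
    ultimately show ?thesis by simp
  qed
  show "norm (indicator {a..b} s :: complex) \<le> 1" for s :: real by (simp add: indicator_def)
qed measurable

lemma poisson_boundary_function:
  fixes f :: "real \<Rightarrow> complex"
  assumes p: "1 \<le> p" "p \<le> 2" "f \<in> Lp p"
  shows "has_boundary_function (poisson_integral f) f"
proof -
  have [measurable]: "f \<in> borel_measurable lebesgue" using p by (auto simp: Lp_def)
  have "AE x in lebesgue. lebesgue_point f x"
  proof (rule AE_lebesgue_point)
    fix a b :: real
    have "integrable lebesgue (\<lambda>s. f s * indicator {a..b} s)"
      by (rule Lp_mult_integrable[OF p indicator_bounded_L2])
    moreover have "(\<lambda>s. f s * indicator {a..b} s) = (\<lambda>s. indicator {a..b} s *\<^sub>R f s)"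
      by (auto simp: indicator_def)
    ultimately show "set_integrable lebesgue {a..b} f"
      by (simp add: set_integrable_def)
  qed measurable
  then show ?thesis
    unfolding has_boundary_function_def
    by eventually_elim (rule poisson_nontangential_at_lebesgue_point[OF p])
qed

section \<open>Fourier integrals of one-sided exponentials\<close>

text \<open>The value is the limit of the integrals over bounded intervals; integrability follows from the
  modulus of the exponential.\<close>

lemma has_bochner_integral_exp_atLeast:
  fixes w :: complex
  assumes w: "Re w < 0"
  shows "has_bochner_integral lborel (\<lambda>t. indicator {0..} t *\<^sub>R exp (w * of_real t)) (- 1 / w)"
proof -
  have lim: "((\<lambda>t. exp (Re w * t) / Re w) \<longlongrightarrow> 0) at_top"
    using w by real_asymp
  have nn: "(\<integral>\<^sup>+t. ennreal (exp (Re w * t)) * indicator {0..} t \<partial>lborel) = ennreal (0 - exp (Re w * 0) / Re w)"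
    using w by (intro nn_integral_FTC_atLeast[OF _ _ _ lim]) (auto intro!: derivative_eq_intros)
  have int: "integrable lborel (\<lambda>t. indicator {0..} t *\<^sub>R exp (w * of_real t))"
  proof (rule integrableI_bounded)
    have "(\<integral>\<^sup>+t. ennreal (norm (indicator {0..} t *\<^sub>R exp (w * of_real t))) \<partial>lborel) =
      (\<integral>\<^sup>+t. ennreal (exp (Re w * t)) * indicator {0..} t \<partial>lborel)"
      by (intro nn_integral_cong) (auto simp: indicator_def)
    then show "(\<integral>\<^sup>+t. ennreal (norm (indicator {0..} t *\<^sub>R exp (w * of_real t))) \<partial>lborel) < \<infinity>"
      using nn by simp
    have "(\<lambda>t. exp (w * complex_of_real t)) \<in> borel_measurable lborel"
      by (subst measurable_cong_sets[OF sets_lborel refl]) (intro borel_measurable_continuous_onI continuous_intros)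
    then show "(\<lambda>t. indicator {0..} t *\<^sub>R exp (w * of_real t)) \<in> borel_measurable lborel"
      by (intro borel_measurable_scaleR) auto
  qed
  have w0: "w \<noteq> 0" using w by auto
  have "((\<lambda>y. \<integral>t. indicator {..y} t *\<^sub>R (indicator {0..} t *\<^sub>R exp (w * of_real t)) \<partial>lborel) \<longlongrightarrow>
     (\<integral>t. indicator {0..} t *\<^sub>R exp (w * of_real t) \<partial>lborel)) at_top"
    by (rule tendsto_integral_at_top[OF _ int]) simp
  moreover have "\<forall>\<^sub>F y in at_top. (\<integral>t. indicator {..y} t *\<^sub>R (indicator {0..} t *\<^sub>R exp (w * of_real t)) \<partial>lborel) =
     exp (w * of_real y) / w - 1 / w"
    using eventually_ge_at_top[of 0]
  proof eventually_elim
    case (elim y)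
    have "(\<integral>t. indicator {..y} t *\<^sub>R (indicator {0..} t *\<^sub>R exp (w * of_real t)) \<partial>lborel) =
      (\<integral>t. indicator {0..y} t *\<^sub>R exp (w * of_real t) \<partial>lborel)"
      by (intro Bochner_Integration.integral_cong) (auto simp: indicator_def)
    also have "\<dots> = exp (w * of_real y) / w - exp (w * of_real 0) / w"
    proof (rule integral_FTC_Icc[OF elim])
      fix t
      have "((\<lambda>z. exp (w * z) / w) has_field_derivative exp (w * of_real t)) (at (of_real t))"
        using w0 by (auto intro!: derivative_eq_intros)
      then have "((\<lambda>t. exp (w * of_real t) / w) has_vector_derivative exp (w * of_real t)) (at t)"
        by (rule has_vector_derivative_real_field)
      then show "((\<lambda>t. exp (w * of_real t) / w) has_vector_derivative exp (w * of_real t)) (at t within {0..y})"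
        by (rule has_vector_derivative_at_within)
    qed (intro continuous_intros)
    finally show ?case by simp
  qed
  ultimately have "((\<lambda>y. exp (w * of_real y) / w - 1 / w) \<longlongrightarrow>
     (\<integral>t. indicator {0..} t *\<^sub>R exp (w * of_real t) \<partial>lborel)) at_top"
    by (rule Lim_transform_eventually)
  moreover have "((\<lambda>y. exp (w * of_real y) / w - 1 / w) \<longlongrightarrow> 0 / w - 1 / w) at_top"
  proof (intro tendsto_intros w0)
    have "((\<lambda>y. exp (Re w * y)) \<longlongrightarrow> 0) at_top" using w by real_asymp
    then show "((\<lambda>y. exp (w * complex_of_real y)) \<longlongrightarrow> 0) at_top"
      by (subst tendsto_norm_zero_iff[symmetric]) simp
  qed
  ultimately have "(\<integral>t. indicator {0..} t *\<^sub>R exp (w * of_real t) \<partial>lborel) = 0 / w - 1 / w"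
    by (intro tendsto_unique) auto
  then show ?thesis using int by (simp add: has_bochner_integral_iff)
qed

lemma has_bochner_integral_exp_atMost:
  fixes w :: complex
  assumes w: "0 < Re w"
  shows "has_bochner_integral lborel (\<lambda>t. indicator {..0} t *\<^sub>R exp (w * of_real t)) (1 / w)"
proof -
  have "has_bochner_integral lborel (\<lambda>t. indicator {0..} t *\<^sub>R exp (- w * of_real t)) (- 1 / - w)"
    using w by (intro has_bochner_integral_exp_atLeast) simp
  then have "has_bochner_integral lborel (\<lambda>t. indicator {0..} (0 + (-1) * t) *\<^sub>R exp (- w * of_real (0 + (-1) * t))) ((- 1 / - w) /\<^sub>R \<bar>-1\<bar>)"
    by (rule lborel_has_bochner_integral_real_affine_iff[THEN iffD1, rotated]) simp
  moreover have "(\<lambda>t. indicator {0..} (0 + (-1) * t) *\<^sub>R exp (- w * of_real (0 + (-1) * t))) = (\<lambda>t. indicator {..0} t *\<^sub>R exp (w * of_real t))"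
    by (auto simp: indicator_def)
  ultimately show ?thesis by simp
qed

text \<open>Up to constants, the Fourier transforms of \<open>upper_exp\<close> and \<open>lower_exp\<close> are the two Cauchy
  kernels with poles at \<open>z\<close> and \<open>cnj z\<close>, and that of \<open>poisson_exp\<close>, their sum away from 0, is the Poisson kernel.\<close>

definition upper_exp :: "complex \<Rightarrow> real \<Rightarrow> complex" where
  "upper_exp z t = indicator {0..} t *\<^sub>R exp (\<i> * of_real t * z)"

definition lower_exp :: "complex \<Rightarrow> real \<Rightarrow> complex" where
  "lower_exp z t = indicator {..0} t *\<^sub>R exp (\<i> * of_real t * cnj z)"

definition poisson_exp :: "complex \<Rightarrow> real \<Rightarrow> complex" where
  "poisson_exp z t = exp (\<i> * of_real (Re z * t) - of_real (Im z * \<bar>t\<bar>))"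

text \<open>The class $L^1 \cap L^2$ contains all Schwartz functions and also the exponentials above, whose
  discontinuity at 0 excludes them from the Schwartz class.\<close>

definition test_function :: "(real \<Rightarrow> complex) \<Rightarrow> bool" where
  "test_function \<phi> \<longleftrightarrow> integrable lebesgue \<phi> \<and> integrable lebesgue (\<lambda>t. (norm (\<phi> t))\<^sup>2)"

lemma test_functionI:
  assumes "integrable lebesgue \<phi>" "\<And>t. norm (\<phi> t) \<le> K"
  shows "test_function \<phi>"
  using bounded_L2_bounded_integrable[of \<phi> K] assms
  by (auto simp: test_function_def bounded_L2_def)

lemma upper_exp_measurable [measurable]: "upper_exp z \<in> borel_measurable borel"
  unfolding upper_exp_def[abs_def] by measurable

lemma lower_exp_measurable [measurable]: "lower_exp z \<in> borel_measurable borel"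
  unfolding lower_exp_def[abs_def] by measurable

lemma poisson_exp_measurable [measurable]: "poisson_exp z \<in> borel_measurable borel"
  unfolding poisson_exp_def[abs_def] by measurable

lemma upper_exp_integral:
  assumes "0 < Im z"
  shows "has_bochner_integral lebesgue (upper_exp z) (\<i> / z)"
proof -
  have 1: "has_bochner_integral lborel (\<lambda>t. indicator {0..} t *\<^sub>R exp (\<i> * z * of_real t)) (- 1 / (\<i> * z))"
    using assms by (intro has_bochner_integral_exp_atLeast) simp
  have "has_bochner_integral lborel (upper_exp z) (\<i> / z)" if "has_bochner_integral lborel (\<lambda>t. indicator {0..} t *\<^sub>R exp (\<i> * z * of_real t)) (- 1 / (\<i> * z))"
  proof -
    have "- 1 / (\<i> * z) = \<i> / z" by (cases "z = 0") (auto simp: field_simps)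
    then show ?thesis unfolding upper_exp_def[abs_def] using that by (simp add: mult_ac)
  qed
  from this[OF 1] show ?thesis
    by (auto simp: has_bochner_integral_iff integrable_completion integral_completion)
qed

lemma lower_exp_integral:
  assumes "0 < Im z"
  shows "has_bochner_integral lebesgue (lower_exp z) (- \<i> / cnj z)"
proof -
  have 1: "has_bochner_integral lborel (\<lambda>t. indicator {..0} t *\<^sub>R exp (\<i> * cnj z * of_real t)) (1 / (\<i> * cnj z))"
    using assms by (intro has_bochner_integral_exp_atMost) simp
  have "has_bochner_integral lborel (lower_exp z) (- \<i> / cnj z)" if "has_bochner_integral lborel (\<lambda>t. indicator {..0} t *\<^sub>R exp (\<i> * cnj z * of_real t)) (1 / (\<i> * cnj z))"
  proof -
    have "1 / (\<i> * cnj z) = - \<i> / cnj z" by (cases "z = 0") (auto simp: field_simps)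
    then show ?thesis unfolding lower_exp_def[abs_def] using that by (simp add: mult_ac)
  qed
  from this[OF 1] show ?thesis
    by (auto simp: has_bochner_integral_iff integrable_completion integral_completion)
qed

text \<open>At 0 both one-sided exponentials have the value 1.\<close>

lemma poisson_exp_AE: "AE t in lebesgue. poisson_exp z t = upper_exp z t + lower_exp z t"
proof -
  have "AE t in lebesgue. t \<noteq> (0::real)" by (intro AE_completion AE_lborel_singleton)
  then show ?thesis
  proof eventually_elim
    case (elim t)
    have "z = of_real (Re z) + \<i> * of_real (Im z)" "cnj z = of_real (Re z) - \<i> * of_real (Im z)"
      by (auto simp: complex_eq_iff)
    then have "\<i> * of_real t * z = \<i> * of_real (Re z * t) - of_real (Im z * t)"
       "\<i> * of_real t * cnj z = \<i> * of_real (Re z * t) + of_real (Im z * t)"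
      by (auto simp: complex_eq_iff)
    then show ?case using elim
      by (auto simp: poisson_exp_def upper_exp_def lower_exp_def indicator_def)
  qed
qed

lemma upper_exp_test: "0 < Im z \<Longrightarrow> test_function (upper_exp z)"
  using upper_exp_integral[of z]
  by (intro test_functionI[of _ 1]) (auto simp: has_bochner_integral_iff upper_exp_def indicator_def)

lemma lower_exp_test: "0 < Im z \<Longrightarrow> test_function (lower_exp z)"
  using lower_exp_integral[of z]
  by (intro test_functionI[of _ 1])
     (auto simp: has_bochner_integral_iff lower_exp_def indicator_def mult_nonneg_nonpos2 mult_nonneg_nonpos mult_nonpos_nonneg mult_le_0_iff)

lemma poisson_exp_test: "0 < Im z \<Longrightarrow> test_function (poisson_exp z)"
proof (rule test_functionI[of _ 1])
  assume z: "0 < Im z"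
  have "integrable lebesgue (\<lambda>t. upper_exp z t + lower_exp z t)"
    using upper_exp_integral[OF z] lower_exp_integral[OF z] by (auto simp: has_bochner_integral_iff)
  then show "integrable lebesgue (poisson_exp z)"
    by (rule integrable_cong_AE_imp) (use poisson_exp_AE[of z] in \<open>auto elim: eventually_mono\<close>)
qed (simp add: poisson_exp_def)

lemma fourier_integral_upper_exp:
  assumes "0 < Im z"
  shows "fourier_integral (upper_exp z) s = complex_of_real (sqrt (2 * pi)) * (1 / (2 * pi * \<i>) * (1 / (of_real s - z)))"
proof -
  have "(LINT t|lebesgue. upper_exp z t * exp (- (\<i> * of_real s * of_real t))) = (LINT t|lebesgue. upper_exp (z - of_real s) t)"
    by (intro Bochner_Integration.integral_cong) (auto simp: upper_exp_def exp_add[symmetric] algebra_simps)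
  also have "\<dots> = \<i> / (z - of_real s)"
    using upper_exp_integral[of "z - of_real s"] assms by (simp add: has_bochner_integral_iff)
  finally have "fourier_integral (upper_exp z) s = 1 / of_real (sqrt (2 * pi)) * (\<i> / (z - of_real s))"
    by (simp add: fourier_integral_def)
  also have "\<dots> = complex_of_real (sqrt (2 * pi)) * (1 / (2 * pi * \<i>) * (1 / (of_real s - z)))"
  proof -
    have nz: "z - of_real s \<noteq> 0" "of_real s - z \<noteq> 0" using assms by (auto simp: complex_eq_iff)
    have r: "complex_of_real (sqrt (2 * pi)) * complex_of_real (sqrt (2 * pi)) = 2 * pi"
      by (simp flip: of_real_mult)
    have r0: "complex_of_real (sqrt (2 * pi)) \<noteq> 0" by simp
    have "\<i> / (z - of_real s) = - \<i> / (of_real s - z)"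
      using minus_divide_divide[of "- \<i>" "of_real s - z"] by simp
    moreover have "1 / (2 * pi * \<i>) = - \<i> / (2 * complex_of_real pi)" by (simp add: divide_simps)
    ultimately show ?thesis unfolding r[symmetric] using r0 nz by (simp add: field_simps)
  qed
  finally show ?thesis .
qed

lemma fourier_integral_lower_exp:
  assumes "0 < Im z"
  shows "fourier_integral (lower_exp z) s = - complex_of_real (sqrt (2 * pi)) * (1 / (2 * pi * \<i>) * (1 / (of_real s - cnj z)))"
proof -
  have "(LINT t|lebesgue. lower_exp z t * exp (- (\<i> * of_real s * of_real t))) = (LINT t|lebesgue. lower_exp (z - of_real s) t)"
    by (intro Bochner_Integration.integral_cong) (auto simp: lower_exp_def exp_add[symmetric] algebra_simps)
  also have "\<dots> = - \<i> / cnj (z - of_real s)"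
    using lower_exp_integral[of "z - of_real s"] assms by (simp add: has_bochner_integral_iff)
  finally have "fourier_integral (lower_exp z) s = 1 / of_real (sqrt (2 * pi)) * (- \<i> / (cnj z - of_real s))"
    by (simp add: fourier_integral_def)
  also have "\<dots> = - complex_of_real (sqrt (2 * pi)) * (1 / (2 * pi * \<i>) * (1 / (of_real s - cnj z)))"
  proof -
    have nz: "cnj z - of_real s \<noteq> 0" "of_real s - cnj z \<noteq> 0" using assms by (auto simp: complex_eq_iff)
    have r: "complex_of_real (sqrt (2 * pi)) * complex_of_real (sqrt (2 * pi)) = 2 * pi"
      by (simp flip: of_real_mult)
    have r0: "complex_of_real (sqrt (2 * pi)) \<noteq> 0" by simp
    have "- \<i> / (cnj z - of_real s) = \<i> / (of_real s - cnj z)"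
      using minus_divide_divide[of "\<i>" "of_real s - cnj z"] by simp
    moreover have "1 / (2 * pi * \<i>) = - \<i> / (2 * complex_of_real pi)" by (simp add: divide_simps)
    ultimately show ?thesis unfolding r[symmetric] using r0 nz by (simp add: field_simps)
  qed
  finally show ?thesis .
qed

section \<open>The multiplication formula and the inequality of Bessel\<close>

lemma fourier_integral_measurable [measurable]:
  assumes [measurable]: "f \<in> borel_measurable lebesgue"
  shows "fourier_integral f \<in> borel_measurable lebesgue"
proof -
  have "(\<lambda>(x, t). f t * exp (- (\<i> * complex_of_real x * complex_of_real t))) \<in> borel_measurable (lebesgue \<Otimes>\<^sub>M lebesgue)"
    by measurable
  then have [measurable]: "(\<lambda>x. LINT t|lebesgue. f t * exp (- (\<i> * complex_of_real x * complex_of_real t))) \<in> borel_measurable lebesgue"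
    by (rule leb.borel_measurable_lebesgue_integral)
  show ?thesis unfolding fourier_integral_def[abs_def] by measurable
qed

lemma norm_fourier_kernel [simp]: "norm (exp (- (\<i> * complex_of_real x * complex_of_real t))) = 1"
  by simp

lemma fourier_integral_norm_le:
  "norm (fourier_integral f x) \<le> 1 / sqrt (2 * pi) * (LINT t|lebesgue. norm (f t))"
proof -
  have "norm (LINT t|lebesgue. f t * exp (- (\<i> * complex_of_real x * complex_of_real t))) \<le>
     (LINT t|lebesgue. norm (f t * exp (- (\<i> * complex_of_real x * complex_of_real t))))"
    by (rule integral_norm_bound)
  then show ?thesis
    unfolding fourier_integral_def norm_mult norm_fourier_kernel
    by (auto simp: norm_divide intro!: mult_left_mono divide_right_mono)
qed

lemma fourier_kernel_integrable:
  assumes "integrable lebesgue f"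
  shows "integrable lebesgue (\<lambda>t. f t * exp (- (\<i> * complex_of_real x * complex_of_real t)))"
  by (rule Bochner_Integration.integrable_bound[OF assms]) (use assms in \<open>auto simp: norm_mult\<close>)

lemma fourier_integral_add:
  assumes "integrable lebesgue f" "integrable lebesgue g"
  shows "fourier_integral (\<lambda>t. f t + g t) x = fourier_integral f x + fourier_integral g x"
  unfolding fourier_integral_def distrib_right
  using fourier_kernel_integrable[OF assms(1)] fourier_kernel_integrable[OF assms(2)]
  by (simp add: distrib_left)

lemma bounded_mult_integrable:
  fixes f \<phi> :: "real \<Rightarrow> complex"
  assumes "integrable lebesgue \<phi>" "f \<in> borel_measurable lebesgue" "\<And>t. norm (f t) \<le> K"
  shows "integrable lebesgue (\<lambda>t. f t * \<phi> t)"
proof (rule Bochner_Integration.integrable_bound[OF integrable_norm[OF integrable_mult_right[OF assms(1), of "of_real K"]]])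
  show "AE t in lebesgue. norm (f t * \<phi> t) \<le> norm (norm (of_real K * \<phi> t))"
    using assms(3) order_trans[OF norm_ge_zero assms(3)] by (auto simp: norm_mult intro!: AE_I2 mult_right_mono)
qed (use assms in measurable)

lemma fourier_integral_mult_integrable:
  assumes "integrable lebesgue f" "integrable lebesgue \<phi>"
  shows "integrable lebesgue (\<lambda>t. fourier_integral f t * \<phi> t)"
  by (rule bounded_mult_integrable[OF assms(2) _ fourier_integral_norm_le]) (use assms in measurable)

text \<open>Both sides are the double integral of \<open>f t * \<phi> x\<close> against the symmetric kernel $e^{-ixt}$.\<close>

lemma fourier_multiplication_formula:
  assumes f: "integrable lebesgue f" and \<phi>: "integrable lebesgue \<phi>"
  shows "(LINT t|lebesgue. fourier_integral f t * \<phi> t) = (LINT t|lebesgue. f t * fourier_integral \<phi> t)"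
proof -
  let ?K = "\<lambda>x t. \<phi> x * (f t * exp (- (\<i> * complex_of_real x * complex_of_real t)))"
  have [measurable]: "f \<in> borel_measurable lebesgue" "\<phi> \<in> borel_measurable lebesgue" using f \<phi> by auto
  have I: "integrable (lebesgue \<Otimes>\<^sub>M lebesgue) (case_prod ?K)"
  proof (rule leb2.Fubini_integrable)
    show "integrable lebesgue (\<lambda>x. LINT t|lebesgue. norm (case_prod ?K (x, t)))"
      using f \<phi> by (simp add: norm_mult)
    show "AE x in lebesgue. integrable lebesgue (\<lambda>t. case_prod ?K (x, t))"
      using fourier_kernel_integrable[OF f] by simp
  qed measurable
  have "(LINT x|lebesgue. LINT t|lebesgue. ?K x t) = (LINT t|lebesgue. LINT x|lebesgue. ?K x t)"
    using leb2.Fubini_integral[OF I] by simp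
  moreover have "(LINT x|lebesgue. LINT t|lebesgue. ?K x t) = of_real (sqrt (2 * pi)) * (LINT t|lebesgue. fourier_integral f t * \<phi> t)"
    by (simp add: fourier_integral_def mult_ac)
  moreover have "(LINT t|lebesgue. LINT x|lebesgue. ?K x t) = (LINT t|lebesgue. of_real (sqrt (2 * pi)) * (f t * fourier_integral \<phi> t))"
  proof (intro Bochner_Integration.integral_cong refl)
    fix t
    have "(LINT x|lebesgue. ?K x t) = (LINT x|lebesgue. f t * (\<phi> x * exp (- (\<i> * complex_of_real t * complex_of_real x))))"
      by (intro Bochner_Integration.integral_cong) (auto simp: mult_ac)
    then show "(LINT x|lebesgue. ?K x t) = of_real (sqrt (2 * pi)) * (f t * fourier_integral \<phi> t)"
      by (simp add: fourier_integral_def)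
  qed
  ultimately show ?thesis by simp
qed

lemma poisson_integral_eq_fourier:
  assumes h: "integrable lebesgue h" and z: "0 < Im z"
  shows "(LINT t|lebesgue. fourier_integral h t * poisson_exp z t) = of_real (sqrt (2 * pi)) * poisson_integral h z"
proof -
  have i: "integrable lebesgue (upper_exp z)" "integrable lebesgue (lower_exp z)" "integrable lebesgue (poisson_exp z)"
    using upper_exp_test[OF z] lower_exp_test[OF z] poisson_exp_test[OF z] by (auto simp: test_function_def)
  have "fourier_integral (poisson_exp z) s = of_real (sqrt (2 * pi) * poisson_kernel z s)" for s
  proof -
    have "fourier_integral (poisson_exp z) s = fourier_integral (\<lambda>t. upper_exp z t + lower_exp z t) s"
      unfolding fourier_integral_def
      using i poisson_exp_AE[of z] by (intro arg_cong2[where f="(*)"] refl integral_cong_AE) (auto elim: eventually_mono)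
    also have "\<dots> = of_real (sqrt (2 * pi)) * (1 / (2 * pi * \<i>) * (1 / (of_real s - z) - 1 / (of_real s - cnj z)))"
      unfolding fourier_integral_add[OF i(1,2)] fourier_integral_upper_exp[OF z] fourier_integral_lower_exp[OF z]
      by (simp only: right_diff_distrib) simp
    finally show ?thesis unfolding poisson_kernel_eq_cauchy[OF z, symmetric] by simp
  qed
  then have "(\<lambda>s. h s * fourier_integral (poisson_exp z) s) = (\<lambda>s. of_real (sqrt (2 * pi)) * (poisson_kernel z s *\<^sub>R h s))"
    by (auto simp: scaleR_conv_of_real)
  then show ?thesis
    unfolding fourier_multiplication_formula[OF h i(3)] poisson_integral_def
    by (simp only: integral_mult_right_zero)
qed

lemma Lp_2_iff: "f \<in> Lp 2 \<longleftrightarrow> f \<in> borel_measurable lebesgue \<and> integrable lebesgue (\<lambda>x. (norm (f x))\<^sup>2)"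
proof -
  have "norm (f x) powr 2 = (norm (f x))\<^sup>2" for x
    by (cases "f x = 0") (auto simp: powr_numeral)
  then show ?thesis by (simp add: Lp_def)
qed

lemma fourier_integral_cnj_mult:
  assumes "integrable lebesgue h"
  shows "fourier_integral (\<lambda>t. cnj (fourier_integral h t) * of_real (exp (- y * \<bar>t\<bar>))) s =
    1 / of_real (sqrt (2 * pi)) * cnj (LINT t|lebesgue. fourier_integral h t * poisson_exp (Complex s y) t)"
proof -
  have "(LINT t|lebesgue. cnj (fourier_integral h t) * of_real (exp (- y * \<bar>t\<bar>)) * exp (- (\<i> * of_real s * of_real t))) =
    (LINT t|lebesgue. cnj (fourier_integral h t * poisson_exp (Complex s y) t))"
    by (intro Bochner_Integration.integral_cong)
       (auto simp: poisson_exp_def exp_cnj exp_diff exp_minus field_simps simp flip: exp_of_real)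
  also have "\<dots> = cnj (LINT t|lebesgue. fourier_integral h t * poisson_exp (Complex s y) t)"
    by (rule Bochner_Integration.integral_cnj)
  finally show ?thesis
    by (subst fourier_integral_def) (simp only:)
qed

text \<open>The multiplication formula with test function $\overline{\hat h(t)} e^{-y|t|}$ turns the integral of
  $|\hat h(t)|^2 e^{-y|t|}$ into the inner product of \<open>h\<close> with its own Poisson integral at height \<open>y\<close>,
  which is a contraction of $L^2$. The weight guarantees that the test function is integrable.\<close>

lemma Bessel_weighted:
  assumes h: "integrable lebesgue h" "integrable lebesgue (\<lambda>t. (norm (h t))\<^sup>2)" and y: "0 < y"
  shows "integrable lebesgue (\<lambda>t. (norm (fourier_integral h t))\<^sup>2 * exp (- y * \<bar>t\<bar>))"
    and "(LINT t|lebesgue. (norm (fourier_integral h t))\<^sup>2 * exp (- y * \<bar>t\<bar>)) \<le> (LINT t|lebesgue. (norm (h t))\<^sup>2)"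
proof -
  have [measurable]: "h \<in> borel_measurable lebesgue" using h by auto
  have z: "0 < Im (Complex s y)" for s using y by simp
  have h2: "h \<in> Lp 2" using h by (simp add: Lp_2_iff)
  define \<phi> where "\<phi> t = cnj (fourier_integral h t) * of_real (exp (- y * \<bar>t\<bar>))" for t
  define P where "P s = poisson_integral h (Complex s y)" for s
  have [measurable]: "P \<in> borel_measurable lebesgue"
    unfolding P_def by (rule poisson_integral_measurable_line) measurable
  have exp_eq: "of_real (exp (- y * \<bar>t\<bar>)) = poisson_exp (Complex 0 y) t" for t
    by (simp add: poisson_exp_def exp_of_real[symmetric])
  have i\<phi>: "integrable lebesgue \<phi>"
    unfolding \<phi>_def exp_eq
  proof (rule bounded_mult_integrable)
    show "integrable lebesgue (poisson_exp (Complex 0 y))"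
      using poisson_exp_test[OF z[of 0]] by (simp add: test_function_def)
    show "norm (cnj (fourier_integral h t)) \<le> 1 / sqrt (2 * pi) * (LINT t|lebesgue. norm (h t))" for t
      using fourier_integral_norm_le[of h t] by simp
    show "(\<lambda>t. cnj (fourier_integral h t)) \<in> borel_measurable lebesgue"
      by (rule measurable_compose[OF fourier_integral_measurable borel_measurable_continuous_onI])
         (auto intro!: continuous_intros)
  qed
  have \<phi>hat: "fourier_integral \<phi> s = cnj (P s)" for s
    unfolding \<phi>_def fourier_integral_cnj_mult[OF h(1)] poisson_integral_eq_fourier[OF h(1) z] P_def by simp
  have eq: "fourier_integral h t * \<phi> t = of_real ((norm (fourier_integral h t))\<^sup>2 * exp (- y * \<bar>t\<bar>))" for t
    unfolding \<phi>_def by (simp only: of_real_mult complex_norm_square mult.assoc)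
  have "integrable lebesgue (\<lambda>t. complex_of_real ((norm (fourier_integral h t))\<^sup>2 * exp (- y * \<bar>t\<bar>)))"
    using fourier_integral_mult_integrable[OF h(1) i\<phi>] unfolding eq .
  then show "integrable lebesgue (\<lambda>t. (norm (fourier_integral h t))\<^sup>2 * exp (- y * \<bar>t\<bar>))"
    using integrable_Re by fastforce
  have P2: "integrable lebesgue (\<lambda>s. (norm (P s))\<^sup>2)" "(LINT s|lebesgue. (norm (P s))\<^sup>2) \<le> (LINT s|lebesgue. (norm (h s))\<^sup>2)"
  proof -
    have e: "norm (w::complex) powr 2 = (norm w)\<^sup>2" for w
      by (cases "w = 0") (auto simp: powr_numeral)
    show "integrable lebesgue (\<lambda>s. (norm (P s))\<^sup>2)" "(LINT s|lebesgue. (norm (P s))\<^sup>2) \<le> (LINT s|lebesgue. (norm (h s))\<^sup>2)"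
      using poisson_integral_Lp_contraction[OF _ _ h2 y] unfolding P_def e by auto
  qed
  have "complex_of_real (LINT t|lebesgue. (norm (fourier_integral h t))\<^sup>2 * exp (- y * \<bar>t\<bar>)) = (LINT t|lebesgue. fourier_integral h t * \<phi> t)"
    unfolding eq by (rule integral_complex_of_real[symmetric])
  also have "\<dots> = (LINT s|lebesgue. h s * cnj (P s))"
    unfolding fourier_multiplication_formula[OF h(1) i\<phi>] \<phi>hat ..
  finally have "\<bar>LINT t|lebesgue. (norm (fourier_integral h t))\<^sup>2 * exp (- y * \<bar>t\<bar>)\<bar> = norm (LINT s|lebesgue. h s * cnj (P s))"
    by (metis norm_of_real)
  also have "\<dots> \<le> (LINT s|lebesgue. 1 / 2 * (norm (h s))\<^sup>2 + 1 / 2 * (norm (P s))\<^sup>2)"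
  proof (rule norm_integral_le_of_bound)
    show "integrable lebesgue (\<lambda>s. 1 / 2 * (norm (h s))\<^sup>2 + 1 / 2 * (norm (P s))\<^sup>2)"
      using h P2 by (intro Bochner_Integration.integrable_add integrable_mult_right)
    show "norm (h s * cnj (P s)) \<le> 1 / 2 * (norm (h s))\<^sup>2 + 1 / 2 * (norm (P s))\<^sup>2" for s
      using sum_squares_bound[of "norm (h s)" "norm (P s)"] by (simp add: norm_mult)
  qed
  also have "\<dots> = 1 / 2 * (LINT s|lebesgue. (norm (h s))\<^sup>2) + 1 / 2 * (LINT s|lebesgue. (norm (P s))\<^sup>2)"
    using h P2 by simp
  also have "\<dots> \<le> (LINT s|lebesgue. (norm (h s))\<^sup>2)" using P2 by simp
  finally show "(LINT t|lebesgue. (norm (fourier_integral h t))\<^sup>2 * exp (- y * \<bar>t\<bar>)) \<le> (LINT t|lebesgue. (norm (h t))\<^sup>2)"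
    by linarith
qed

text \<open>Let the weight tend to 1 and apply Fatou's lemma.\<close>

lemma Bessel_inequality:
  assumes h: "test_function h"
  shows "integrable lebesgue (\<lambda>t. (norm (fourier_integral h t))\<^sup>2)"
    and "(LINT t|lebesgue. (norm (fourier_integral h t))\<^sup>2) \<le> (LINT t|lebesgue. (norm (h t))\<^sup>2)"
proof -
  have h: "integrable lebesgue h" "integrable lebesgue (\<lambda>t. (norm (h t))\<^sup>2)" using assms by (auto simp: test_function_def)
  have [measurable]: "h \<in> borel_measurable lebesgue" using h by auto
  let ?B = "LINT t|lebesgue. (norm (h t))\<^sup>2"
  let ?w = "\<lambda>n t. (norm (fourier_integral h t))\<^sup>2 * exp (- (1 / real (Suc n)) * \<bar>t\<bar>)"
  have "(\<integral>\<^sup>+t. ennreal ((norm (fourier_integral h t))\<^sup>2) \<partial>lebesgue) = (\<integral>\<^sup>+t. liminf (\<lambda>n. ennreal (?w n t)) \<partial>lebesgue)"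
  proof (intro nn_integral_cong)
    fix t :: real
    have "(\<lambda>n. exp (- (1 / real (Suc n)) * \<bar>t\<bar>)) \<longlonglongrightarrow> exp (- 0 * \<bar>t\<bar>)"
      by (intro tendsto_intros LIMSEQ_Suc lim_1_over_n)
    then have "(\<lambda>n. ?w n t) \<longlonglongrightarrow> (norm (fourier_integral h t))\<^sup>2 * exp (- 0 * \<bar>t\<bar>)"
      by (intro tendsto_mult tendsto_const)
    then have "(\<lambda>n. ennreal (?w n t)) \<longlonglongrightarrow> ennreal ((norm (fourier_integral h t))\<^sup>2)"
      by (intro tendsto_ennrealI) simp
    then show "ennreal ((norm (fourier_integral h t))\<^sup>2) = liminf (\<lambda>n. ennreal (?w n t))"
      by (intro lim_imp_Liminf[symmetric]) auto
  qed
  also have "\<dots> \<le> liminf (\<lambda>n. \<integral>\<^sup>+t. ennreal (?w n t) \<partial>lebesgue)"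
  proof (rule nn_integral_liminf)
    fix n
    show "(\<lambda>t. ennreal (?w n t)) \<in> borel_measurable lebesgue"
      using borel_measurable_integrable[OF Bessel_weighted(1)[OF h, of "1 / real (Suc n)"]] by simp
  qed
  also have "\<dots> \<le> ennreal ?B"
  proof (rule Liminf_le)
    show "\<forall>\<^sub>F n in sequentially. (\<integral>\<^sup>+t. ennreal (?w n t) \<partial>lebesgue) \<le> ennreal ?B"
    proof (rule always_eventually, rule allI)
      fix n
      have y: "0 < 1 / real (Suc n)" by simp
      show "(\<integral>\<^sup>+t. ennreal (?w n t) \<partial>lebesgue) \<le> ennreal ?B"
        using Bessel_weighted[OF h y] by (subst nn_integral_eq_integral) (auto intro: ennreal_leI)
    qed
  qed auto
  finally have le: "(\<integral>\<^sup>+t. ennreal ((norm (fourier_integral h t))\<^sup>2) \<partial>lebesgue) \<le> ennreal ?B" .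
  show i: "integrable lebesgue (\<lambda>t. (norm (fourier_integral h t))\<^sup>2)"
    by (rule integrableI_nonneg) (use le in \<open>auto simp: top_unique less_top[symmetric]\<close>)
  show "(LINT t|lebesgue. (norm (fourier_integral h t))\<^sup>2) \<le> ?B"
    using le by (subst (asm) nn_integral_eq_integral[OF i])
      (auto simp: ennreal_le_iff Bochner_Integration.integral_nonneg)
qed

lemma fourier_integral_bounded_L2:
  assumes "test_function \<phi>"
  shows "bounded_L2 (fourier_integral \<phi>)"
proof (rule bounded_L2I[OF _ fourier_integral_norm_le Bessel_inequality(1)[OF assms]])
  show "fourier_integral \<phi> \<in> borel_measurable lebesgue"
    using assms by (auto simp: test_function_def)
qed

section \<open>Existence of the Fourier transform\<close>

text \<open>The Fourier transform in the sense of distributions, but with the larger class $L^1 \cap L^2$ of test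
  functions.\<close>

definition weak_fourier :: "(real \<Rightarrow> complex) \<Rightarrow> (real \<Rightarrow> complex) \<Rightarrow> bool" where
  "weak_fourier f g \<longleftrightarrow> g \<in> borel_measurable lebesgue \<and> (\<forall>\<phi>. test_function \<phi> \<longrightarrow>
     integrable lebesgue (\<lambda>t. g t * \<phi> t) \<and>
     (LINT t|lebesgue. g t * \<phi> t) = (LINT t|lebesgue. f t * fourier_integral \<phi> t))"

lemma weak_fourier_integrable:
  assumes "integrable lebesgue f"
  shows "weak_fourier f (fourier_integral f)"
  unfolding weak_fourier_def test_function_def
  using assms fourier_integral_mult_integrable[OF assms] fourier_multiplication_formula[OF assms] by auto

lemma weak_fourier_cong_AE:
  assumes "weak_fourier f g" "AE t in lebesgue. g t = g' t" "g' \<in> borel_measurable lebesgue"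
  shows "weak_fourier f g'"
  unfolding weak_fourier_def
proof (intro conjI allI impI)
  fix \<phi> assume \<phi>: "test_function \<phi>"
  have [measurable]: "g \<in> borel_measurable lebesgue" "g' \<in> borel_measurable lebesgue" "\<phi> \<in> borel_measurable lebesgue"
    using assms \<phi> by (auto simp: weak_fourier_def test_function_def)
  have ae: "AE t in lebesgue. g t * \<phi> t = g' t * \<phi> t" using assms(2) by (auto elim: eventually_mono)
  have i: "integrable lebesgue (\<lambda>t. g t * \<phi> t)" "(LINT t|lebesgue. g t * \<phi> t) = (LINT t|lebesgue. f t * fourier_integral \<phi> t)"
    using assms \<phi> by (auto simp: weak_fourier_def)
  show "integrable lebesgue (\<lambda>t. g' t * \<phi> t)"
    by (rule integrable_cong_AE_imp[OF i(1)]) (use ae in \<open>auto elim: eventually_mono\<close>)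
  show "(LINT t|lebesgue. g' t * \<phi> t) = (LINT t|lebesgue. f t * fourier_integral \<phi> t)"
    unfolding i(2)[symmetric] by (rule integral_cong_AE) (use ae in \<open>auto elim: eventually_mono\<close>)
qed fact

lemma AE_summable_integrable:
  fixes u :: "nat \<Rightarrow> 'a \<Rightarrow> real"
  assumes i: "\<And>n. integrable M (u n)" and nn: "\<And>n x. 0 \<le> u n x" and s: "summable (\<lambda>n. integral\<^sup>L M (u n))"
  shows "AE x in M. summable (\<lambda>n. u n x)"
proof -
  have [measurable]: "u n \<in> borel_measurable M" for n using i by auto
  have "(\<integral>\<^sup>+x. (\<Sum>n. ennreal (u n x)) \<partial>M) = (\<Sum>n. \<integral>\<^sup>+x. ennreal (u n x) \<partial>M)"
    by (rule nn_integral_suminf) auto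
  also have "\<dots> = (\<Sum>n. ennreal (integral\<^sup>L M (u n)))"
    using nn by (intro suminf_cong nn_integral_eq_integral i) auto
  also have "\<dots> \<noteq> top"
    using s nn by (intro ennreal_suminf_neq_top) auto
  finally have "(\<integral>\<^sup>+x. (\<Sum>n. ennreal (u n x)) \<partial>M) \<noteq> \<infinity>" by simp
  then have "AE x in M. (\<Sum>n. ennreal (u n x)) \<noteq> \<infinity>"
    by (intro nn_integral_PInf_AE) auto
  then show ?thesis
    by eventually_elim (use nn in \<open>auto intro: summable_suminf_not_top\<close>)
qed

text \<open>The arithmetic-geometric mean inequality is used with weights $2^n$ and $2^{-n}$; the norms decrease
  like $2^{-n}$, so both resulting series converge.\<close>

lemma geometric_L2_pairing:
  fixes u :: "nat \<Rightarrow> real \<Rightarrow> complex"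
  assumes [measurable]: "\<And>n. u n \<in> borel_measurable lebesgue" "v \<in> borel_measurable lebesgue"
    and u: "\<And>n. integrable lebesgue (\<lambda>t. (norm (u n t))\<^sup>2)" "\<And>n. (LINT t|lebesgue. (norm (u n t))\<^sup>2) \<le> (1 / 4) ^ n"
    and v: "integrable lebesgue (\<lambda>t. (norm (v t))\<^sup>2)"
  shows "\<And>n. integrable lebesgue (\<lambda>t. u n t * v t)"
    and "summable (\<lambda>n. LINT t|lebesgue. norm (u n t * v t))"
    and "AE t in lebesgue. summable (\<lambda>n. norm (u n t * v t))"
proof -
  let ?V = "LINT t|lebesgue. (norm (v t))\<^sup>2"
  have b: "norm (u n t * v t) \<le> 2 ^ n * (norm (u n t))\<^sup>2 + (1 / 2) ^ n * (norm (v t))\<^sup>2" for n t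
  proof -
    have "0 \<le> 2 ^ n * (norm (u n t) - (1 / 2) ^ n * norm (v t))\<^sup>2" by simp
    also have "\<dots> = 2 ^ n * (norm (u n t))\<^sup>2 + (1 / 2) ^ n * (norm (v t))\<^sup>2 - 2 * (norm (u n t) * norm (v t))"
      by (simp add: power2_diff power_mult_distrib algebra_simps power_divide) (simp add: power2_eq_square)
    finally show ?thesis by (simp add: norm_mult) (smt (verit) mult_nonneg_nonneg norm_ge_zero)
  qed
  have ib: "integrable lebesgue (\<lambda>t. 2 ^ n * (norm (u n t))\<^sup>2 + (1 / 2) ^ n * (norm (v t))\<^sup>2)" for n
    using u v by (intro Bochner_Integration.integrable_add integrable_mult_right)
  show i: "integrable lebesgue (\<lambda>t. u n t * v t)" for n
  proof (rule Bochner_Integration.integrable_bound[OF ib])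
    show "AE t in lebesgue. norm (u n t * v t) \<le> norm (2 ^ n * (norm (u n t))\<^sup>2 + (1 / 2) ^ n * (norm (v t))\<^sup>2)"
      using b[of n] by (auto intro!: AE_I2)
  qed measurable
  show s: "summable (\<lambda>n. LINT t|lebesgue. norm (u n t * v t))"
  proof (rule summable_comparison_test')
    show "summable (\<lambda>n. (1 / 2) ^ n * (1 + ?V))"
      by (intro summable_mult2 summable_geometric) auto
    show "norm (LINT t|lebesgue. norm (u n t * v t)) \<le> (1 / 2) ^ n * (1 + ?V)" for n
    proof -
      have "(LINT t|lebesgue. norm (u n t * v t)) \<le> (LINT t|lebesgue. 2 ^ n * (norm (u n t))\<^sup>2 + (1 / 2) ^ n * (norm (v t))\<^sup>2)"
        using b i by (intro integral_mono ib integrable_norm)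
      also have "\<dots> = 2 ^ n * (LINT t|lebesgue. (norm (u n t))\<^sup>2) + (1 / 2) ^ n * ?V"
        using u v by simp
      also have "\<dots> \<le> 2 ^ n * (1 / 4) ^ n + (1 / 2) ^ n * ?V"
        using u by (intro add_mono mult_left_mono) auto
      also have "2 ^ n * (1 / 4) ^ n = ((1 / 2) ^ n :: real)" by (simp add: power_mult_distrib[symmetric])
      finally show ?thesis by (simp add: algebra_simps)
    qed
  qed
  show "AE t in lebesgue. summable (\<lambda>n. norm (u n t * v t))"
    by (rule AE_summable_integrable) (use i s in auto)
qed

lemma Lp2_mult_integrable:
  assumes "integrable lebesgue (\<lambda>x. (norm (f x))\<^sup>2)" "f \<in> borel_measurable lebesgue" "bounded_L2 k"
  shows "integrable lebesgue (\<lambda>s. f s * k s :: complex)"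
  by (rule Lp_mult_integrable[of 2]) (use assms in \<open>auto simp: Lp_2_iff\<close>)

lemma L2_tail:
  fixes f :: "real \<Rightarrow> complex"
  assumes [measurable]: "f \<in> borel_measurable lebesgue" and f: "integrable lebesgue (\<lambda>x. (norm (f x))\<^sup>2)"
  shows "(\<lambda>n. LINT x|lebesgue. (norm (f x))\<^sup>2 * indicator {x. real n \<le> \<bar>x\<bar>} x) \<longlonglongrightarrow> 0"
proof -
  have "(\<lambda>n. LINT x|lebesgue. (norm (f x))\<^sup>2 * indicator {x. real n \<le> \<bar>x\<bar>} x) \<longlonglongrightarrow> integral\<^sup>L lebesgue (\<lambda>x::real. 0::real)"
  proof (rule integral_dominated_convergence[where w="\<lambda>x. (norm (f x))\<^sup>2"])
    show "AE x in lebesgue. (\<lambda>n. (norm (f x))\<^sup>2 * indicator {x. real n \<le> \<bar>x\<bar>} x) \<longlonglongrightarrow> 0"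
    proof (rule AE_I2)
      fix x :: real
      obtain N where "\<bar>x\<bar> < real N" using reals_Archimedean2 by blast
      then have "\<forall>\<^sub>F n in sequentially. (norm (f x))\<^sup>2 * indicator {x. real n \<le> \<bar>x\<bar>} x = 0"
        by (intro eventually_sequentiallyI[of N]) (auto simp: indicator_def)
      then show "(\<lambda>n. (norm (f x))\<^sup>2 * indicator {x. real n \<le> \<bar>x\<bar>} x) \<longlonglongrightarrow> 0"
        by (rule tendsto_eventually)
    qed
    show "AE x in lebesgue. norm ((norm (f x))\<^sup>2 * indicator {x. real n \<le> \<bar>x\<bar>} x) \<le> (norm (f x))\<^sup>2" for n
      by (auto simp: indicator_def)
    have [measurable]: "{x::real. real n \<le> \<bar>x\<bar>} \<in> sets borel" for n by measurable
    show "(\<lambda>x. (norm (f x))\<^sup>2 * indicator {x. real n \<le> \<bar>x\<bar>} x) \<in> borel_measurable lebesgue" for n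
      by (intro borel_measurable_times borel_measurable_indicator) auto
  qed (use f in auto)
  then show ?thesis by simp
qed

text \<open>Cutting \<open>f\<close> at radii \<open>N k\<close> where the tails in $L^2$ are geometrically small makes \<open>f\<close> a series
  of integrable pieces \<open>h k\<close>. By Bessel's inequality their transforms have norms that are as small, so the
  transformed series converges almost everywhere and can be integrated term by term against test functions.\<close>

lemma weak_fourier_exists_L2:
  assumes fm [measurable]: "f \<in> borel_measurable lebesgue" and f: "integrable lebesgue (\<lambda>x. (norm (f x))\<^sup>2)"
  shows "\<exists>g. weak_fourier f g"
proof -
  let ?tail = "\<lambda>n. LINT x|lebesgue. (norm (f x))\<^sup>2 * indicator {x. real n \<le> \<bar>x\<bar>} x"
  have "\<exists>M. \<forall>n\<ge>M. ?tail n \<le> (1 / 4) ^ k" for k :: nat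
  proof -
    have "\<forall>\<^sub>F n in sequentially. ?tail n < (1 / 4) ^ k"
      using L2_tail[OF fm f] by (rule order_tendstoD) simp
    then show ?thesis unfolding eventually_sequentially by (auto intro: less_imp_le)
  qed
  then obtain M where M: "\<And>k n. M k \<le> n \<Longrightarrow> ?tail n \<le> (1 / 4) ^ k" by metis
  \<comment> \<open>at least \<open>M k\<close>, monotone and unbounded\<close>
  define N where "N k = k + (\<Sum>j\<le>k. M j)" for k
  have N: "M k \<le> N k" "k \<le> N k" for k
    unfolding N_def using member_le_sum[of k "{..k}" M] by auto
  have N_mono: "N k \<le> N (Suc k)" for k unfolding N_def by auto
  define F where "F k x = (if \<bar>x\<bar> < real (N k) then f x else 0)" for k x
  define h where "h k x = F (Suc k) x - F k x" for k x
  have [measurable]: "F k \<in> borel_measurable lebesgue" for k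
  proof -
    have "{x::real. \<bar>x\<bar> < real (N k)} \<in> sets borel" by measurable
    then have "Measurable.pred lebesgue (\<lambda>x. \<bar>x\<bar> < real (N k))" by (auto simp: pred_def)
    then show ?thesis unfolding F_def by measurable
  qed
  have [measurable]: "h k \<in> borel_measurable lebesgue" for k unfolding h_def by measurable
  have h_le: "norm (h k x) \<le> norm (f x)" "(norm (h k x))\<^sup>2 \<le> (norm (f x))\<^sup>2 * indicator {x. real (N k) \<le> \<bar>x\<bar>} x" for k x
    using N_mono[of k] by (auto simp: h_def F_def indicator_def)
  have F_le: "norm (F k x) \<le> norm (f x)" for k x by (simp add: F_def)
  have sq_int: "integrable lebesgue (\<lambda>x. (norm (u x))\<^sup>2)" if "u \<in> borel_measurable lebesgue" "\<And>x. norm (u x) \<le> norm (f x)" for u :: "real \<Rightarrow> complex"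
    by (rule Bochner_Integration.integrable_bound[OF f]) (use that in \<open>auto intro!: AE_I2 power_mono\<close>)
  have F_int: "integrable lebesgue (F k)" for k
  proof -
    have "integrable lebesgue (\<lambda>x. F k x * indicator {- real (N k)..real (N k)} x)"
      by (rule Lp2_mult_integrable[OF sq_int _ indicator_bounded_L2]) (auto simp: F_le)
    also have "(\<lambda>x. F k x * indicator {- real (N k)..real (N k)} x) = F k"
      by (auto simp: F_def indicator_def fun_eq_iff abs_less_iff)
    finally show ?thesis .
  qed
  have h_int: "integrable lebesgue (h k)" for k
    unfolding h_def[abs_def] by (intro Bochner_Integration.integrable_diff F_int)
  have h_test: "test_function (h k)" for k
    unfolding test_function_def using h_int sq_int[of "h k"] h_le(1) by auto
  have h_sq: "(LINT x|lebesgue. (norm (h k x))\<^sup>2) \<le> (1 / 4) ^ k" for k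
  proof -
    have "(LINT x|lebesgue. (norm (h k x))\<^sup>2) \<le> ?tail (N k)"
    proof (rule integral_mono)
      show "integrable lebesgue (\<lambda>x. (norm (f x))\<^sup>2 * indicator {x. real (N k) \<le> \<bar>x\<bar>} x)"
      proof (rule Bochner_Integration.integrable_bound[OF f])
        have [measurable]: "{x::real. real n \<le> \<bar>x\<bar>} \<in> sets borel" for n by measurable
        show "(\<lambda>x. (norm (f x))\<^sup>2 * indicator {x. real (N k) \<le> \<bar>x\<bar>} x) \<in> borel_measurable lebesgue"
          by (intro borel_measurable_times borel_measurable_indicator) auto
      qed (auto simp: indicator_def)
    qed (use h_le sq_int in auto)
    also have "\<dots> \<le> (1 / 4) ^ k" by (rule M[OF N(1)])
    finally show ?thesis .
  qed
  define H where "H k = fourier_integral (h k)" for k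
  have [measurable]: "H k \<in> borel_measurable lebesgue" for k unfolding H_def by measurable
  have H_sq: "integrable lebesgue (\<lambda>t. (norm (H k t))\<^sup>2)" "(LINT t|lebesgue. (norm (H k t))\<^sup>2) \<le> (1 / 4) ^ k" for k
    unfolding H_def using Bessel_inequality[OF h_test] h_sq by (auto intro: order_trans)
  define g where "g t = fourier_integral (F 0) t + (\<Sum>k. H k t)" for t
  \<comment> \<open>pairing with a test function that has no zeros gives summability of the transforms themselves\<close>
  have H_summable: "AE t in lebesgue. summable (\<lambda>k. H k t)"
  proof -
    have t: "test_function (poisson_exp \<i>)" by (rule poisson_exp_test) simp
    have "AE t in lebesgue. summable (\<lambda>k. norm (H k t * poisson_exp \<i> t))"
      by (rule geometric_L2_pairing) (use t H_sq in \<open>auto simp: test_function_def\<close>)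
    then show ?thesis
    proof eventually_elim
      case (elim t)
      have "summable (\<lambda>k. norm (H k t))"
        using summable_mult2[OF elim, of "inverse (norm (poisson_exp \<i> t))"]
        by (simp add: norm_mult mult.assoc poisson_exp_def)
      then show ?case by (rule summable_norm_cancel)
    qed
  qed
  have h_sums: "(\<lambda>k. h k x) sums (f x - F 0 x)" for x
  proof -
    obtain n where n: "\<bar>x\<bar> < real n" using reals_Archimedean2 by blast
    have "\<forall>\<^sub>F k in sequentially. F k x = f x"
    proof (rule eventually_sequentiallyI)
      fix k assume "n \<le> k"
      then have "real n \<le> real (N k)" using N(2)[of k] by simp
      then show "F k x = f x" using n by (simp add: F_def)
    qed
    then have "(\<lambda>k. F k x) \<longlonglongrightarrow> f x" by (rule tendsto_eventually)
    then show ?thesis unfolding h_def by (rule telescope_sums)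
  qed
  have "weak_fourier f g"
    unfolding weak_fourier_def
  proof (intro conjI allI impI)
    show "g \<in> borel_measurable lebesgue" unfolding g_def by measurable
    fix \<phi> assume \<phi>: "test_function \<phi>"
    have [measurable]: "\<phi> \<in> borel_measurable lebesgue" and i\<phi>: "integrable lebesgue \<phi>"
      and s\<phi>: "integrable lebesgue (\<lambda>t. (norm (\<phi> t))\<^sup>2)" using \<phi> by (auto simp: test_function_def)
    let ?\<psi> = "fourier_integral \<phi>"
    have h\<psi>: "integrable lebesgue (\<lambda>t. h k t * ?\<psi> t)" "summable (\<lambda>k. LINT t|lebesgue. norm (h k t * ?\<psi> t))"
      "AE t in lebesgue. summable (\<lambda>k. norm (h k t * ?\<psi> t))" for k
      using geometric_L2_pairing[of h ?\<psi>] h_test h_sq Bessel_inequality(1)[OF \<phi>] by (auto simp: test_function_def)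
    have H\<phi>: "integrable lebesgue (\<lambda>t. H k t * \<phi> t)" "summable (\<lambda>k. LINT t|lebesgue. norm (H k t * \<phi> t))"
      "AE t in lebesgue. summable (\<lambda>k. norm (H k t * \<phi> t))" for k
      using geometric_L2_pairing[of H \<phi>] H_sq s\<phi> by auto
    have F\<psi>: "integrable lebesgue (\<lambda>t. F 0 t * ?\<psi> t)"
      by (rule Lp2_mult_integrable[OF sq_int _ fourier_integral_bounded_L2[OF \<phi>]]) (auto simp: F_le)
    have F\<phi>: "integrable lebesgue (\<lambda>t. fourier_integral (F 0) t * \<phi> t)"
      by (rule fourier_integral_mult_integrable[OF F_int i\<phi>])
    have term_eq: "(LINT t|lebesgue. H k t * \<phi> t) = (LINT t|lebesgue. h k t * ?\<psi> t)" for k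
      unfolding H_def by (rule fourier_multiplication_formula[OF h_int i\<phi>])
    have 1: "integrable lebesgue (\<lambda>t. \<Sum>k. H k t * \<phi> t)" "(\<lambda>k. LINT t|lebesgue. H k t * \<phi> t) sums (LINT t|lebesgue. (\<Sum>k. H k t * \<phi> t))"
      using integrable_suminf[OF H\<phi>(1) H\<phi>(3) H\<phi>(2)] sums_integral[OF H\<phi>(1) H\<phi>(3) H\<phi>(2)] by auto
    have 2: "integrable lebesgue (\<lambda>t. \<Sum>k. h k t * ?\<psi> t)" "(\<lambda>k. LINT t|lebesgue. h k t * ?\<psi> t) sums (LINT t|lebesgue. (\<Sum>k. h k t * ?\<psi> t))"
      using integrable_suminf[OF h\<psi>(1) h\<psi>(3) h\<psi>(2)] sums_integral[OF h\<psi>(1) h\<psi>(3) h\<psi>(2)] by auto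
    have eq: "(LINT t|lebesgue. (\<Sum>k. H k t * \<phi> t)) = (LINT t|lebesgue. (\<Sum>k. h k t * ?\<psi> t))"
      using 1(2) 2(2) unfolding term_eq by (rule sums_unique2)
    have g\<phi>: "AE t in lebesgue. g t * \<phi> t = fourier_integral (F 0) t * \<phi> t + (\<Sum>k. H k t * \<phi> t)"
      using H_summable by eventually_elim (simp add: g_def distrib_right suminf_mult2)
    have f\<psi>: "(\<lambda>t. f t * ?\<psi> t) = (\<lambda>t. F 0 t * ?\<psi> t + (\<Sum>k. h k t * ?\<psi> t))"
    proof
      fix t
      have "(\<Sum>k. h k t * ?\<psi> t) = (f t - F 0 t) * ?\<psi> t"
        using sums_mult2[OF h_sums[of t], of "?\<psi> t"] by (rule sums_unique[symmetric])
      then show "f t * ?\<psi> t = F 0 t * ?\<psi> t + (\<Sum>k. h k t * ?\<psi> t)" by (simp add: algebra_simps)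
    qed
    have [measurable]: "g \<in> borel_measurable lebesgue" unfolding g_def by measurable
    show "integrable lebesgue (\<lambda>t. g t * \<phi> t)"
      by (rule integrable_cong_AE_imp[OF Bochner_Integration.integrable_add[OF F\<phi> 1(1)]])
         (use g\<phi> in \<open>auto elim: eventually_mono\<close>)
    have "(LINT t|lebesgue. g t * \<phi> t) = (LINT t|lebesgue. fourier_integral (F 0) t * \<phi> t + (\<Sum>k. H k t * \<phi> t))"
      using g\<phi> by (intro integral_cong_AE) auto
    also have "\<dots> = (LINT t|lebesgue. F 0 t * ?\<psi> t) + (LINT t|lebesgue. (\<Sum>k. h k t * ?\<psi> t))"
      using F\<phi> 1(1) eq fourier_multiplication_formula[OF F_int i\<phi>] by simp
    also have "\<dots> = (LINT t|lebesgue. f t * ?\<psi> t)"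
      unfolding f\<psi> using F\<psi> 2(1) by simp
    finally show "(LINT t|lebesgue. g t * \<phi> t) = (LINT t|lebesgue. f t * ?\<psi> t)" .
  qed
  then show ?thesis by blast
qed

text \<open>The part of \<open>f\<close> where it is larger than 1 is integrable, the rest is square integrable.\<close>

lemma weak_fourier_exists:
  assumes p: "1 \<le> p" "p \<le> 2" "f \<in> Lp p"
  shows "\<exists>g. weak_fourier f g"
proof -
  have [measurable]: "f \<in> borel_measurable lebesgue" and fi: "integrable lebesgue (\<lambda>x. norm (f x) powr p)"
    using p by (auto simp: Lp_def)
  define f1 where "f1 x = (if 1 < norm (f x) then f x else 0)" for x
  define f2 where "f2 x = (if 1 < norm (f x) then 0 else f x)" for x
  have f1m [measurable]: "f1 \<in> borel_measurable lebesgue" unfolding f1_def by measurable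
  have f2m [measurable]: "f2 \<in> borel_measurable lebesgue" unfolding f2_def by measurable
  have i1: "integrable lebesgue f1"
  proof (rule Bochner_Integration.integrable_bound[OF fi])
    show "AE x in lebesgue. norm (f1 x) \<le> norm (norm (f x) powr p)"
    proof (rule AE_I2)
      fix x
      show "norm (f1 x) \<le> norm (norm (f x) powr p)"
      proof (cases "1 < norm (f x)")
        case True
        then have "norm (f x) powr 1 \<le> norm (f x) powr p" using p by (intro powr_mono) auto
        then show ?thesis using True by (simp add: f1_def)
      qed (simp add: f1_def)
    qed
  qed measurable
  have i2: "integrable lebesgue (\<lambda>x. (norm (f2 x))\<^sup>2)"
  proof (rule Bochner_Integration.integrable_bound[OF fi])
    show "AE x in lebesgue. norm ((norm (f2 x))\<^sup>2) \<le> norm (norm (f x) powr p)"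
    proof (rule AE_I2)
      fix x
      show "norm ((norm (f2 x))\<^sup>2) \<le> norm (norm (f x) powr p)"
      proof (cases "1 < norm (f x) \<or> f x = 0")
        case False
        then have "norm (f x) powr 2 \<le> norm (f x) powr p" using p by (intro powr_mono') auto
        then show ?thesis using False by (simp add: f2_def powr_numeral)
      qed (auto simp: f2_def)
    qed
  qed measurable
  obtain g2 where g2: "weak_fourier f2 g2" using weak_fourier_exists_L2[OF f2m i2] by blast
  have g1: "weak_fourier f1 (fourier_integral f1)" by (rule weak_fourier_integrable[OF i1])
  have "weak_fourier f (\<lambda>t. fourier_integral f1 t + g2 t)"
    unfolding weak_fourier_def
  proof (intro conjI allI impI)
    have [measurable]: "g2 \<in> borel_measurable lebesgue" using g2 by (simp add: weak_fourier_def)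
    show "(\<lambda>t. fourier_integral f1 t + g2 t) \<in> borel_measurable lebesgue" by measurable
    fix \<phi> assume \<phi>: "test_function \<phi>"
    have 1: "integrable lebesgue (\<lambda>t. fourier_integral f1 t * \<phi> t)" "(LINT t|lebesgue. fourier_integral f1 t * \<phi> t) = (LINT t|lebesgue. f1 t * fourier_integral \<phi> t)"
      using g1 \<phi> by (auto simp: weak_fourier_def)
    have 2: "integrable lebesgue (\<lambda>t. g2 t * \<phi> t)" "(LINT t|lebesgue. g2 t * \<phi> t) = (LINT t|lebesgue. f2 t * fourier_integral \<phi> t)"
      using g2 \<phi> by (auto simp: weak_fourier_def)
    have "integrable lebesgue (\<lambda>t. f1 t * fourier_integral \<phi> t)"
      using fourier_integral_mult_integrable[OF _ i1, of \<phi>] \<phi> by (simp add: test_function_def mult.commute)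
    moreover have "integrable lebesgue (\<lambda>t. f2 t * fourier_integral \<phi> t)"
      by (rule Lp2_mult_integrable[OF i2 _ fourier_integral_bounded_L2[OF \<phi>]]) measurable
    ultimately have "(LINT t|lebesgue. f1 t * fourier_integral \<phi> t + f2 t * fourier_integral \<phi> t) =
       (LINT t|lebesgue. f1 t * fourier_integral \<phi> t) + (LINT t|lebesgue. f2 t * fourier_integral \<phi> t)"
      by (rule Bochner_Integration.integral_add)
    moreover have "(\<lambda>t. f1 t * fourier_integral \<phi> t + f2 t * fourier_integral \<phi> t) = (\<lambda>t. f t * fourier_integral \<phi> t)"
      by (auto simp: f1_def f2_def)
    ultimately show "(LINT t|lebesgue. (fourier_integral f1 t + g2 t) * \<phi> t) = (LINT t|lebesgue. f t * fourier_integral \<phi> t)"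
      using 1 2 by (simp add: distrib_right)
    show "integrable lebesgue (\<lambda>t. (fourier_integral f1 t + g2 t) * \<phi> t)"
      using 1 2 by (simp add: distrib_right)
  qed
  then show ?thesis by blast
qed

section \<open>Uniqueness of the Fourier transform\<close>

lemma nontangential_cone_nontrivial:
  assumes "0 < a"
  shows "at (complex_of_real x) within nontangential_cone a x \<noteq> bot"
proof -
  have "complex_of_real x islimpt nontangential_cone a x"
    unfolding islimpt_approachable
  proof (intro allI impI)
    fix e :: real assume e: "0 < e"
    show "\<exists>x'\<in>nontangential_cone a x. x' \<noteq> complex_of_real x \<and> dist x' (complex_of_real x) < e"
    proof (intro bexI[of _ "Complex x (e / 2)"] conjI)
      have eq: "Complex x (e / 2) - complex_of_real x = \<i> * of_real (e / 2)" by (simp add: complex_eq_iff)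
      show "dist (Complex x (e / 2)) (complex_of_real x) < e"
        unfolding dist_norm eq using e by (simp add: norm_mult)
    qed (use e assms in \<open>auto simp: nontangential_cone_def complex_eq_iff\<close>)
  qed
  then show ?thesis by (simp add: trivial_limit_within)
qed

text \<open>The cones lie in the open upper half-plane, so only the values there enter.\<close>

lemma has_boundary_function_unique:
  assumes "has_boundary_function F f" "has_boundary_function G g" "\<And>z. 0 < Im z \<Longrightarrow> F z = G z"
  shows "AE x in lebesgue. f x = g x"
  using assms(1,2) unfolding has_boundary_function_def
proof eventually_elim
  case (elim x)
  have "(F \<longlongrightarrow> f x) (at (complex_of_real x) within nontangential_cone 1 x)"
    using elim(1) by (simp add: has_nontangential_limit_def)
  moreover have "\<forall>\<^sub>F z in at (complex_of_real x) within nontangential_cone 1 x. F z = G z"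
    by (auto simp: eventually_at_filter nontangential_cone_def intro!: always_eventually assms(3))
  ultimately have "(G \<longlongrightarrow> f x) (at (complex_of_real x) within nontangential_cone 1 x)"
    by (rule Lim_transform_eventually)
  moreover have "(G \<longlongrightarrow> g x) (at (complex_of_real x) within nontangential_cone 1 x)"
    using elim(2) by (simp add: has_nontangential_limit_def)
  ultimately show ?case
    using nontangential_cone_nontrivial[of 1 x] by (intro tendsto_unique) auto
qed

text \<open>The Poisson integral of \<open>k\<close> can be computed from its transform, so it vanishes; but its boundary
  function is \<open>k\<close>.\<close>

lemma fourier_integral_eq_0_imp_AE_0:
  assumes k: "integrable lebesgue k" and z: "\<And>x. fourier_integral k x = 0"
  shows "AE t in lebesgue. k t = 0"
proof -
  have "k \<in> Lp 1" using k by (auto simp: Lp_def)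
  then have "has_boundary_function (poisson_integral k) k" by (intro poisson_boundary_function[of 1]) auto
  moreover have "has_boundary_function (\<lambda>_. 0) (\<lambda>_. 0)"
    by (simp add: has_boundary_function_def has_nontangential_limit_def)
  moreover have "poisson_integral k w = 0" if "0 < Im w" for w
    using poisson_integral_eq_fourier[OF k that] by (simp add: z)
  ultimately show ?thesis by (rule has_boundary_function_unique)
qed

text \<open>From $(1 + x/n)^n \leq e^x$ one gets $|t|^n \leq n^n e^{|t|}$, and $|t| - t^2/2 \leq 1/2$.\<close>

lemma power_times_gaussian_bounded: "bounded (range (\<lambda>t::real. t ^ n * exp (- t\<^sup>2 / 2)))"
proof -
  have "\<bar>t ^ n * exp (- t\<^sup>2 / 2)\<bar> \<le> real n ^ n * exp (1 / 2)" for t :: real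
  proof -
    have "\<bar>t\<bar> ^ n \<le> real n ^ n * exp \<bar>t\<bar>"
    proof (cases "n = 0")
      case False
      have "(\<bar>t\<bar> / real n) ^ n \<le> (1 + \<bar>t\<bar> / real n) ^ n" by (intro power_mono) auto
      also have "\<dots> \<le> exp \<bar>t\<bar>" using False by (intro exp_ge_one_plus_x_over_n_power_n) auto
      finally show ?thesis using False by (simp add: power_divide divide_le_eq mult.commute)
    qed auto
    then have "\<bar>t\<bar> ^ n * exp (- t\<^sup>2 / 2) \<le> real n ^ n * exp \<bar>t\<bar> * exp (- t\<^sup>2 / 2)"
      by (intro mult_right_mono) auto
    also have "\<dots> = real n ^ n * exp (\<bar>t\<bar> - t\<^sup>2 / 2)" by (simp add: mult.assoc mult_exp_exp)
    also have "\<dots> \<le> real n ^ n * exp (1 / 2)"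
    proof (intro mult_left_mono iffD2[OF exp_le_cancel_iff])
      have "0 \<le> (\<bar>t\<bar> - 1)\<^sup>2" by simp
      then show "\<bar>t\<bar> - t\<^sup>2 / 2 \<le> 1 / 2" by (simp add: power2_diff)
    qed auto
    finally show ?thesis by (simp add: abs_mult power_abs)
  qed
  then show ?thesis unfolding bounded_iff by auto
qed

text \<open>All derivatives are polynomial multiples of the function itself; the recursion \<open>P\<close> computes
  the polynomials.\<close>

lemma schwartz_modulated_gaussian:
  "schwartz (\<lambda>t. exp (- (of_real t)\<^sup>2 / 2 - \<i> * of_real x * of_real t))"
proof -
  define E where "E t = exp (- (complex_of_real t)\<^sup>2 / 2 - \<i> * of_real x * of_real t)" for t
  define P :: "nat \<Rightarrow> complex poly" where "P = rec_nat 1 (\<lambda>_ q. pderiv q - [:\<i> * of_real x, 1:] * q)"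
  have P: "P 0 = 1" "\<And>n. P (Suc n) = pderiv (P n) - [:\<i> * of_real x, 1:] * P n" by (auto simp: P_def)
  define D where "D n t = poly (P n) (of_real t) * E t" for n t
  have E_norm: "norm (E t) = exp (- t\<^sup>2 / 2)" for t
    by (simp add: E_def)
  have D': "(D n has_vector_derivative D (Suc n) t) (at t)" for n t
  proof -
    have "((\<lambda>z. poly (P n) z * exp (- z\<^sup>2 / 2 - \<i> * of_real x * z)) has_field_derivative
      poly (pderiv (P n)) (of_real t) * exp (- (of_real t)\<^sup>2 / 2 - \<i> * of_real x * of_real t) +
      (- of_real t - \<i> * of_real x) * exp (- (of_real t)\<^sup>2 / 2 - \<i> * of_real x * of_real t) * poly (P n) (of_real t)) (at (of_real t))"
    proof (rule DERIV_mult[OF poly_DERIV])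
      have "((\<lambda>z. - z\<^sup>2 / 2 - \<i> * of_real x * z) has_field_derivative - of_real t - \<i> * of_real x) (at (complex_of_real t))"
        by (auto intro!: derivative_eq_intros)
      then have "((\<lambda>z. exp (- z\<^sup>2 / 2 - \<i> * of_real x * z)) has_field_derivative
          exp (- (of_real t)\<^sup>2 / 2 - \<i> * of_real x * of_real t) * (- of_real t - \<i> * of_real x)) (at (complex_of_real t))"
        by (rule DERIV_fun_exp)
      then show "((\<lambda>z. exp (- z\<^sup>2 / 2 - \<i> * of_real x * z)) has_field_derivative
          (- of_real t - \<i> * of_real x) * exp (- (of_real t)\<^sup>2 / 2 - \<i> * of_real x * of_real t)) (at (complex_of_real t))"
        by (simp only: mult.commute)
    qed
    then have "((\<lambda>t. poly (P n) (of_real t) * exp (- (of_real t)\<^sup>2 / 2 - \<i> * of_real x * of_real t)) has_vector_derivative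
      poly (pderiv (P n)) (of_real t) * exp (- (of_real t)\<^sup>2 / 2 - \<i> * of_real x * of_real t) +
      (- of_real t - \<i> * of_real x) * exp (- (of_real t)\<^sup>2 / 2 - \<i> * of_real x * of_real t) * poly (P n) (of_real t)) (at t)"
      by (rule has_vector_derivative_real_field)
    note that = this
    show ?thesis
    proof -
      have "D (Suc n) t = poly (pderiv (P n)) (of_real t) * E t + (- of_real t - \<i> * of_real x) * E t * poly (P n) (of_real t)"
        unfolding D_def P(2) by (simp add: algebra_simps)
      then show ?thesis using that unfolding D_def[abs_def] E_def by simp
    qed
  qed
  have bnd: "bounded (range (\<lambda>t. t ^ m *\<^sub>R (poly q (of_real t) * E t)))" for m and q :: "complex poly"
  proof (induction q arbitrary: m)
    case 0
    then show ?case by (auto simp: bounded_iff)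
  next
    case (pCons a q)
    obtain B where B: "\<And>t. norm (t ^ Suc m *\<^sub>R (poly q (of_real t) * E t)) \<le> B"
      using pCons.IH[of "Suc m"] unfolding bounded_iff by auto
    obtain B' where B': "\<And>t::real. norm (t ^ m * exp (- t\<^sup>2 / 2)) \<le> B'"
      using power_times_gaussian_bounded[of m] unfolding bounded_iff by auto
    have "norm (t ^ m *\<^sub>R (poly (pCons a q) (of_real t) * E t)) \<le> norm a * B' + B" for t
    proof -
      have "t ^ m *\<^sub>R (poly (pCons a q) (of_real t) * E t) = t ^ m *\<^sub>R (a * E t) + t ^ Suc m *\<^sub>R (poly q (of_real t) * E t)"
        by (simp add: scaleR_conv_of_real algebra_simps)
      also have "norm \<dots> \<le> norm (t ^ m *\<^sub>R (a * E t)) + norm (t ^ Suc m *\<^sub>R (poly q (of_real t) * E t))"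
        by (rule norm_triangle_ineq)
      also have "norm (t ^ m *\<^sub>R (a * E t)) = norm a * norm (t ^ m * exp (- t\<^sup>2 / 2))"
        by (simp add: norm_mult E_norm abs_mult)
      also have "\<dots> + norm (t ^ Suc m *\<^sub>R (poly q (of_real t) * E t)) \<le> norm a * B' + B"
        by (intro add_mono mult_left_mono B B') auto
      finally show ?thesis .
    qed
    then show ?case unfolding bounded_iff by auto
  qed
  show ?thesis
    unfolding schwartz_def
  proof (intro exI[of _ D] conjI allI)
    show "D 0 = (\<lambda>t. exp (- (of_real t)\<^sup>2 / 2 - \<i> * of_real x * of_real t))"
      by (simp add: D_def[abs_def] P(1) E_def)
    show "bounded (range (\<lambda>t. t ^ m *\<^sub>R D n t))" for m n unfolding D_def by (rule bnd)
  qed (rule D')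
qed

lemma schwartz_imp_test_function:
  assumes "schwartz \<phi>"
  shows "test_function \<phi>"
proof -
  obtain D where D: "D 0 = \<phi>" "\<And>n x. (D n has_vector_derivative D (Suc n) x) (at x)"
    "\<And>m n. bounded (range (\<lambda>x. x ^ m *\<^sub>R D n x))"
    using assms unfolding schwartz_def by blast
  have "continuous_on UNIV \<phi>"
    using D(2)[of 0] unfolding D(1) by (auto intro!: continuous_at_imp_continuous_on has_vector_derivative_continuous)
  then have [measurable]: "\<phi> \<in> borel_measurable borel" by (rule borel_measurable_continuous_onI)
  obtain A where A: "\<And>t. norm (\<phi> t) \<le> A" using D(3)[of 0 0] unfolding bounded_iff D(1) by auto
  obtain B where B: "\<And>t. t\<^sup>2 * norm (\<phi> t) \<le> B" using D(3)[of 2 0] unfolding bounded_iff D(1) by auto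
  have "integrable lebesgue \<phi>"
  proof (rule Bochner_Integration.integrable_bound)
    show "integrable lebesgue (\<lambda>t. (A + B) * pi * poisson_kernel \<i> t)"
      using poisson_kernel_integral[of \<i>] by (intro integrable_mult_right) (auto simp: has_bochner_integral_iff)
    show "AE t in lebesgue. norm (\<phi> t) \<le> norm ((A + B) * pi * poisson_kernel \<i> t)"
    proof (rule AE_I2)
      fix t :: real
      have pos: "0 < t\<^sup>2 + 1" by (intro add_nonneg_pos) auto
      have "norm (\<phi> t) * (t\<^sup>2 + 1) \<le> A + B" using A[of t] B[of t] by (simp add: algebra_simps)
      then have "norm (\<phi> t) \<le> (A + B) / (t\<^sup>2 + 1)" using pos by (simp add: pos_le_divide_eq)
      also have "\<dots> = (A + B) * pi * poisson_kernel \<i> t" by (simp add: poisson_kernel_def)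
      finally show "norm (\<phi> t) \<le> norm ((A + B) * pi * poisson_kernel \<i> t)" by simp
    qed
  qed measurable
  then show ?thesis using A by (rule test_functionI)
qed

text \<open>Multiplied by a fixed Gaussian, the difference of the two functions becomes integrable, and the
  modulations in the test functions show that its Fourier transform vanishes.\<close>

lemma schwartz_separating:
  assumes [measurable]: "g \<in> borel_measurable lebesgue" "g' \<in> borel_measurable lebesgue"
    and i: "\<And>\<phi>. schwartz \<phi> \<Longrightarrow> integrable lebesgue (\<lambda>t. g t * \<phi> t)" "\<And>\<phi>. schwartz \<phi> \<Longrightarrow> integrable lebesgue (\<lambda>t. g' t * \<phi> t)"
    and eq: "\<And>\<phi>. schwartz \<phi> \<Longrightarrow> (LINT t|lebesgue. g t * \<phi> t) = (LINT t|lebesgue. g' t * \<phi> t)"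
  shows "AE t in lebesgue. g t = g' t"
proof -
  define G where "G x t = exp (- (of_real t)\<^sup>2 / 2 - \<i> * of_real x * of_real t)" for x t :: real
  have S: "schwartz (G x)" for x unfolding G_def by (rule schwartz_modulated_gaussian)
  define k where "k t = g t * G 0 t - g' t * G 0 t" for t
  have k: "integrable lebesgue k" unfolding k_def by (intro Bochner_Integration.integrable_diff i S)
  have "fourier_integral k x = 0" for x
  proof -
    have "G x t = G 0 t * exp (- (\<i> * of_real x * of_real t))" for t
      unfolding G_def exp_add[symmetric] by simp
    then have "(\<lambda>t. k t * exp (- (\<i> * of_real x * of_real t))) = (\<lambda>t. g t * G x t - g' t * G x t)"
      by (simp add: k_def left_diff_distrib mult.assoc)
    then show ?thesis unfolding fourier_integral_def using i S eq[OF S] by simp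
  qed
  with k have "AE t in lebesgue. k t = 0" by (rule fourier_integral_eq_0_imp_AE_0)
  then show ?thesis by eventually_elim (simp add: k_def G_def)
qed

text \<open>The function chosen in the definition of \<open>fourier\<close> is tested against Schwartz functions only. By
  uniqueness it agrees almost everywhere with the transform constructed above, and so it may be paired
  with the discontinuous one-sided exponentials too.\<close>

lemma weak_fourier_fourier:
  assumes p: "1 \<le> p" "p \<le> 2" "f \<in> Lp p"
  shows "weak_fourier f (fourier f)"
proof (cases "integrable lebesgue f")
  case True
  have "fourier f = fourier_integral f" unfolding fourier_def if_P[OF True] ..
  then show ?thesis by (rule ssubst) (rule weak_fourier_integrable[OF True])
next
  case False
  define P where "P g \<longleftrightarrow> g \<in> borel_measurable lebesgue \<and>
             (\<forall>\<phi>. schwartz \<phi> \<longrightarrow> integrable lebesgue (\<lambda>t. g t * \<phi> t) \<and>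
               (LINT t|lebesgue. g t * \<phi> t) = (LINT t|lebesgue. f t * fourier_integral \<phi> t))" for g
  have PD: "g \<in> borel_measurable lebesgue" "schwartz \<phi> \<Longrightarrow> integrable lebesgue (\<lambda>t. g t * \<phi> t)"
    "schwartz \<phi> \<Longrightarrow> (LINT t|lebesgue. g t * \<phi> t) = (LINT t|lebesgue. f t * fourier_integral \<phi> t)" if "P g" for g \<phi>
    using that unfolding P_def by simp_all
  obtain g where g: "weak_fourier f g" using weak_fourier_exists[OF p] ..
  have Pg: "P g"
    unfolding P_def
  proof (intro conjI allI impI)
    show "g \<in> borel_measurable lebesgue" using g by (simp add: weak_fourier_def)
    fix \<phi> assume "schwartz \<phi>"
    then have "test_function \<phi>" by (rule schwartz_imp_test_function)
    with g show "integrable lebesgue (\<lambda>t. g t * \<phi> t)" "(LINT t|lebesgue. g t * \<phi> t) = (LINT t|lebesgue. f t * fourier_integral \<phi> t)"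
      by (simp_all add: weak_fourier_def)
  qed
  have "fourier f = (SOME g. P g)" unfolding fourier_def if_not_P[OF False] by (simp only: P_def)
  then have Pf: "P (fourier f)" by (rule ssubst[where P=P]) (rule someI[of P, OF Pg])
  have "AE t in lebesgue. g t = fourier f t"
  proof (rule schwartz_separating)
    show "g \<in> borel_measurable lebesgue" "fourier f \<in> borel_measurable lebesgue"
      by (rule PD(1)[OF Pg], rule PD(1)[OF Pf])
    fix \<phi> assume \<phi>: "schwartz \<phi>"
    show "integrable lebesgue (\<lambda>t. g t * \<phi> t)" "integrable lebesgue (\<lambda>t. fourier f t * \<phi> t)"
      by (rule PD(2)[OF Pg \<phi>], rule PD(2)[OF Pf \<phi>])
    show "(LINT t|lebesgue. g t * \<phi> t) = (LINT t|lebesgue. fourier f t * \<phi> t)"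
      unfolding PD(3)[OF Pg \<phi>] PD(3)[OF Pf \<phi>] ..
  qed
  with g show ?thesis using PD(1)[OF Pf] by (rule weak_fourier_cong_AE)
qed

section \<open>A maximum principle in the half-plane\<close>

lemma open_upper_half_plane: "open upper_half_plane"
  unfolding upper_half_plane_def by (rule open_halfspace_Im_gt)

lemma convex_upper_half_plane: "convex upper_half_plane"
  unfolding upper_half_plane_def by (rule convex_halfspace_Im_gt)

lemma norm_plus_i_ge: "z \<in> upper_half_plane \<Longrightarrow> 1 \<le> norm (z + \<i>)"
  using abs_Im_le_cmod[of "z + \<i>"] by (simp add: upper_half_plane_def)

text \<open>The last premise is the form in which subharmonicity is available below: at each point where \<open>w\<close> is
  positive it is touched from below by the real part of a holomorphic function. Infinity is
  taken care of by subtracting a small multiple of \<open>ln (norm (z + \<i>))\<close>, which is harmonic and tends to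
  infinity. The resulting function \<open>v\<close> attains its maximum if it is positive somewhere. Around a
  maximum point, the exponential of the touching function has maximal modulus at the centre and is thus
  constant, so the set of maximum points is open as well as closed and is the whole half-plane. But it is
  also bounded.\<close>

lemma harmonic_minorant_nonpos:
  fixes w :: "complex \<Rightarrow> real"
  assumes cont: "continuous_on upper_half_plane w"
    and bdd: "\<And>z. z \<in> upper_half_plane \<Longrightarrow> w z \<le> B"
    and bdry: "\<And>x e. 0 < e \<Longrightarrow> \<exists>d>0. \<forall>z\<in>upper_half_plane. dist z (complex_of_real x) < d \<longrightarrow> w z < e"
    and loc: "\<And>z. z \<in> upper_half_plane \<Longrightarrow> 0 < w z \<Longrightarrow> \<exists>r>0. \<exists>K. ball z r \<subseteq> upper_half_plane \<and>
       K holomorphic_on ball z r \<and> Re (K z) = w z \<and> (\<forall>\<zeta>\<in>ball z r. Re (K \<zeta>) \<le> w \<zeta>)"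
    and z0: "z0 \<in> upper_half_plane"
  shows "w z0 \<le> 0"
proof (rule ccontr)
  assume "\<not> w z0 \<le> 0"
  then have wz0: "0 < w z0" by simp
  define L where "L z = ln (norm (z + \<i>))" for z
  have L0: "0 \<le> L z" if "z \<in> upper_half_plane" for z
    using norm_plus_i_ge[OF that] by (simp add: L_def)
  \<comment> \<open>small enough for \<open>v\<close> to remain positive at \<open>z0\<close>\<close>
  define \<epsilon> where "\<epsilon> = w z0 / 2 / (L z0 + 1)"
  have \<epsilon>: "0 < \<epsilon>" using wz0 L0[OF z0] by (simp add: \<epsilon>_def)
  define v where "v z = w z - \<epsilon> * L z" for z
  have "\<epsilon> * L z0 \<le> \<epsilon> * (L z0 + 1)" using \<epsilon> by simp
  also have "\<dots> = w z0 / 2"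
  proof -
    have "L z0 + 1 \<noteq> 0" using L0[OF z0] by simp
    then show ?thesis unfolding \<epsilon>_def by (rule nonzero_eq_divide_eq[THEN iffD1, OF _ refl])
  qed
  finally have m: "0 < v z0" using wz0 by (simp add: v_def)
  have v_le: "v z \<le> w z" if "z \<in> upper_half_plane" for z
    using L0[OF that] \<epsilon> by (simp add: v_def)
  have nz: "norm (z + \<i>) \<noteq> 0" if "z \<in> upper_half_plane" for z
    using norm_plus_i_ge[OF that] by linarith
  have v_cont: "continuous_on upper_half_plane v"
    unfolding v_def[abs_def] L_def by (intro continuous_intros cont ballI nz)
  define S where "S = {z \<in> upper_half_plane. v z0 \<le> v z}"
  have "bounded S"
    unfolding bounded_iff
  proof (intro exI ballI)
    fix z assume z: "z \<in> S"
    then have zU: "z \<in> upper_half_plane" and "v z0 \<le> v z" by (simp_all add: S_def)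
    then have "\<epsilon> * L z \<le> B" using bdd[OF zU] m unfolding v_def[of z] by linarith
    then have "L z \<le> B / \<epsilon>" using \<epsilon> by (simp add: field_simps)
    then have "exp (L z) \<le> exp (B / \<epsilon>)" by simp
    moreover have "exp (L z) = norm (z + \<i>)"
      using norm_plus_i_ge[OF zU] unfolding L_def by (intro exp_ln) linarith
    ultimately have "norm (z + \<i>) \<le> exp (B / \<epsilon>)" by simp
    then show "norm z \<le> exp (B / \<epsilon>) + 1"
      using norm_triangle_ineq4[of "z + \<i>" \<i>] by simp
  qed
  moreover have "closed S"
    unfolding closed_sequential_limits
  proof (intro allI impI, elim conjE)
    fix s l assume s: "\<forall>n. s n \<in> S" and l: "s \<longlonglongrightarrow> l"
    have "0 \<le> Im (s n)" for n
      using s[rule_format, of n] by (simp add: S_def upper_half_plane_def)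
    then have "0 \<le> Im l"
      using tendsto_Im[OF l] by (meson LIMSEQ_le_const)
    moreover have "Im l \<noteq> 0"
    proof
      assume "Im l = 0"
      then have lr: "l = complex_of_real (Re l)" by (simp add: complex_eq_iff)
      obtain d where d: "d > 0" "\<And>z. z \<in> upper_half_plane \<Longrightarrow> dist z l < d \<Longrightarrow> w z < v z0"
        using bdry[OF m, of "Re l"] unfolding lr[symmetric] by blast
      obtain n where n: "dist (s n) l < d"
        using l d(1) unfolding lim_sequentially by blast
      have "s n \<in> S" using s by blast
      then show False using d(2)[of "s n"] n v_le[of "s n"] by (auto simp: S_def)
    qed
    ultimately have lU: "l \<in> upper_half_plane" by (simp add: upper_half_plane_def)
    then have "isCont v l"
      using v_cont open_upper_half_plane by (simp add: continuous_on_eq_continuous_at)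
    then have "(\<lambda>n. v (s n)) \<longlonglongrightarrow> v l" using l by (rule isCont_tendsto_compose)
    moreover have "v z0 \<le> v (s n)" for n using s[rule_format, of n] by (simp add: S_def)
    ultimately have "v z0 \<le> v l" by (meson LIMSEQ_le_const)
    with lU show "l \<in> S" by (simp add: S_def)
  qed
  ultimately have "compact S" by (simp add: compact_eq_bounded_closed)
  moreover have "S \<noteq> {}" using z0 by (auto simp: S_def)
  moreover have "continuous_on S v" using v_cont by (rule continuous_on_subset) (auto simp: S_def)
  ultimately have "\<exists>z1\<in>S. \<forall>z\<in>S. v z \<le> v z1" by (rule continuous_attains_sup)
  then obtain z1 where z1: "z1 \<in> S" "\<And>z. z \<in> S \<Longrightarrow> v z \<le> v z1" by blast
  have max: "v z \<le> v z1" if "z \<in> upper_half_plane" for z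
    using z1 that by (cases "v z0 \<le> v z") (auto simp: S_def)
  have M: "0 < v z1" using z1 m by (auto simp: S_def)
  define T where "T = {z \<in> upper_half_plane. v z = v z1}"
  have "openin (top_of_set upper_half_plane) T"
  proof (subst openin_open_eq[OF open_upper_half_plane], intro conjI)
    show "open T"
      unfolding open_contains_ball
    proof
      fix z assume z: "z \<in> T"
      then have zU: "z \<in> upper_half_plane" "v z = v z1" by (auto simp: T_def)
      then have "0 < w z" using M v_le[of z] by simp
      then obtain r K where r: "0 < r" "ball z r \<subseteq> upper_half_plane" "K holomorphic_on ball z r"
        "Re (K z) = w z" "\<And>\<zeta>. \<zeta> \<in> ball z r \<Longrightarrow> Re (K \<zeta>) \<le> w \<zeta>"
        using loc[OF zU(1)] by blast
      define E where "E \<zeta> = exp (K \<zeta> - \<epsilon> * Ln (\<zeta> + \<i>))" for \<zeta>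
      have nE: "norm (E \<zeta>) = exp (Re (K \<zeta>) - \<epsilon> * L \<zeta>)" if "\<zeta> \<in> ball z r" for \<zeta>
      proof -
        have "\<zeta> + \<i> \<noteq> 0" using norm_plus_i_ge[of \<zeta>] r(2) that by auto
        then show ?thesis by (simp add: E_def L_def)
      qed
      have holE: "E holomorphic_on ball z r"
        unfolding E_def
      proof (intro holomorphic_intros r(3))
        fix \<zeta> assume "\<zeta> \<in> ball z r"
        then have "0 < Im \<zeta>" using r(2) by (auto simp: upper_half_plane_def)
        then show "\<zeta> + \<i> \<notin> \<real>\<^sub>\<le>\<^sub>0" by (auto simp: complex_nonpos_Reals_iff)
      qed
      have "E constant_on ball z r"
      proof (rule maximum_modulus_principle[OF holE, where U="ball z r" and \<xi>=z])
        fix \<zeta> assume \<zeta>: "\<zeta> \<in> ball z r"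
        have "Re (K \<zeta>) - \<epsilon> * L \<zeta> \<le> v \<zeta>" using r(5)[OF \<zeta>] by (simp add: v_def)
        also have "\<dots> \<le> v z" using max[of \<zeta>] \<zeta> r(2) zU by auto
        also have "\<dots> = Re (K z) - \<epsilon> * L z" using r(4) by (simp add: v_def)
        finally show "norm (E \<zeta>) \<le> norm (E z)" using nE \<zeta> r(1) by simp
      qed (use r in auto)
      then have Ec: "E \<zeta> = E z" if "\<zeta> \<in> ball z r" for \<zeta>
      proof -
        obtain y where y: "\<And>\<zeta>. \<zeta> \<in> ball z r \<Longrightarrow> E \<zeta> = y"
          using \<open>E constant_on ball z r\<close> unfolding constant_on_def by blast
        show ?thesis using y[OF that] y[of z] r(1) by simp
      qed
      have "ball z r \<subseteq> T"
      proof
        fix \<zeta> assume \<zeta>: "\<zeta> \<in> ball z r"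
        have "Re (K \<zeta>) - \<epsilon> * L \<zeta> = Re (K z) - \<epsilon> * L z"
          using nE[OF \<zeta>] nE[of z] Ec[OF \<zeta>] r(1) by simp
        also have "\<dots> = v z1" using r(4) zU by (simp add: v_def)
        finally have "v z1 \<le> v \<zeta>" using r(5)[OF \<zeta>] by (simp add: v_def)
        with max[of \<zeta>] \<zeta> r(2) show "\<zeta> \<in> T" by (auto simp: T_def)
      qed
      with r(1) show "\<exists>e>0. ball z e \<subseteq> T" by blast
    qed
  qed (auto simp: T_def)
  moreover have "closedin (top_of_set upper_half_plane) T"
    unfolding T_def by (rule continuous_closedin_preimage_constant[OF v_cont])
  moreover have "connected upper_half_plane"
    using convex_upper_half_plane by (rule convex_connected)
  moreover have "T \<noteq> {}" using z1 by (auto simp: T_def S_def)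
  ultimately have "T = upper_half_plane" unfolding connected_clopen by metis
  moreover have "T \<subseteq> S" using z1 by (auto simp: T_def S_def)
  ultimately have "bounded upper_half_plane" using \<open>bounded S\<close> bounded_subset by blast
  then obtain C where C: "\<And>z. z \<in> upper_half_plane \<Longrightarrow> norm z \<le> C" unfolding bounded_iff by blast
  have "\<i> * of_real (\<bar>C\<bar> + 1) \<in> upper_half_plane" by (simp add: upper_half_plane_def)
  from C[OF this] show False by (simp add: norm_mult del: of_real_add)
qed

section \<open>Poisson representation of bounded holomorphic functions\<close>

text \<open>The antiholomorphic part of the Poisson integral may be conjugated without changing the real part.\<close>

lemma poisson_integral_harmonic:
  assumes p: "1 \<le> p" "p \<le> 2" "f \<in> Lp p"
  obtains H where "H holomorphic_on upper_half_plane" "\<And>z. z \<in> upper_half_plane \<Longrightarrow> Re (H z) = Re (poisson_integral f z)"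
proof
  let ?H = "\<lambda>z. cauchy_integral f z - (cnj \<circ> cauchy_integral f \<circ> cnj) z"
  have U: "upper_half_plane \<subseteq> {z. Im z \<noteq> 0}" "cnj ` upper_half_plane \<subseteq> {z. Im z \<noteq> 0}"
    by (auto simp: upper_half_plane_def)
  show "?H holomorphic_on upper_half_plane"
    by (intro holomorphic_on_diff holomorphic_on_compose_cnj_cnj open_upper_half_plane
        holomorphic_on_subset[OF cauchy_integral_holomorphic[OF p]] U)
  show "Re (?H z) = Re (poisson_integral f z)" if "z \<in> upper_half_plane" for z
    using that poisson_integral_eq_cauchy[OF p, of z] by (simp add: upper_half_plane_def)
qed

lemma poisson_integral_bounded:
  fixes b :: "real \<Rightarrow> complex"
  assumes b: "\<And>s. norm (b s) \<le> K" and z: "0 < Im z"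
  shows "norm (poisson_integral b z) \<le> K"
proof -
  have k: "integrable lebesgue (poisson_kernel z)" "integral\<^sup>L lebesgue (poisson_kernel z) = 1"
    using poisson_kernel_integral[OF z] by (auto simp: has_bochner_integral_iff)
  have "norm (poisson_integral b z) \<le> (LINT s|lebesgue. poisson_kernel z s * K)"
    unfolding poisson_integral_def
    by (rule norm_integral_le_of_bound)
       (use k b poisson_kernel_pos[OF z] in \<open>auto intro!: mult_left_mono simp: less_imp_le\<close>)
  then show ?thesis using k by simp
qed

text \<open>The maximum principle requires convergence from all directions, not just within cones; for continuous
  bounded boundary values the near part is controlled by continuity and the far part by the height.\<close>

lemma poisson_integral_boundary_continuous:
  fixes b :: "real \<Rightarrow> complex"
  assumes b: "continuous_on UNIV b" "\<And>s. norm (b s) \<le> K" and e: "0 < e"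
  shows "\<exists>d>0. \<forall>z\<in>upper_half_plane. dist z (complex_of_real x) < d \<longrightarrow> dist (poisson_integral b z) (b x) < e"
proof -
  have K: "0 \<le> K" using b(2)[of 0] norm_ge_zero order_trans by blast
  have [measurable]: "b \<in> borel_measurable borel" using b(1) by (rule borel_measurable_continuous_onI)
  have "isCont b x" using b(1) by (simp add: continuous_on_eq_continuous_at)
  then obtain \<delta> where \<delta>: "0 < \<delta>" "\<And>s. dist s x < \<delta> \<Longrightarrow> dist (b s) (b x) < e / 2"
    unfolding continuous_at_eps_delta using e by (metis half_gt_zero)
  define M where "M = (1 + 1 / (\<delta> / 2)\<^sup>2) * (2 * K)"
  have M: "0 \<le> M" using K by (simp add: M_def)
  define d where "d = min (\<delta> / 2) (e / 2 / (M + 1))"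
  have d: "0 < d" using \<delta> e M by (simp add: d_def)
  show ?thesis
  proof (intro exI[of _ d] conjI ballI impI d)
    fix z assume zU: "z \<in> upper_half_plane" and zd: "dist z (complex_of_real x) < d"
    have z: "0 < Im z" using zU by (simp add: upper_half_plane_def)
    have Re: "\<bar>Re z - x\<bar> < \<delta> / 2" and Im: "Im z < e / 2 / (M + 1)"
      using zd abs_Re_le_cmod[of "z - of_real x"] abs_Im_le_cmod[of "z - of_real x"]
      by (auto simp: dist_norm d_def)
    define z' where "z' = Complex (Re z) 1"
    have z': "0 < Im z'" by (simp add: z'_def)
    have k: "integrable lebesgue (poisson_kernel z)" "integral\<^sup>L lebesgue (poisson_kernel z) = 1"
      "integrable lebesgue (poisson_kernel z')" "integral\<^sup>L lebesgue (poisson_kernel z') = 1"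
      using poisson_kernel_integral[OF z] poisson_kernel_integral[OF z'] by (auto simp: has_bochner_integral_iff)
    have ib: "integrable lebesgue (\<lambda>s. poisson_kernel z s *\<^sub>R b s)"
    proof (rule Bochner_Integration.integrable_bound[OF integrable_mult_left[OF k(1), of K]])
      show "AE s in lebesgue. norm (poisson_kernel z s *\<^sub>R b s) \<le> norm (poisson_kernel z s * K)"
        using b(2) K poisson_kernel_pos[OF z] by (auto intro!: AE_I2 mult_left_mono simp: less_imp_le abs_mult)
    qed measurable
    have "dist (poisson_integral b z) (b x) \<le> (LINT s|lebesgue. poisson_kernel z s * norm (b s - b x))"
      unfolding dist_norm by (rule poisson_integral_diff_le(2)[OF z ib])
    also have "\<dots> \<le> (LINT s|lebesgue. e / 2 * poisson_kernel z s + M * Im z * poisson_kernel z' s)"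
    proof (rule integral_mono[OF poisson_integral_diff_le(1)[OF z ib]])
      show "integrable lebesgue (\<lambda>s. e / 2 * poisson_kernel z s + M * Im z * poisson_kernel z' s)"
        using k by (intro Bochner_Integration.integrable_add integrable_mult_right)
      fix s
      have pos: "0 \<le> poisson_kernel z s" "0 \<le> poisson_kernel z' s"
        using poisson_kernel_pos[OF z] poisson_kernel_pos[OF z'] by (auto simp: less_imp_le)
      show "poisson_kernel z s * norm (b s - b x) \<le> e / 2 * poisson_kernel z s + M * Im z * poisson_kernel z' s"
      proof (cases "dist s x < \<delta>")
        case True
        then have "norm (b s - b x) \<le> e / 2" using \<delta>(2) by (simp add: dist_norm less_imp_le)
        then have "poisson_kernel z s * norm (b s - b x) \<le> poisson_kernel z s * (e / 2)"
          using pos by (intro mult_left_mono)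
        moreover have "0 \<le> M * Im z * poisson_kernel z' s" using M z pos by simp
        ultimately show ?thesis by (simp add: mult.commute)
      next
        case False
        then have "\<delta> \<le> \<bar>s - x\<bar>" by (simp add: dist_real_def)
        moreover have "\<bar>s - x\<bar> \<le> \<bar>s - Re z\<bar> + \<bar>Re z - x\<bar>" by linarith
        ultimately have far: "0 < \<delta> / 2" "\<delta> / 2 \<le> \<bar>s - Re z\<bar>" using Re \<delta> by linarith+
        have "norm (b s - b x) \<le> 2 * K" using norm_triangle_ineq4[of "b s" "b x"] b(2)[of s] b(2)[of x] by linarith
        then have "poisson_kernel z s * norm (b s - b x) \<le> ((1 + 1 / (\<delta> / 2)\<^sup>2) * Im z * poisson_kernel z' s) * (2 * K)"
          using pos poisson_kernel_far_le[OF z far] unfolding z'_def[symmetric]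
          by (intro mult_mono) (auto intro: order_trans)
        also have "\<dots> = M * Im z * poisson_kernel z' s" by (simp only: M_def mult_ac)
        finally have "poisson_kernel z s * norm (b s - b x) \<le> M * Im z * poisson_kernel z' s" .
        moreover have "0 \<le> e / 2 * poisson_kernel z s" using e pos by simp
        ultimately show ?thesis by linarith
      qed
    qed
    also have "\<dots> = e / 2 + M * Im z" using k by simp
    also have "\<dots> < e"
    proof -
      have "0 < M + 1" using M by simp
      then have "Im z * (M + 1) < e / 2" using Im by (rule pos_less_divide_eq[THEN iffD1])
      then show ?thesis using z by (simp add: algebra_simps)
    qed
    finally show "dist (poisson_integral b z) (b x) < e" .
  qed
qed

text \<open>The difference of the two sides is bounded, harmonic and vanishes on the real line. If it were nonzero
  at \<open>z0\<close>, a rotation \<open>c\<close> would make it positive there, contrary to the maximum principle.\<close>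

lemma holomorphic_eq_poisson_integral:
  assumes p: "1 \<le> p" "p \<le> 2" and h: "0 < h"
    and G: "G holomorphic_on {z. - h < Im z}" "\<And>z. 0 \<le> Im z \<Longrightarrow> norm (G z) \<le> K"
    and g: "(\<lambda>s. G (of_real s)) \<in> Lp p"
    and z0: "0 < Im z0"
  shows "G z0 = poisson_integral (\<lambda>s. G (of_real s)) z0"
proof (rule ccontr)
  let ?g = "\<lambda>s. G (of_real s)"
  assume neq: "G z0 \<noteq> poisson_integral ?g z0"
  define \<Delta> where "\<Delta> z = G z - poisson_integral ?g z" for z
  \<comment> \<open>turns \<open>\<Delta> z0\<close> into its modulus\<close>
  define c where "c = cnj (sgn (\<Delta> z0))"
  have nc: "norm c = 1" using neq by (simp add: c_def \<Delta>_def norm_sgn)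
  have U: "upper_half_plane \<subseteq> {z. - h < Im z}" using h by (auto simp: upper_half_plane_def)
  have contG: "continuous_on {z. - h < Im z} G" using G(1) by (rule holomorphic_on_imp_continuous_on)
  have contg: "continuous_on UNIV ?g"
    by (rule continuous_on_compose2[OF contG]) (use h in \<open>auto intro!: continuous_intros\<close>)
  have bg: "norm (?g s) \<le> K" for s using G(2)[of "of_real s"] by simp
  have cg: "(\<lambda>s. c * ?g s) \<in> Lp p"
    using g nc by (auto simp: Lp_def norm_mult)
  obtain H where H: "H holomorphic_on upper_half_plane" "\<And>z. z \<in> upper_half_plane \<Longrightarrow> Re (H z) = Re (poisson_integral (\<lambda>s. c * ?g s) z)"
    using poisson_integral_harmonic[OF p cg] by metis
  have Pc: "poisson_integral (\<lambda>s. c * ?g s) z = c * poisson_integral ?g z" for z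
    unfolding poisson_integral_def by (simp flip: mult_scaleR_right)
  define Q where "Q z = c * G z - H z" for z
  have Q: "Re (Q z) = Re (c * \<Delta> z)" if "z \<in> upper_half_plane" for z
    using H(2)[OF that] by (simp add: Q_def \<Delta>_def Pc right_diff_distrib)
  have holQ: "Q holomorphic_on upper_half_plane"
    unfolding Q_def by (intro holomorphic_intros H(1) holomorphic_on_subset[OF G(1) U])
  have "Re (Q z0) \<le> 0"
  proof (rule harmonic_minorant_nonpos[where B="2 * K" and w="\<lambda>z. Re (Q z)" and ?z0.0=z0])
    show "continuous_on upper_half_plane (\<lambda>z. Re (Q z))"
      by (intro continuous_intros holomorphic_on_imp_continuous_on holQ)
    fix z assume z: "z \<in> upper_half_plane"
    then have Im: "0 < Im z" by (simp add: upper_half_plane_def)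
    have "Re (Q z) \<le> norm (\<Delta> z)"
      using Q[OF z] complex_Re_le_cmod[of "c * \<Delta> z"] by (simp add: norm_mult nc)
    also have "\<dots> \<le> norm (G z) + norm (poisson_integral ?g z)" unfolding \<Delta>_def by (rule norm_triangle_ineq4)
    also have "\<dots> \<le> K + K" using G(2)[of z] Im poisson_integral_bounded[OF bg Im] by (intro add_mono) auto
    finally show "Re (Q z) \<le> 2 * K" by simp
    obtain r where "0 < r" "ball z r \<subseteq> upper_half_plane"
      using open_upper_half_plane z by (meson open_contains_ball)
    then show "\<exists>r>0. \<exists>K. ball z r \<subseteq> upper_half_plane \<and> K holomorphic_on ball z r \<and> Re (K z) = Re (Q z) \<and> (\<forall>\<zeta>\<in>ball z r. Re (K \<zeta>) \<le> Re (Q \<zeta>))"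
      using holomorphic_on_subset[OF holQ] by (intro exI[of _ r] conjI exI[of _ Q]) auto
  next
    fix x e :: real assume e: "0 < e"
    obtain d1 where d1: "0 < d1" "\<And>z. z \<in> upper_half_plane \<Longrightarrow> dist z (complex_of_real x) < d1 \<Longrightarrow> dist (poisson_integral ?g z) (?g x) < e / 2"
      using poisson_integral_boundary_continuous[OF contg bg, of "e / 2" x] e by auto
    have "isCont G (of_real x)"
      using contG h open_halfspace_Im_gt by (subst (asm) continuous_on_eq_continuous_at) auto
    then obtain d2 where d2: "0 < d2" "\<And>z. dist z (complex_of_real x) < d2 \<Longrightarrow> dist (G z) (?g x) < e / 2"
      unfolding continuous_at_eps_delta using e by (metis half_gt_zero)
    show "\<exists>d>0. \<forall>z\<in>upper_half_plane. dist z (complex_of_real x) < d \<longrightarrow> Re (Q z) < e"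
    proof (intro exI[of _ "min d1 d2"] conjI ballI impI)
      fix z assume z: "z \<in> upper_half_plane" "dist z (complex_of_real x) < min d1 d2"
      have "Re (Q z) \<le> norm (\<Delta> z)"
        using Q[OF z(1)] complex_Re_le_cmod[of "c * \<Delta> z"] by (simp add: norm_mult nc)
      also have "\<dots> \<le> dist (G z) (?g x) + dist (poisson_integral ?g z) (?g x)"
        unfolding \<Delta>_def by (metis dist_norm dist_triangle2)
      also have "\<dots> < e" using d1(2)[of z] d2(2)[of z] z by auto
      finally show "Re (Q z) < e" .
    qed (use d1 d2 in auto)
  qed (use z0 in \<open>auto simp: upper_half_plane_def\<close>)
  moreover have "Re (Q z0) = norm (\<Delta> z0)"
  proof -
    have "c * \<Delta> z0 = of_real (norm (\<Delta> z0))"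
      unfolding c_def by (simp add: sgn_eq complex_norm_square[symmetric] power2_eq_square field_simps mult.commute[of "cnj _"])
    then show ?thesis using Q[of z0] z0 by (simp add: upper_half_plane_def)
  qed
  ultimately show False using neq by (simp add: \<Delta>_def)
qed

lemma holomorphic_root_modulus:
  assumes "G holomorphic_on ball z r" "\<And>\<zeta>. \<zeta> \<in> ball z r \<Longrightarrow> G \<zeta> \<noteq> 0" "0 < r"
  obtains Q where "Q holomorphic_on ball z r" "\<And>\<zeta>. \<zeta> \<in> ball z r \<Longrightarrow> norm (Q \<zeta>) = norm (G \<zeta>) powr q"
proof -
  have "contractible (ball z r)" by (intro convex_imp_contractible convex_ball)
  from contractible_imp_holomorphic_log[OF assms(1) this assms(2)]
  obtain l where l: "l holomorphic_on ball z r" "\<And>\<zeta>. \<zeta> \<in> ball z r \<Longrightarrow> G \<zeta> = exp (l \<zeta>)"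
    by metis
  show ?thesis
  proof
    show "(\<lambda>\<zeta>. exp (of_real q * l \<zeta>)) holomorphic_on ball z r" by (intro holomorphic_intros l)
    show "norm (exp (of_real q * l \<zeta>)) = norm (G \<zeta>) powr q" if "\<zeta> \<in> ball z r" for \<zeta>
      using l(2)[OF that] by (simp add: exp_powr_real mult.commute)
  qed
qed

lemma powr_half_square: "(a powr (p / 2))\<^sup>2 = a powr p" for a p :: real
  by (simp add: power2_eq_square flip: powr_add)

text \<open>Where \<open>G\<close> vanishes the left-hand side is 0. Elsewhere $|G|^{p/2}$ is locally the modulus of the
  holomorphic function \<open>Q\<close>, a branch of $G^{p/2}$, and a rotation \<open>c\<close> makes the real part of \<open>c * Q\<close> touch
  this modulus from below. The maximum principle applies to the difference of $|G|^{p/2}$ and the Poisson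
  integral.\<close>

lemma norm_powr_le_poisson_integral:
  assumes p: "0 < p" and h: "0 < h"
    and G: "G holomorphic_on {z. - h < Im z}" "\<And>z. 0 \<le> Im z \<Longrightarrow> norm (G z) \<le> K"
    and g: "integrable lebesgue (\<lambda>s. norm (G (of_real s)) powr p)"
    and z0: "0 < Im z0"
  shows "norm (G z0) powr (p / 2) \<le> Re (poisson_integral (\<lambda>s. of_real (norm (G (of_real s)) powr (p / 2))) z0)"
proof -
  define b where "b s = complex_of_real (norm (G (of_real s)) powr (p / 2))" for s
  have U: "upper_half_plane \<subseteq> {z. - h < Im z}" using h by (auto simp: upper_half_plane_def)
  have contG: "continuous_on {z. - h < Im z} G" using G(1) by (rule holomorphic_on_imp_continuous_on)
  have contu: "continuous_on {z. - h < Im z} (\<lambda>z. norm (G z) powr (p / 2))"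
    using p by (intro continuous_on_powr' continuous_intros contG) auto
  have contb: "continuous_on UNIV b"
    unfolding b_def by (intro continuous_intros continuous_on_compose2[OF contu]) (use h in \<open>auto intro!: continuous_intros\<close>)
  have bb: "norm (b s) \<le> K powr (p / 2)" for s
    using G(2)[of "of_real s"] p by (auto simp: b_def intro!: powr_mono2)
  have bL: "b \<in> Lp 2"
    unfolding Lp_2_iff using g borel_imp_lebesgue_measurable[OF borel_measurable_continuous_onI[OF contb]]
    by (simp add: b_def powr_half_square)
  obtain H where H: "H holomorphic_on upper_half_plane" "\<And>z. z \<in> upper_half_plane \<Longrightarrow> Re (H z) = Re (poisson_integral b z)"
    using poisson_integral_harmonic[OF _ _ bL] by (metis one_le_numeral order_refl)
  have P0: "0 \<le> Re (poisson_integral b z)" if "0 < Im z" for z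
  proof -
    have "poisson_integral b z = (LINT s|lebesgue. complex_of_real (poisson_kernel z s * norm (G (of_real s)) powr (p / 2)))"
      unfolding poisson_integral_def b_def by (simp only: scaleR_conv_of_real of_real_mult)
    also have "\<dots> = of_real (LINT s|lebesgue. poisson_kernel z s * norm (G (of_real s)) powr (p / 2))"
      by (rule integral_complex_of_real)
    finally have "poisson_integral b z = of_real (LINT s|lebesgue. poisson_kernel z s * norm (G (of_real s)) powr (p / 2))" .
    then show ?thesis using poisson_kernel_pos[OF that]
      by (simp add: Bochner_Integration.integral_nonneg less_imp_le)
  qed
  define w where "w z = norm (G z) powr (p / 2) - Re (H z)" for z
  have "w z0 \<le> 0"
  proof (rule harmonic_minorant_nonpos[where B="K powr (p / 2)" and w=w and ?z0.0=z0])
    show "continuous_on upper_half_plane w"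
      unfolding w_def by (intro continuous_intros holomorphic_on_imp_continuous_on H continuous_on_subset[OF contu U])
    fix z assume z: "z \<in> upper_half_plane"
    then have Im: "0 < Im z" by (simp add: upper_half_plane_def)
    have "norm (G z) powr (p / 2) \<le> K powr (p / 2)" using G(2)[of z] Im p by (intro powr_mono2) auto
    then show "w z \<le> K powr (p / 2)" using P0[OF Im] H(2)[OF z] by (simp add: w_def)
    assume wz: "0 < w z"
    then have Gz: "G z \<noteq> 0" using P0[OF Im] H(2)[OF z] p by (auto simp: w_def)
    have "isCont G z" using contG h z U open_halfspace_Im_gt by (subst (asm) continuous_on_eq_continuous_at) auto
    then have "\<forall>\<^sub>F \<zeta> in nhds z. G \<zeta> \<noteq> 0"
      using Gz by (intro tendsto_imp_eventually_ne) (auto simp: isCont_def tendsto_at_iff_tendsto_nhds)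
    then obtain r1 where r1: "0 < r1" "\<And>\<zeta>. dist \<zeta> z < r1 \<Longrightarrow> G \<zeta> \<noteq> 0"
      unfolding eventually_nhds_metric by blast
    obtain r2 where r2: "0 < r2" "ball z r2 \<subseteq> upper_half_plane"
      using open_upper_half_plane z by (meson open_contains_ball)
    define r where "r = min r1 r2"
    have r: "0 < r" "ball z r \<subseteq> upper_half_plane" "\<And>\<zeta>. \<zeta> \<in> ball z r \<Longrightarrow> G \<zeta> \<noteq> 0"
      using r1 r2 by (auto simp: r_def dist_commute)
    obtain Q where Q: "Q holomorphic_on ball z r" "\<And>\<zeta>. \<zeta> \<in> ball z r \<Longrightarrow> norm (Q \<zeta>) = norm (G \<zeta>) powr (p / 2)"
      using holomorphic_root_modulus[OF holomorphic_on_subset[OF G(1) subset_trans[OF r(2) U]] r(3,1)] by metis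
    \<comment> \<open>turns \<open>Q z\<close> into its modulus\<close>
    define c where "c = cnj (sgn (Q z))"
    have "norm (Q z) > 0" using Q(2)[of z] r(1) Gz by simp
    then have nc: "norm c = 1" by (simp add: c_def norm_sgn)
    have cQ: "c * Q z = of_real (norm (Q z))"
      unfolding c_def by (simp add: sgn_eq complex_norm_square[symmetric] power2_eq_square field_simps mult.commute[of "cnj _"])
    show "\<exists>r>0. \<exists>K. ball z r \<subseteq> upper_half_plane \<and> K holomorphic_on ball z r \<and> Re (K z) = w z \<and> (\<forall>\<zeta>\<in>ball z r. Re (K \<zeta>) \<le> w \<zeta>)"
    proof (intro exI[of _ r] conjI exI[of _ "\<lambda>\<zeta>. c * Q \<zeta> - H \<zeta>"] ballI r)
      show "(\<lambda>\<zeta>. c * Q \<zeta> - H \<zeta>) holomorphic_on ball z r"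
        by (intro holomorphic_intros Q holomorphic_on_subset[OF H(1) r(2)])
      show "Re (c * Q z - H z) = w z" using cQ Q(2)[of z] r(1) by (simp add: w_def)
      show "Re (c * Q \<zeta> - H \<zeta>) \<le> w \<zeta>" if "\<zeta> \<in> ball z r" for \<zeta>
        using complex_Re_le_cmod[of "c * Q \<zeta>"] Q(2)[OF that] by (simp add: w_def norm_mult nc)
    qed
  next
    fix x e :: real assume e: "0 < e"
    obtain d1 where d1: "0 < d1" "\<And>z. z \<in> upper_half_plane \<Longrightarrow> dist z (complex_of_real x) < d1 \<Longrightarrow> dist (poisson_integral b z) (b x) < e / 2"
      using poisson_integral_boundary_continuous[OF contb bb, of "e / 2" x] e by auto
    have "isCont (\<lambda>z. norm (G z) powr (p / 2)) (of_real x)"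
      using contu h open_halfspace_Im_gt by (subst (asm) continuous_on_eq_continuous_at) auto
    then obtain d2 where d2: "0 < d2" "\<And>z. dist z (complex_of_real x) < d2 \<Longrightarrow> dist (norm (G z) powr (p / 2)) (norm (G x) powr (p / 2)) < e / 2"
      unfolding continuous_at_eps_delta using e by (metis half_gt_zero)
    show "\<exists>d>0. \<forall>z\<in>upper_half_plane. dist z (complex_of_real x) < d \<longrightarrow> w z < e"
    proof (intro exI[of _ "min d1 d2"] conjI ballI impI)
      fix z assume z: "z \<in> upper_half_plane" "dist z (complex_of_real x) < min d1 d2"
      have "\<bar>Re (poisson_integral b z - b x)\<bar> < e / 2"
        using d1(2)[of z] z abs_Re_le_cmod[of "poisson_integral b z - b x"] by (simp add: dist_norm)
      moreover have "\<bar>norm (G z) powr (p / 2) - norm (G x) powr (p / 2)\<bar> < e / 2"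
        using d2(2)[of z] z by (simp add: dist_real_def)
      moreover have "Re (b x) = norm (G x) powr (p / 2)" by (simp add: b_def)
      ultimately show "w z < e"
        using H(2)[OF z(1)] unfolding w_def minus_complex.sel by arith
    qed (use d1 d2 in auto)
  qed (use z0 in \<open>auto simp: upper_half_plane_def\<close>)
  then show ?thesis using H(2)[of z0] z0 by (simp add: w_def b_def[abs_def] upper_half_plane_def)
qed

section \<open>Growth of functions in the Hardy space\<close>

lemma hardy_space_integral_bound:
  assumes "F \<in> hardy_space p" "0 < p"
  obtains C where "0 \<le> C" "\<And>y. 0 < y \<Longrightarrow> (LINT x|lebesgue. norm (F (Complex x y)) powr p) \<le> C"
proof -
  let ?I = "\<lambda>y. LINT x|lebesgue. norm (F (Complex x y)) powr p"
  obtain B where B: "\<And>y. 0 < y \<Longrightarrow> ?I y powr (1 / p) \<le> B"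
    using assms(1) unfolding hardy_space_def bdd_above_def by auto
  have "?I y \<le> B powr p" if y: "0 < y" for y
  proof -
    have "?I y = (?I y powr (1 / p)) powr p"
      using assms(2) by (simp add: powr_powr Bochner_Integration.integral_nonneg)
    also have "\<dots> \<le> B powr p" using B[OF y] assms(2) by (intro powr_mono2) auto
    finally show ?thesis .
  qed
  then show ?thesis by (intro that[of "B powr p"]) auto
qed

lemma hardy_space_line:
  assumes "F \<in> hardy_space p" "0 < y"
  shows "continuous_on UNIV (\<lambda>s. F (Complex s y))" "(\<lambda>s. F (Complex s y)) \<in> Lp p"
proof -
  have "continuous_on upper_half_plane F"
    using assms by (auto simp: hardy_space_def holomorphic_on_imp_continuous_on)
  then show c: "continuous_on UNIV (\<lambda>s. F (Complex s y))"
    unfolding Complex_eq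
    by (rule continuous_on_compose2) (use assms in \<open>auto intro!: continuous_intros simp: upper_half_plane_def\<close>)
  then show "(\<lambda>s. F (Complex s y)) \<in> Lp p"
    using assms borel_imp_lebesgue_measurable[OF borel_measurable_continuous_onI[OF c]]
    by (auto simp: Lp_def hardy_space_def)
qed

lemma one_plus_powr_ge:
  fixes a p :: real
  assumes "1 \<le> p" "0 \<le> a"
  shows "a \<le> 1 + a powr p"
proof (cases "a \<le> 1")
  case False
  then have "a powr 1 \<le> a powr p" using assms by (intro powr_mono) auto
  then show ?thesis using assms by simp
qed (simp add: add_increasing2)

text \<open>The increment of a primitive \<open>\<Phi>\<close> along a horizontal segment is the integral of \<open>F\<close>, and \<open>norm (F z)\<close> is
  at most \<open>1 + norm (F z) powr p\<close>.\<close>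

lemma hardy_space_segment_integral:
  assumes F: "F \<in> hardy_space p" and p: "1 \<le> p" and y: "0 < y" and a: "0 \<le> a"
    and \<Phi>: "\<And>z. z \<in> upper_half_plane \<Longrightarrow> (\<Phi> has_field_derivative F z) (at z)"
    and C: "(LINT x|lebesgue. norm (F (Complex x y)) powr p) \<le> C"
  shows "norm (\<Phi> (Complex (x + a) y) - \<Phi> (Complex x y)) \<le> a + C"
proof -
  let ?f = "\<lambda>s. F (Complex s y)"
  have c: "continuous_on UNIV ?f" by (rule hardy_space_line[OF F y])
  have fi: "integrable lebesgue (\<lambda>s. norm (?f s) powr p)"
    using hardy_space_line(2)[OF F y] by (simp add: Lp_def)
  have D: "((\<lambda>s. \<Phi> (Complex s y)) has_vector_derivative ?f s) (at s)" for s
  proof -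
    have "Complex s y \<in> upper_half_plane" using y by (simp add: upper_half_plane_def)
    from \<Phi>[OF this] have "(\<Phi> has_field_derivative F (Complex s y)) (at (of_real s + \<i> * of_real y))"
      by (simp add: Complex_eq)
    then have "((\<lambda>z. \<Phi> (z + \<i> * of_real y)) has_field_derivative F (Complex s y)) (at (of_real s))"
      by (simp add: DERIV_shift)
    then show ?thesis unfolding Complex_eq[of _ y] by (rule has_vector_derivative_real_field)
  qed
  have eq: "(\<integral>s. indicator {x..x + a} s *\<^sub>R ?f s \<partial>lborel) = \<Phi> (Complex (x + a) y) - \<Phi> (Complex x y)"
    using a by (intro integral_FTC_Icc has_vector_derivative_at_within[OF D] continuous_on_subset[OF c]) auto
  have "(\<lambda>s. indicator {x..x + a} s *\<^sub>R ?f s) \<in> borel_measurable lborel"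
    using borel_measurable_continuous_onI[OF c] by (intro borel_measurable_scaleR) auto
  then have "\<Phi> (Complex (x + a) y) - \<Phi> (Complex x y) = (\<integral>s. indicator {x..x + a} s *\<^sub>R ?f s \<partial>lebesgue)"
    unfolding eq[symmetric] by (intro integral_completion[symmetric]) simp
  also have "norm \<dots> \<le> (LINT s|lebesgue. indicator {x..x + a} s + norm (?f s) powr p)"
  proof (rule norm_integral_le_of_bound)
    show "integrable lebesgue (\<lambda>s. indicator {x..x + a} s + norm (?f s) powr p)"
      by (intro Bochner_Integration.integrable_add fi integrable_real_indicator) (auto simp: emeasure_lborel_Icc_eq)
    show "norm (indicator {x..x + a} s *\<^sub>R ?f s) \<le> indicator {x..x + a} s + norm (?f s) powr p" for s
      using one_plus_powr_ge[OF p, of "norm (?f s)"] by (auto simp: indicator_def)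
  qed
  also have "\<dots> = a + (LINT s|lebesgue. norm (?f s) powr p)"
    using fi a by (subst Bochner_Integration.integral_add) (auto simp: emeasure_lborel_Icc_eq intro!: integrable_real_indicator)
  also have "\<dots> \<le> a + C" using C by simp
  finally show ?thesis .
qed

text \<open>The increment \<open>\<Phi> (z + a) - \<Phi> z\<close> of a primitive is bounded in the whole half-plane. Cauchy's estimate
  bounds its derivative \<open>F (z + a) - F z\<close> for \<open>Im z \<ge> h\<close>, uniformly for $0 \leq a \leq 1$. So \<open>F z\<close>
  is comparable to \<open>F\<close> at every point of a horizontal segment of length 1, and the bound on the integral of
  \<open>norm (F z) powr p\<close> prevents \<open>F\<close> from being large on all of it. This avoids integration over discs.\<close>

lemma hardy_space_bounded:
  assumes F: "F \<in> hardy_space p" and p: "1 \<le> p" and h: "0 < h"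
  obtains K where "\<And>z. h \<le> Im z \<Longrightarrow> norm (F z) \<le> K"
proof -
  obtain C where C: "0 \<le> C" "\<And>y. 0 < y \<Longrightarrow> (LINT x|lebesgue. norm (F (Complex x y)) powr p) \<le> C"
    using hardy_space_integral_bound[OF F] p by auto
  have hol: "F holomorphic_on upper_half_plane" using F by (simp add: hardy_space_def)
  obtain \<Phi> where "\<And>z. z \<in> upper_half_plane \<Longrightarrow> (\<Phi> has_field_derivative F z) (at z within upper_half_plane)"
    using holomorphic_convex_primitive'[OF convex_upper_half_plane open_upper_half_plane hol] by blast
  then have \<Phi>: "(\<Phi> has_field_derivative F z) (at z)" if "z \<in> upper_half_plane" for z
    using that at_within_open[OF that open_upper_half_plane] by metis
  have diff: "norm (F (z + of_real a) - F z) \<le> 2 * (1 + C) / h" if z: "h \<le> Im z" and a: "0 \<le> a" "a \<le> 1" for z a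
  proof -
    define G where "G w = \<Phi> (w + of_real a) - \<Phi> w" for w
    have G': "(G has_field_derivative F (w + of_real a) - F w) (at w)" if "w \<in> upper_half_plane" for w
    proof -
      have "w + of_real a \<in> upper_half_plane" using that by (simp add: upper_half_plane_def)
      from \<Phi>[OF this] have "((\<lambda>w. \<Phi> (w + of_real a)) has_field_derivative F (w + of_real a)) (at w)"
        by (simp only: DERIV_shift)
      then show ?thesis unfolding G_def using \<Phi>[OF that] by (rule DERIV_diff)
    qed
    have GB: "norm (G w) \<le> 1 + C" if "w \<in> upper_half_plane" for w
    proof -
      have "0 < Im w" using that by (simp add: upper_half_plane_def)
      from hardy_space_segment_integral[OF F p this a(1) \<Phi> C(2)[OF this], of "Re w"]
      have "norm (\<Phi> (Complex (Re w + a) (Im w)) - \<Phi> (Complex (Re w) (Im w))) \<le> a + C" by simp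
      moreover have "Complex (Re w + a) (Im w) = w + of_real a" "Complex (Re w) (Im w) = w"
        by (auto simp: complex_eq_iff)
      ultimately show ?thesis using a by (simp add: G_def)
    qed
    have sub: "cball z (h / 2) \<subseteq> upper_half_plane"
    proof
      fix w assume "w \<in> cball z (h / 2)"
      then have "\<bar>Im z - Im w\<bar> \<le> h / 2" using abs_Im_le_cmod[of "z - w"] by (simp add: dist_norm)
      then have "0 < Im w" using z h by linarith
      then show "w \<in> upper_half_plane" by (simp add: upper_half_plane_def)
    qed
    have holG: "G holomorphic_on upper_half_plane"
      using G' by (auto simp: holomorphic_on_def field_differentiable_def intro: has_field_derivative_at_within)
    have "norm ((deriv ^^ 1) G z) \<le> fact 1 * (1 + C) / (h / 2) ^ 1"
    proof (rule Cauchy_inequality)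
      show "G holomorphic_on ball z (h / 2)" using holG sub ball_subset_cball by (meson holomorphic_on_subset order_trans)
      show "continuous_on (cball z (h / 2)) G"
        using holG sub holomorphic_on_imp_continuous_on continuous_on_subset by blast
      show "norm (G w) \<le> 1 + C" if "norm (z - w) = h / 2" for w
        using GB[of w] sub that by (auto simp: dist_norm)
    qed (use h in auto)
    moreover have "deriv G z = F (z + of_real a) - F z"
      using z h by (intro DERIV_imp_deriv G') (simp add: upper_half_plane_def)
    ultimately show ?thesis by (simp add: mult.commute)
  qed
  have "norm (F z) \<le> 1 + C + 2 * (1 + C) / h" if z: "h \<le> Im z" for z
  proof -
    have y: "0 < Im z" using z h by linarith
    \<comment> \<open>otherwise the integral over the segment alone would exceed \<open>C\<close>\<close>
    have "\<exists>a. 0 \<le> a \<and> a \<le> 1 \<and> norm (F (z + of_real a)) \<le> 1 + C"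
    proof (rule ccontr)
      assume "\<not> ?thesis"
      then have big: "1 + C < norm (F (z + of_real a))" if "0 \<le> a" "a \<le> 1" for a
        using that by force
      have fi: "integrable lebesgue (\<lambda>s. norm (F (Complex s (Im z))) powr p)"
        using hardy_space_line(2)[OF F y] by (simp add: Lp_def)
      have "1 + C = (LINT s|lebesgue. (1 + C) * indicator {Re z..Re z + 1} s)" by simp
      also have "\<dots> \<le> (LINT s|lebesgue. norm (F (Complex s (Im z))) powr p)"
      proof (rule integral_mono[OF _ fi])
        show "integrable lebesgue (\<lambda>s. (1 + C) * indicator {Re z..Re z + 1} s)"
          by (intro integrable_mult_right integrable_real_indicator) (auto simp: emeasure_lborel_Icc_eq)
        fix s
        show "(1 + C) * indicator {Re z..Re z + 1} s \<le> norm (F (Complex s (Im z))) powr p"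
        proof (cases "s \<in> {Re z..Re z + 1}")
          case True
          have "z + of_real (s - Re z) = Complex s (Im z)" by (simp add: complex_eq_iff)
          then have "1 + C < norm (F (Complex s (Im z)))" using big[of "s - Re z"] True by simp
          moreover from this have "norm (F (Complex s (Im z))) powr 1 \<le> norm (F (Complex s (Im z))) powr p"
            using p C(1) by (intro powr_mono) auto
          ultimately show ?thesis using True C(1) by simp
        qed simp
      qed
      also have "\<dots> \<le> C" by (rule C(2)[OF y])
      finally show False by simp
    qed
    then obtain a where a: "0 \<le> a" "a \<le> 1" "norm (F (z + of_real a)) \<le> 1 + C" by blast
    then show ?thesis
      using diff[OF z a(1,2)] norm_triangle_ineq2[of "F z" "F (z + of_real a)"] by (simp add: norm_minus_commute)
  qed
  then show ?thesis by (rule that)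
qed

section \<open>Passage to the boundary\<close>

lemma nontangential_limit_vertical:
  assumes "has_nontangential_limit F l x"
  shows "(\<lambda>n. F (Complex x (1 / real (Suc n)))) \<longlonglongrightarrow> l"
proof -
  have "(F \<longlongrightarrow> l) (at (complex_of_real x) within nontangential_cone 1 x)"
    using assms by (simp add: has_nontangential_limit_def)
  moreover have "filterlim (\<lambda>n. Complex x (1 / real (Suc n))) (at (complex_of_real x) within nontangential_cone 1 x) sequentially"
    unfolding filterlim_at
  proof
    show "\<forall>\<^sub>F n in sequentially. Complex x (1 / real (Suc n)) \<in> nontangential_cone 1 x \<and> Complex x (1 / real (Suc n)) \<noteq> complex_of_real x"
      by (intro always_eventually) (auto simp: nontangential_cone_def complex_eq_iff)
    have "(\<lambda>n. of_real x + \<i> * of_real (1 / real (Suc n))) \<longlonglongrightarrow> of_real x + \<i> * of_real 0"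
      by (intro tendsto_intros LIMSEQ_Suc lim_1_over_n)
    then show "(\<lambda>n. Complex x (1 / real (Suc n))) \<longlonglongrightarrow> complex_of_real x"
      by (simp add: Complex_eq)
  qed
  ultimately show ?thesis by (rule filterlim_compose)
qed

lemma poisson_integral_of_real:
  "poisson_integral (\<lambda>s. complex_of_real (b s)) z = of_real (LINT s|lebesgue. poisson_kernel z s * b s)"
proof -
  have "poisson_integral (\<lambda>s. complex_of_real (b s)) z = (LINT s|lebesgue. complex_of_real (poisson_kernel z s * b s))"
    unfolding poisson_integral_def by (simp only: scaleR_conv_of_real of_real_mult)
  then show ?thesis by (simp only: integral_complex_of_real)
qed

lemma hardy_space_shift_holomorphic:
  assumes F: "F \<in> hardy_space p" and h: "0 < h"
  shows "(\<lambda>z. F (z + \<i> * of_real h)) holomorphic_on {z. - h < Im z}"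
proof -
  have "F holomorphic_on upper_half_plane" using F by (simp add: hardy_space_def)
  then have "(F \<circ> (\<lambda>z. z + \<i> * of_real h)) holomorphic_on {z. - h < Im z}"
    by (rule holomorphic_on_compose_gen[rotated]) (auto intro!: holomorphic_intros simp: upper_half_plane_def)
  then show ?thesis by (simp add: o_def)
qed

text \<open>The estimate holds for the translates by \<open>h n\<close>. The functions \<open>b n\<close> converge almost everywhere and are
  bounded in $L^2$, so \<open>b n \<le> min (b n) N + (b n)\<^sup>2 / N\<close> allows passage to the limit by dominated convergence
  in the first term, with an error of order $1/N$ in the second.\<close>

lemma hardy_space_majorant:
  assumes F: "F \<in> hardy_space p" and p: "1 \<le> p" and f: "f \<in> Lp p" and bf: "has_boundary_function F f"
    and z: "0 < Im z"
  shows "norm (F z) powr (p / 2) \<le> (LINT s|lebesgue. poisson_kernel z s * norm (f s) powr (p / 2))"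
proof -
  define h where "h n = 1 / real (Suc n)" for n
  have h: "0 < h n" for n by (simp add: h_def)
  have h0: "h \<longlonglongrightarrow> 0" unfolding h_def[abs_def] by (intro LIMSEQ_Suc lim_1_over_n)
  define b where "b n s = norm (F (Complex s (h n))) powr (p / 2)" for n s
  define b0 where "b0 s = norm (f s) powr (p / 2)" for s
  have [measurable]: "f \<in> borel_measurable lebesgue" using f by (simp add: Lp_def)
  have bm [measurable]: "b n \<in> borel_measurable lebesgue" for n
  proof -
    have [measurable]: "(\<lambda>s. F (Complex s (h n))) \<in> borel_measurable lebesgue"
      using hardy_space_line(2)[OF F h[of n]] by (simp add: Lp_def)
    show ?thesis unfolding b_def by measurable
  qed
  have b0m [measurable]: "b0 \<in> borel_measurable lebesgue" unfolding b0_def by measurable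
  have bsq: "(b n s)\<^sup>2 = norm (F (Complex s (h n))) powr p" "(b0 s)\<^sup>2 = norm (f s) powr p" for n s
    by (simp_all add: b_def b0_def powr_half_square)
  have bnn: "0 \<le> b n s" "0 \<le> b0 s" for n s by (simp_all add: b_def b0_def)
  obtain C where C: "0 \<le> C" "\<And>y. 0 < y \<Longrightarrow> (LINT x|lebesgue. norm (F (Complex x y)) powr p) \<le> C"
    using hardy_space_integral_bound[OF F] p by auto
  have k: "integrable lebesgue (poisson_kernel z)"
    using poisson_kernel_integral[OF z] by (auto simp: has_bochner_integral_iff)
  have kp: "0 \<le> poisson_kernel z s" for s using poisson_kernel_pos[OF z, of s] by simp
  have fi: "integrable lebesgue (\<lambda>s. (b n s)\<^sup>2)" for n
    using hardy_space_line(2)[OF F h[of n]] by (simp add: bsq Lp_def)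
  have b0L: "(\<lambda>s. complex_of_real (b0 s)) \<in> Lp 2"
    using f by (simp add: Lp_2_iff bsq Lp_def)
  have Pb0: "integrable lebesgue (\<lambda>s. poisson_kernel z s * b0 s)"
    using integrable_norm[OF Lp_poisson_integrable[OF _ _ b0L z]] kp bnn by (simp add: abs_mult)
  have min_int: "integrable lebesgue (\<lambda>s. poisson_kernel z s * min (u s) N)"
    if "u \<in> borel_measurable lebesgue" "\<And>s. 0 \<le> u s" "0 \<le> N" for u and N :: real
  proof (rule Bochner_Integration.integrable_bound[OF integrable_mult_left[OF k, of N]])
    show "(\<lambda>s. poisson_kernel z s * min (u s) N) \<in> borel_measurable lebesgue" using that(1) by measurable
    show "AE s in lebesgue. norm (poisson_kernel z s * min (u s) N) \<le> norm (poisson_kernel z s * N)"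
      using that kp by (auto intro!: AE_I2 mult_left_mono simp: abs_mult)
  qed
  have step: "norm (F (z + \<i> * of_real (h n))) powr (p / 2) \<le> (LINT s|lebesgue. poisson_kernel z s * min (b n s) N) + C / (pi * Im z) / N"
    if N: "0 < N" for n N
  proof -
    obtain K where K: "\<And>z. h n \<le> Im z \<Longrightarrow> norm (F z) \<le> K" using hardy_space_bounded[OF F p h] by blast
    have "norm (F (z + \<i> * of_real (h n))) powr (p / 2) \<le>
      Re (poisson_integral (\<lambda>s. of_real (norm (F (of_real s + \<i> * of_real (h n))) powr (p / 2))) z)"
    proof (rule norm_powr_le_poisson_integral[OF _ h hardy_space_shift_holomorphic[OF F h]])
      show "norm (F (w + \<i> * of_real (h n))) \<le> K" if "0 \<le> Im w" for w
        using that by (intro K) simp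
      show "integrable lebesgue (\<lambda>s. norm (F (of_real s + \<i> * of_real (h n))) powr p)"
        using fi[of n] by (simp add: bsq Complex_eq)
    qed (use p z in auto)
    also have "\<dots> = (LINT s|lebesgue. poisson_kernel z s * b n s)"
      unfolding poisson_integral_of_real Complex_eq[symmetric] b_def[symmetric] by simp
    also have "\<dots> \<le> (LINT s|lebesgue. poisson_kernel z s * min (b n s) N + 1 / (pi * Im z) / N * (b n s)\<^sup>2)"
    proof (rule integral_mono_AE')
      show "integrable lebesgue (\<lambda>s. poisson_kernel z s * min (b n s) N + 1 / (pi * Im z) / N * (b n s)\<^sup>2)"
        by (intro Bochner_Integration.integrable_add integrable_mult_right fi min_int) (use N bnn in auto)
      show "AE s in lebesgue. poisson_kernel z s * b n s \<le> poisson_kernel z s * min (b n s) N + 1 / (pi * Im z) / N * (b n s)\<^sup>2"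
      proof (rule AE_I2)
        fix s
        have "b n s \<le> min (b n s) N + (b n s)\<^sup>2 / N"
        proof (cases "b n s \<le> N")
          case False
          then have "b n s * N \<le> (b n s)\<^sup>2" using bnn(1)[of n s] by (simp add: power2_eq_square mult_left_mono)
          then have "b n s \<le> (b n s)\<^sup>2 / N" using N by (simp add: field_simps)
          moreover have "0 \<le> min (b n s) N" using bnn(1)[of n s] N by simp
          ultimately show ?thesis by linarith
        qed (use N in auto)
        then have "poisson_kernel z s * b n s \<le> poisson_kernel z s * min (b n s) N + poisson_kernel z s * ((b n s)\<^sup>2 / N)"
          using mult_left_mono[OF _ kp[of s]] by (metis distrib_left)
        also have "poisson_kernel z s * ((b n s)\<^sup>2 / N) \<le> 1 / (pi * Im z) * ((b n s)\<^sup>2 / N)"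
          using poisson_kernel_le[OF z] N by (intro mult_right_mono) auto
        finally show "poisson_kernel z s * b n s \<le> poisson_kernel z s * min (b n s) N + 1 / (pi * Im z) / N * (b n s)\<^sup>2"
          by simp
      qed
      show "AE s in lebesgue. 0 \<le> poisson_kernel z s * min (b n s) N + 1 / (pi * Im z) / N * (b n s)\<^sup>2"
        using kp bnn N z by (intro AE_I2 add_nonneg_nonneg mult_nonneg_nonneg) auto
    qed
    also have "\<dots> = (LINT s|lebesgue. poisson_kernel z s * min (b n s) N) + 1 / (pi * Im z) / N * (LINT s|lebesgue. (b n s)\<^sup>2)"
      using fi min_int[OF bm bnn(1)] N by (subst Bochner_Integration.integral_add) auto
    also have "1 / (pi * Im z) / N * (LINT s|lebesgue. (b n s)\<^sup>2) \<le> 1 / (pi * Im z) / N * C"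
      using C(2)[OF h[of n]] z N unfolding bsq by (intro mult_left_mono) auto
    finally show ?thesis by (simp add: mult.commute)
  qed
  have lim: "norm (F z) powr (p / 2) \<le> (LINT s|lebesgue. poisson_kernel z s * b0 s) + C / (pi * Im z) / N" if N: "0 < N" for N
  proof -
    have "continuous_on upper_half_plane F"
      using F by (auto simp: hardy_space_def holomorphic_on_imp_continuous_on)
    then have "isCont F z"
      using z by (simp add: continuous_on_eq_continuous_at[OF open_upper_half_plane]) (simp add: upper_half_plane_def)
    moreover have "(\<lambda>n. z + \<i> * of_real (h n)) \<longlonglongrightarrow> z + \<i> * of_real 0"
      by (intro tendsto_intros h0)
    then have "(\<lambda>n. z + \<i> * of_real (h n)) \<longlonglongrightarrow> z" by simp
    ultimately have "(\<lambda>n. F (z + \<i> * of_real (h n))) \<longlonglongrightarrow> F z"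
      by (rule isCont_tendsto_compose)
    then have L: "(\<lambda>n. norm (F (z + \<i> * of_real (h n))) powr (p / 2)) \<longlonglongrightarrow> norm (F z) powr (p / 2)"
      using p by (intro tendsto_powr' tendsto_norm) auto
    have "(\<lambda>n. LINT s|lebesgue. poisson_kernel z s * min (b n s) N) \<longlonglongrightarrow> (LINT s|lebesgue. poisson_kernel z s * min (b0 s) N)"
    proof (rule integral_dominated_convergence)
      show "integrable lebesgue (\<lambda>s. poisson_kernel z s * N)" using k by simp
      show "AE s in lebesgue. norm (poisson_kernel z s * min (b n s) N) \<le> poisson_kernel z s * N" for n
        using kp bnn N by (auto intro!: AE_I2 mult_left_mono simp: abs_mult)
      show "AE s in lebesgue. (\<lambda>n. poisson_kernel z s * min (b n s) N) \<longlonglongrightarrow> poisson_kernel z s * min (b0 s) N"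
        using bf unfolding has_boundary_function_def
      proof eventually_elim
        case (elim s)
        have "(\<lambda>n. F (Complex s (h n))) \<longlonglongrightarrow> f s"
          using nontangential_limit_vertical[OF elim] by (simp add: h_def)
        then have "(\<lambda>n. b n s) \<longlonglongrightarrow> b0 s"
          unfolding b_def b0_def using p by (intro tendsto_powr' tendsto_norm) auto
        then show ?case by (intro tendsto_intros)
      qed
    qed measurable
    then have "(\<lambda>n. (LINT s|lebesgue. poisson_kernel z s * min (b n s) N) + C / (pi * Im z) / N)
       \<longlonglongrightarrow> (LINT s|lebesgue. poisson_kernel z s * min (b0 s) N) + C / (pi * Im z) / N"
      by (intro tendsto_add tendsto_const)
    then have "norm (F z) powr (p / 2) \<le> (LINT s|lebesgue. poisson_kernel z s * min (b0 s) N) + C / (pi * Im z) / N"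
      using step[OF N] by (intro LIMSEQ_le[OF L]) auto
    also have "(LINT s|lebesgue. poisson_kernel z s * min (b0 s) N) \<le> (LINT s|lebesgue. poisson_kernel z s * b0 s)"
      using kp N bnn by (intro integral_mono min_int b0m Pb0 mult_left_mono) auto
    finally show ?thesis by simp
  qed
  have "norm (F z) powr (p / 2) \<le> (LINT s|lebesgue. poisson_kernel z s * b0 s)"
  proof (rule field_le_epsilon)
    fix e :: real assume e: "0 < e"
    define N where "N = (C / (pi * Im z) + 1) / e"
    have "0 \<le> C / (pi * Im z)" using C z by simp
    then have N: "0 < N" using e by (simp add: N_def)
    have "C / (pi * Im z) \<le> N * e" using e by (simp add: N_def)
    then have "C / (pi * Im z) \<le> e * N" by (simp only: mult.commute)
    then have "C / (pi * Im z) / N \<le> e" by (rule pos_divide_le_eq[OF N, THEN iffD2])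
    then show "norm (F z) powr (p / 2) \<le> (LINT s|lebesgue. poisson_kernel z s * b0 s) + e"
      using lim[OF N] by linarith
  qed
  then show ?thesis by (simp add: b0_def)
qed

text \<open>Square the majorant of $|F|^{p/2}$ and use that the Poisson integral is a contraction of $L^2$.\<close>

lemma hardy_space_norm_le_boundary:
  assumes F: "F \<in> hardy_space p" and p: "1 \<le> p" and f: "f \<in> Lp p" and bf: "has_boundary_function F f"
    and y: "0 < y"
  shows "(LINT x|lebesgue. norm (F (Complex x y)) powr p) \<le> (LINT x|lebesgue. norm (f x) powr p)"
proof -
  define b where "b s = complex_of_real (norm (f s) powr (p / 2))" for s
  have e: "norm (b s) powr 2 = norm (f s) powr p" for s
    by (cases "f s = 0") (auto simp: b_def powr_powr)
  have [measurable]: "f \<in> borel_measurable lebesgue" using f by (simp add: Lp_def)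
  have bm: "b \<in> borel_measurable lebesgue" unfolding b_def by measurable
  have bL: "b \<in> Lp 2" using f bm unfolding Lp_def mem_Collect_eq e by simp
  have "(LINT x|lebesgue. norm (F (Complex x y)) powr p) \<le> (LINT x|lebesgue. norm (poisson_integral b (Complex x y)) powr 2)"
  proof (rule integral_mono)
    show "integrable lebesgue (\<lambda>x. norm (F (Complex x y)) powr p)"
      using F y by (simp add: hardy_space_def)
    show "integrable lebesgue (\<lambda>x. norm (poisson_integral b (Complex x y)) powr 2)"
      using poisson_integral_Lp_contraction(1)[OF _ _ bL y] by simp
    fix x
    have "norm (F (Complex x y)) powr (p / 2) \<le> norm (poisson_integral b (Complex x y))"
      using hardy_space_majorant[OF F p f bf, of "Complex x y"] y
      unfolding b_def poisson_integral_of_real norm_of_real by simp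
    then have "(norm (F (Complex x y)) powr (p / 2)) powr 2 \<le> norm (poisson_integral b (Complex x y)) powr 2"
      by (intro powr_mono2) auto
    then show "norm (F (Complex x y)) powr p \<le> norm (poisson_integral b (Complex x y)) powr 2"
      by (simp add: powr_powr)
  qed
  also have "\<dots> \<le> (LINT x|lebesgue. norm (b x) powr 2)"
    using poisson_integral_Lp_contraction(2)[OF _ _ bL y] by simp
  finally show ?thesis unfolding e .
qed

text \<open>Apply Fatou's lemma to the nonnegative functions \<open>V n\<close>, the difference of
  $2^p (|u_n|^p + |f|^p)$ and $|u_n - f|^p$.\<close>

lemma Lp_convergence_of_norms:
  fixes u :: "nat \<Rightarrow> real \<Rightarrow> complex"
  assumes p: "0 < p" and u: "\<And>n. u n \<in> Lp p" and f: "f \<in> Lp p"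
    and ae: "AE x in lebesgue. (\<lambda>n. u n x) \<longlonglongrightarrow> f x"
    and le: "\<And>n. (LINT x|lebesgue. norm (u n x) powr p) \<le> (LINT x|lebesgue. norm (f x) powr p)"
  shows "\<And>n. integrable lebesgue (\<lambda>x. norm (u n x - f x) powr p)"
    and "(\<lambda>n. LINT x|lebesgue. norm (u n x - f x) powr p) \<longlonglongrightarrow> 0"
proof -
  have [measurable]: "u n \<in> borel_measurable lebesgue" "f \<in> borel_measurable lebesgue" for n
    using u f by (auto simp: Lp_def)
  have ui: "integrable lebesgue (\<lambda>x. norm (u n x) powr p)" for n using u by (simp add: Lp_def)
  have fi: "integrable lebesgue (\<lambda>x. norm (f x) powr p)" using f by (simp add: Lp_def)
  define S where "S n x = 2 powr p * (norm (u n x) powr p + norm (f x) powr p)" for n x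
  have Si: "integrable lebesgue (S n)" for n
    unfolding S_def by (intro integrable_mult_right Bochner_Integration.integrable_add ui fi)
  have dS: "norm (u n x - f x) powr p \<le> S n x" for n x
  proof -
    let ?m = "max (norm (u n x)) (norm (f x))"
    have "norm (u n x - f x) \<le> 2 * ?m" using norm_triangle_ineq4[of "u n x" "f x"] by linarith
    then have "norm (u n x - f x) powr p \<le> (2 * ?m) powr p" using p by (intro powr_mono2) auto
    also have "\<dots> = 2 powr p * ?m powr p" by (simp add: powr_mult)
    also have "?m powr p \<le> norm (u n x) powr p + norm (f x) powr p"
      by (simp add: max_def)
    finally show ?thesis by (simp add: S_def)
  qed
  have dm [measurable]: "(\<lambda>x. norm (u n x - f x) powr p) \<in> borel_measurable lebesgue" for n
    by measurable
  show di: "integrable lebesgue (\<lambda>x. norm (u n x - f x) powr p)" for n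
    by (rule Bochner_Integration.integrable_bound[OF Si[of n] dm]) (use order_trans[OF dS[of n] abs_ge_self] in \<open>auto intro!: AE_I2\<close>)
  let ?I = "LINT x|lebesgue. norm (f x) powr p"
  let ?d = "\<lambda>n. LINT x|lebesgue. norm (u n x - f x) powr p"
  define V where "V n x = S n x - norm (u n x - f x) powr p" for n x
  have Vi: "integrable lebesgue (V n)" for n unfolding V_def by (intro Bochner_Integration.integrable_diff Si di)
  have V0: "0 \<le> V n x" for n x using dS[of n x] by (simp add: V_def)
  have Vint: "integral\<^sup>L lebesgue (V n) \<le> 2 powr p * (2 * ?I) - ?d n" for n
  proof -
    have "integral\<^sup>L lebesgue (V n) = 2 powr p * ((LINT x|lebesgue. norm (u n x) powr p) + ?I) - ?d n"
      unfolding V_def using Si di ui fi by (simp add: S_def)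
    also have "\<dots> \<le> 2 powr p * (?I + ?I) - ?d n"
      using le by (intro diff_right_mono mult_left_mono add_right_mono) auto
    finally show ?thesis by simp
  qed
  have "ennreal (2 powr p * (2 * ?I)) = (\<integral>\<^sup>+x. ennreal (2 powr p * (2 * norm (f x) powr p)) \<partial>lebesgue)"
    using fi by (subst nn_integral_eq_integral) auto
  also have "\<dots> = (\<integral>\<^sup>+x. liminf (\<lambda>n. ennreal (V n x)) \<partial>lebesgue)"
  proof (rule nn_integral_cong_AE)
    show "AE x in lebesgue. ennreal (2 powr p * (2 * norm (f x) powr p)) = liminf (\<lambda>n. ennreal (V n x))"
      using ae
    proof eventually_elim
      case (elim x)
      have "(\<lambda>n. norm (u n x) powr p) \<longlonglongrightarrow> norm (f x) powr p"
        using p elim by (intro tendsto_powr' tendsto_norm) auto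
      moreover have "(\<lambda>n. norm (u n x - f x) powr p) \<longlonglongrightarrow> norm (f x - f x) powr p"
        using p elim by (intro tendsto_powr' tendsto_norm tendsto_diff) auto
      ultimately have "(\<lambda>n. V n x) \<longlonglongrightarrow> 2 powr p * (norm (f x) powr p + norm (f x) powr p) - norm (f x - f x) powr p"
        unfolding V_def S_def by (intro tendsto_diff tendsto_mult tendsto_add tendsto_const)
      then have "(\<lambda>n. ennreal (V n x)) \<longlonglongrightarrow> ennreal (2 powr p * (2 * norm (f x) powr p))"
        by (intro tendsto_ennrealI) simp
      then show ?case by (intro lim_imp_Liminf[symmetric]) auto
    qed
  qed
  also have "\<dots> \<le> liminf (\<lambda>n. \<integral>\<^sup>+x. ennreal (V n x) \<partial>lebesgue)"
    using Vi by (intro nn_integral_liminf) auto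
  also have "\<dots> = liminf (\<lambda>n. ennreal (integral\<^sup>L lebesgue (V n)))"
    using Vi V0 by (simp add: nn_integral_eq_integral)
  finally have Fatou: "ennreal (2 powr p * (2 * ?I)) \<le> liminf (\<lambda>n. ennreal (integral\<^sup>L lebesgue (V n)))" .
  show "?d \<longlonglongrightarrow> 0"
  proof (rule LIMSEQ_I)
    fix e :: real assume e: "0 < e"
    have d0: "0 \<le> ?d n" for n by (simp add: Bochner_Integration.integral_nonneg)
    have "\<forall>\<^sub>F n in sequentially. ?d n < e"
    proof (cases "e \<le> 2 powr p * (2 * ?I)")
      case True
      have "ennreal (2 powr p * (2 * ?I) - e) < ennreal (2 powr p * (2 * ?I))"
        using True e by (intro ennreal_lessI) auto
      also note Fatou
      finally have "\<forall>\<^sub>F n in sequentially. ennreal (2 powr p * (2 * ?I) - e) < ennreal (integral\<^sup>L lebesgue (V n))"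
        by (rule less_LiminfD)
      then show ?thesis
      proof eventually_elim
        case (elim n)
        then have "2 powr p * (2 * ?I) - e < integral\<^sup>L lebesgue (V n)"
          using True by (simp add: ennreal_less_iff)
        then show ?case using Vint[of n] by linarith
      qed
    next
      case False
      have "?d n < e" for n
      proof -
        have "0 \<le> integral\<^sup>L lebesgue (V n)" using V0 by (simp add: Bochner_Integration.integral_nonneg)
        then show ?thesis using Vint[of n] False by linarith
      qed
      then show ?thesis by simp
    qed
    then show "\<exists>no. \<forall>n\<ge>no. norm (?d n - 0) < e"
      using d0 by (simp add: eventually_sequentially)
  qed
qed

text \<open>By \<open>powr_mult_bound\<close> the error is at most a constant depending on \<open>\<eta>\<close> times the distance in $L^p$,
  plus a term proportional to \<open>\<eta>\<close>.\<close>

lemma poisson_integral_Lp_tendsto: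
  fixes u :: "nat \<Rightarrow> real \<Rightarrow> complex"
  assumes p: "1 \<le> p" "p \<le> 2" and u: "\<And>n. u n \<in> Lp p" and f: "f \<in> Lp p" and z: "0 < Im z"
    and i: "\<And>n. integrable lebesgue (\<lambda>x. norm (u n x - f x) powr p)"
    and lim: "(\<lambda>n. LINT x|lebesgue. norm (u n x - f x) powr p) \<longlonglongrightarrow> 0"
  shows "(\<lambda>n. poisson_integral (u n) z) \<longlonglongrightarrow> poisson_integral f z"
proof (rule LIMSEQ_I)
  fix e :: real assume e: "0 < e"
  let ?d = "\<lambda>n. LINT x|lebesgue. norm (u n x - f x) powr p"
  define S where "S = (LINT s|lebesgue. (poisson_kernel z s)\<^sup>2)"
  have k2: "integrable lebesgue (\<lambda>s. (poisson_kernel z s)\<^sup>2)"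
    using poisson_kernel_bounded_L2[OF z] by (simp add: bounded_L2_def)
  have S: "0 \<le> S" unfolding S_def by (intro Bochner_Integration.integral_nonneg) simp
  define \<eta> where "\<eta> = e / (S + 1)"
  have \<eta>: "0 < \<eta>" using e S by (simp add: \<eta>_def)
  define M where "M = 1 / (pi * Im z) + 1 / (2 * \<eta>)"
  have M: "0 < M" using z \<eta> by (simp add: M_def add_pos_pos)
  have b: "norm (poisson_integral (u n) z - poisson_integral f z) \<le> M * ?d n + \<eta> / 2 * S" for n
  proof -
    have "poisson_integral (u n) z - poisson_integral f z = (LINT s|lebesgue. poisson_kernel z s *\<^sub>R (u n s - f s))"
      unfolding poisson_integral_def scaleR_diff_right
      using Lp_poisson_integrable[OF p u z] Lp_poisson_integrable[OF p f z] by simp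
    also have "norm \<dots> \<le> (LINT s|lebesgue. M * norm (u n s - f s) powr p + \<eta> / 2 * (poisson_kernel z s)\<^sup>2)"
    proof (rule norm_integral_le_of_bound)
      show "integrable lebesgue (\<lambda>s. M * norm (u n s - f s) powr p + \<eta> / 2 * (poisson_kernel z s)\<^sup>2)"
        by (intro Bochner_Integration.integrable_add integrable_mult_right i k2)
      fix s
      have "\<bar>poisson_kernel z s\<bar> \<le> 1 / (pi * Im z)"
        using poisson_kernel_le[OF z, of s] poisson_kernel_pos[OF z, of s] by simp
      from powr_mult_bound[OF norm_ge_zero p this \<eta>, of "u n s - f s"]
      show "norm (poisson_kernel z s *\<^sub>R (u n s - f s)) \<le> M * norm (u n s - f s) powr p + \<eta> / 2 * (poisson_kernel z s)\<^sup>2"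
        by (simp add: M_def mult.commute)
    qed
    also have "\<dots> = M * ?d n + \<eta> / 2 * S" unfolding S_def using i k2 by simp
    finally show ?thesis .
  qed
  have "\<eta> * (S + 1) = e" using S by (simp add: \<eta>_def)
  then have \<eta>S: "\<eta> / 2 * S < e / 2 " using \<eta> by (simp add: algebra_simps)
  have "\<forall>\<^sub>F n in sequentially. ?d n < e / 2 / M"
    using lim e M by (intro order_tendstoD(2)[OF lim]) auto
  then have "\<forall>\<^sub>F n in sequentially. norm (poisson_integral (u n) z - poisson_integral f z) < e"
  proof eventually_elim
    case (elim n)
    then have "?d n * M < e / 2" by (rule pos_less_divide_eq[OF M, THEN iffD1])
    then have "M * ?d n < e / 2" by (simp only: mult.commute)
    with b[of n] \<eta>S show ?case by linarith
  qed
  then show "\<exists>no. \<forall>n\<ge>no. norm (poisson_integral (u n) z - poisson_integral f z) < e"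
    by (simp add: eventually_sequentially)
qed

text \<open>The translates of \<open>F\<close> by \<open>h n\<close> are the Poisson integrals of their values \<open>u n\<close> on the real line, and the
  \<open>u n\<close> converge to \<open>f\<close> in $L^p$ because they converge almost everywhere with norms at most that of \<open>f\<close>.\<close>

lemma hardy_space_eq_poisson_integral:
  assumes F: "F \<in> hardy_space p" and p: "1 \<le> p" "p \<le> 2" and f: "f \<in> Lp p" and bf: "has_boundary_function F f"
    and z: "0 < Im z"
  shows "F z = poisson_integral f z"
proof -
  define h where "h n = 1 / real (Suc n)" for n
  have h: "0 < h n" for n by (simp add: h_def)
  have h0: "h \<longlonglongrightarrow> 0" unfolding h_def[abs_def] by (intro LIMSEQ_Suc lim_1_over_n)
  define u where "u n s = F (Complex s (h n))" for n s
  have u: "u n \<in> Lp p" for n unfolding u_def by (rule hardy_space_line(2)[OF F h])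
  have ae: "AE x in lebesgue. (\<lambda>n. u n x) \<longlonglongrightarrow> f x"
    using bf unfolding has_boundary_function_def
    by eventually_elim (auto dest: nontangential_limit_vertical simp: u_def h_def)
  have le: "(LINT x|lebesgue. norm (u n x) powr p) \<le> (LINT x|lebesgue. norm (f x) powr p)" for n
    unfolding u_def by (rule hardy_space_norm_le_boundary[OF F p(1) f bf h])
  have p0: "0 < p" using p by simp
  have P: "(\<lambda>n. poisson_integral (u n) z) \<longlonglongrightarrow> poisson_integral f z"
    by (rule poisson_integral_Lp_tendsto[OF p u f z Lp_convergence_of_norms[OF p0 u f ae le]])
  have eq: "poisson_integral (u n) z = F (z + \<i> * of_real (h n))" for n
  proof -
    obtain K where K: "\<And>z. h n \<le> Im z \<Longrightarrow> norm (F z) \<le> K" using hardy_space_bounded[OF F p(1) h] by blast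
    have "F (z + \<i> * of_real (h n)) = poisson_integral (\<lambda>s. F (of_real s + \<i> * of_real (h n))) z"
    proof (rule holomorphic_eq_poisson_integral[OF p h hardy_space_shift_holomorphic[OF F h] _ _ z])
      show "norm (F (w + \<i> * of_real (h n))) \<le> K" if "0 \<le> Im w" for w
        using that by (intro K) simp
      show "(\<lambda>s. F (of_real s + \<i> * of_real (h n))) \<in> Lp p"
        using u[of n] unfolding u_def Complex_eq .
    qed
    then show ?thesis by (simp add: u_def[abs_def] Complex_eq)
  qed
  have "continuous_on upper_half_plane F"
    using F by (auto simp: hardy_space_def holomorphic_on_imp_continuous_on)
  then have "isCont F z"
    using z by (simp add: continuous_on_eq_continuous_at[OF open_upper_half_plane]) (simp add: upper_half_plane_def)
  moreover have "(\<lambda>n. z + \<i> * of_real (h n)) \<longlonglongrightarrow> z + \<i> * of_real 0"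
    by (intro tendsto_intros h0)
  then have "(\<lambda>n. z + \<i> * of_real (h n)) \<longlonglongrightarrow> z" by simp
  ultimately have "(\<lambda>n. F (z + \<i> * of_real (h n))) \<longlonglongrightarrow> F z"
    by (rule isCont_tendsto_compose)
  then show ?thesis using P unfolding eq by (rule LIMSEQ_unique)
qed

section \<open>Cauchy integrals from below and the spectrum\<close>

lemma cauchy_integral_tendsto_0:
  assumes p: "1 \<le> p" "p \<le> 2" "f \<in> Lp p"
  shows "(\<lambda>n. cauchy_integral f (- \<i> * of_real (real (Suc n)))) \<longlonglongrightarrow> 0"
proof -
  have [measurable]: "f \<in> borel_measurable lebesgue" using p by (simp add: Lp_def)
  let ?w = "\<lambda>n. - \<i> * complex_of_real (real (Suc n))"
  have nw: "norm (1 / (of_real s - ?w n)) \<le> norm (1 / (of_real s - ?w 0))" "norm (1 / (of_real s - ?w n)) \<le> 1 / real (Suc n)" for s n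
  proof -
    have "of_real s - ?w 0 \<noteq> 0" by (simp add: complex_eq_iff)
    then have pos: "0 < norm (of_real s - ?w 0)" by (simp only: zero_less_norm_iff not_False_eq_True)
    have "(norm (of_real s - ?w 0))\<^sup>2 \<le> (norm (of_real s - ?w n))\<^sup>2"
      by (simp add: cmod_power2 one_le_power)
    then have "norm (of_real s - ?w 0) \<le> norm (of_real s - ?w n)" by (rule power2_le_imp_le) simp
    then have "1 / norm (of_real s - ?w n) \<le> 1 / norm (of_real s - ?w 0)"
      using pos by (intro divide_left_mono mult_pos_pos) linarith+
    then show "norm (1 / (of_real s - ?w n)) \<le> norm (1 / (of_real s - ?w 0))"
      by (simp only: norm_divide norm_one)
    show "norm (1 / (of_real s - ?w n)) \<le> 1 / real (Suc n)"
      using norm_cauchy_kernel_le[of "?w n" s] by (simp add: add.commute)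
  qed
  have "(\<lambda>n. LINT s|lebesgue. f s * (1 / (of_real s - ?w n))) \<longlonglongrightarrow> integral\<^sup>L lebesgue (\<lambda>s::real. 0::complex)"
  proof (rule integral_dominated_convergence)
    show "integrable lebesgue (\<lambda>s. norm (f s) * norm (1 / (of_real s - ?w 0)))"
      by (rule Lp_mult_bounded_L2[OF p cauchy_kernel_bounded_L2]) simp
    show "AE s in lebesgue. norm (f s * (1 / (of_real s - ?w n))) \<le> norm (f s) * norm (1 / (of_real s - ?w 0))" for n
      unfolding norm_mult by (intro AE_I2 mult_left_mono nw) auto
    show "AE s in lebesgue. (\<lambda>n. f s * (1 / (of_real s - ?w n))) \<longlonglongrightarrow> 0"
    proof (rule AE_I2)
      fix s
      have "(\<lambda>n. 1 / (of_real s - ?w n)) \<longlonglongrightarrow> 0"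
      proof (rule Lim_null_comparison)
        show "\<forall>\<^sub>F n in sequentially. norm (1 / (of_real s - ?w n)) \<le> 1 / real (Suc n)" using nw(2) by simp
        show "(\<lambda>n. 1 / real (Suc n)) \<longlonglongrightarrow> 0" by (intro LIMSEQ_Suc lim_1_over_n)
      qed
      from tendsto_mult_left[OF this, of "f s"] show "(\<lambda>n. f s * (1 / (of_real s - ?w n))) \<longlonglongrightarrow> 0" by simp
    qed
  qed measurable
  then have "(\<lambda>n. LINT s|lebesgue. f s * (1 / (of_real s - ?w n))) \<longlonglongrightarrow> 0" by simp
  from tendsto_mult_left[OF this, of "1 / (2 * pi * \<i>)"] show ?thesis
    unfolding cauchy_integral_def by simp
qed

text \<open>Compare the two derivatives in the directions 1 and \<open>\<i>\<close>.\<close>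

lemma holomorphic_and_cnj_holomorphic_imp_deriv_0:
  assumes "(R has_field_derivative D) (at z)" "((\<lambda>z. cnj (R z)) has_field_derivative E) (at z)"
  shows "D = 0"
proof -
  have "(R has_derivative (\<lambda>h. D * h)) (at z)" using assms(1) by (simp add: has_field_derivative_def)
  then have "((\<lambda>z. cnj (R z)) has_derivative (\<lambda>h. cnj (D * h))) (at z)"
    by (rule has_derivative_cnj)
  moreover have "((\<lambda>z. cnj (R z)) has_derivative (\<lambda>h. E * h)) (at z)" using assms(2) by (simp add: has_field_derivative_def)
  ultimately have eq: "(\<lambda>h. cnj (D * h)) = (\<lambda>h. E * h)" by (rule has_derivative_unique)
  have "cnj D = E" using fun_cong[OF eq, of 1] by simp
  moreover have "cnj D * (- \<i>) = E * \<i>" using fun_cong[OF eq, of \<i>] by simp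
  ultimately have "E = 0" by simp
  with \<open>cnj D = E\<close> show "D = 0" by simp
qed

text \<open>The function \<open>R\<close> is antiholomorphic by construction, and holomorphic as the difference of the Cauchy and
  the Poisson integral. So it is constant, and the constant is its limit along the imaginary axis.\<close>

lemma cauchy_integral_lower_eq_0:
  assumes p: "1 \<le> p" "p \<le> 2" "f \<in> Lp p" and hol: "poisson_integral f holomorphic_on upper_half_plane"
    and z: "0 < Im z"
  shows "cauchy_integral f (cnj z) = 0"
proof -
  define R where "R z = cauchy_integral f (cnj z)" for z
  have U: "upper_half_plane \<subseteq> {z. Im z \<noteq> 0}" "cnj ` upper_half_plane \<subseteq> {z. Im z \<noteq> 0}"
    by (auto simp: upper_half_plane_def)
  have "(\<lambda>z. cauchy_integral f z - poisson_integral f z) holomorphic_on upper_half_plane"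
    by (intro holomorphic_on_diff hol holomorphic_on_subset[OF cauchy_integral_holomorphic[OF p]] U)
  then have R1: "R holomorphic_on upper_half_plane"
    by (rule holomorphic_transform)
       (auto simp: R_def upper_half_plane_def poisson_integral_eq_cauchy[OF p])
  have "cnj \<circ> cauchy_integral f \<circ> cnj holomorphic_on upper_half_plane"
    by (intro holomorphic_on_compose_cnj_cnj open_upper_half_plane
        holomorphic_on_subset[OF cauchy_integral_holomorphic[OF p]] U)
  then have R2: "(\<lambda>z. cnj (R z)) holomorphic_on upper_half_plane" by (simp add: R_def o_def)
  have D0: "(R has_field_derivative 0) (at w within upper_half_plane)" if w: "w \<in> upper_half_plane" for w
  proof -
    have "(R has_field_derivative deriv R w) (at w)"
      by (rule holomorphic_derivI[OF R1 open_upper_half_plane w])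
    moreover have "((\<lambda>z. cnj (R z)) has_field_derivative deriv (\<lambda>z. cnj (R z)) w) (at w)"
      by (rule holomorphic_derivI[OF R2 open_upper_half_plane w])
    ultimately have "deriv R w = 0" by (rule holomorphic_and_cnj_holomorphic_imp_deriv_0)
    with \<open>(R has_field_derivative deriv R w) (at w)\<close> show ?thesis
      by (simp add: has_field_derivative_at_within)
  qed
  obtain c where c: "\<And>w. w \<in> upper_half_plane \<Longrightarrow> R w = c"
    using has_field_derivative_zero_constant[OF convex_upper_half_plane D0] by metis
  have "R (\<i> * of_real (real (Suc n))) = c" for n
    by (rule c) (simp add: upper_half_plane_def)
  then have "(\<lambda>n. cauchy_integral f (- \<i> * of_real (real (Suc n)))) = (\<lambda>n. c)"
    by (simp add: R_def)
  with cauchy_integral_tendsto_0[OF p] have "(\<lambda>n::nat. c) \<longlonglongrightarrow> 0" by simp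
  then have "c = 0" by (simp add: LIMSEQ_const_iff)
  then show ?thesis using c[of z] z by (simp add: R_def upper_half_plane_def)
qed

text \<open>By Lindelof's theorem countably many open null sets suffice to cover the negative half-line.\<close>

lemma ess_support_subset_nonneg_iff:
  "ess_support g \<subseteq> {0..} \<longleftrightarrow> (AE t in lebesgue. t < 0 \<longrightarrow> g t = 0)"
proof
  assume sub: "ess_support g \<subseteq> {0..}"
  define \<U> where "\<U> = {U. open U \<and> (AE t in lebesgue. t \<in> U \<longrightarrow> g t = 0)}"
  obtain \<V> where V: "\<V> \<subseteq> \<U>" "countable \<V>" "\<Union>\<V> = \<Union>\<U>"
    using Lindelof[of \<U>] unfolding \<U>_def by auto
  have "AE t in lebesgue. \<forall>U\<in>\<V>. t \<in> U \<longrightarrow> g t = 0"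
    using V(1,2) by (intro AE_ball_countable[THEN iffD2]) (auto simp: \<U>_def)
  then show "AE t in lebesgue. t < 0 \<longrightarrow> g t = 0"
  proof eventually_elim
    case (elim t)
    show ?case
    proof
      assume "t < 0"
      then have "t \<in> \<Union>\<V>" using sub V(3) by (auto simp: ess_support_def \<U>_def)
      with elim show "g t = 0" by blast
    qed
  qed
next
  assume "AE t in lebesgue. t < 0 \<longrightarrow> g t = 0"
  then have "{..<0} \<in> {U. open U \<and> (AE t in lebesgue. t \<in> U \<longrightarrow> g t = 0)}" by simp
  then have "{..<0} \<subseteq> \<Union> {U. open U \<and> (AE t in lebesgue. t \<in> U \<longrightarrow> g t = 0)}" by (rule Union_upper)
  then have "- \<Union> {U. open U \<and> (AE t in lebesgue. t \<in> U \<longrightarrow> g t = 0)} \<subseteq> - {..<0}" by (rule Compl_anti_mono)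
  then show "ess_support g \<subseteq> {0..}" unfolding ess_support_def by auto
qed

lemma weak_fourier_upper_exp:
  assumes g: "weak_fourier f g" and z: "0 < Im z"
  shows "integrable lebesgue (\<lambda>t. g t * upper_exp z t)"
    "1 / of_real (sqrt (2 * pi)) * (LINT t|lebesgue. g t * upper_exp z t) = cauchy_integral f z"
proof -
  have *: "integrable lebesgue (\<lambda>t. g t * upper_exp z t)"
    "(LINT t|lebesgue. g t * upper_exp z t) = (LINT t|lebesgue. f t * fourier_integral (upper_exp z) t)"
    using g upper_exp_test[OF z] by (auto simp: weak_fourier_def)
  show "integrable lebesgue (\<lambda>t. g t * upper_exp z t)" by fact
  have "(\<lambda>t. f t * fourier_integral (upper_exp z) t) =
    (\<lambda>t. (of_real (sqrt (2 * pi)) * (1 / (2 * pi * \<i>))) * (f t * (1 / (of_real t - z))))"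
    unfolding fourier_integral_upper_exp[OF z] by (simp only: mult_ac)
  then have "(LINT t|lebesgue. g t * upper_exp z t) = of_real (sqrt (2 * pi)) * cauchy_integral f z"
    unfolding *(2) cauchy_integral_def by (simp only: integral_mult_right_zero mult.assoc)
  then show "1 / of_real (sqrt (2 * pi)) * (LINT t|lebesgue. g t * upper_exp z t) = cauchy_integral f z"
    by simp
qed

lemma weak_fourier_lower_exp:
  assumes g: "weak_fourier f g" and z: "0 < Im z"
  shows "integrable lebesgue (\<lambda>t. g t * lower_exp z t)"
    "(LINT t|lebesgue. g t * lower_exp z t) = - of_real (sqrt (2 * pi)) * cauchy_integral f (cnj z)"
proof -
  have *: "integrable lebesgue (\<lambda>t. g t * lower_exp z t)"
    "(LINT t|lebesgue. g t * lower_exp z t) = (LINT t|lebesgue. f t * fourier_integral (lower_exp z) t)"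
    using g lower_exp_test[OF z] by (auto simp: weak_fourier_def)
  show "integrable lebesgue (\<lambda>t. g t * lower_exp z t)" by fact
  have "(\<lambda>t. f t * fourier_integral (lower_exp z) t) =
    (\<lambda>t. (- of_real (sqrt (2 * pi)) * (1 / (2 * pi * \<i>))) * (f t * (1 / (of_real t - cnj z))))"
    unfolding fourier_integral_lower_exp[OF z] by (simp only: mult_ac)
  then show "(LINT t|lebesgue. g t * lower_exp z t) = - of_real (sqrt (2 * pi)) * cauchy_integral f (cnj z)"
    unfolding *(2) cauchy_integral_def by (simp only: integral_mult_right_zero mult.assoc)
qed

text \<open>At height 1 the values of \<open>cauchy_integral f (cnj z)\<close> are, up to a constant and a reflection, those of
  the Fourier transform of \<open>g * lower_exp \<i>\<close>; if they all vanish, so does this integrable function.\<close>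

lemma cauchy_lower_eq_0_iff_spectrum:
  assumes g: "weak_fourier f g"
  shows "(\<forall>z. 0 < Im z \<longrightarrow> cauchy_integral f (cnj z) = 0) \<longleftrightarrow> (AE t in lebesgue. t < 0 \<longrightarrow> g t = 0)"
proof
  assume 0: "\<forall>z. 0 < Im z \<longrightarrow> cauchy_integral f (cnj z) = 0"
  define k where "k t = g t * lower_exp \<i> t" for t
  have k: "integrable lebesgue k" unfolding k_def by (rule weak_fourier_lower_exp[OF g]) simp
  have "fourier_integral k x = 0" for x
  proof -
    have "(\<lambda>t. k t * exp (- (\<i> * of_real x * of_real t))) = (\<lambda>t. g t * lower_exp (\<i> - of_real x) t)"
      by (auto simp: k_def lower_exp_def indicator_def algebra_simps simp flip: exp_add)
    moreover have "(LINT t|lebesgue. g t * lower_exp (\<i> - of_real x) t) = 0"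
      using weak_fourier_lower_exp(2)[OF g, of "\<i> - of_real x"] 0[rule_format, of "\<i> - of_real x"] by simp
    ultimately show ?thesis unfolding fourier_integral_def by simp
  qed
  with k have "AE t in lebesgue. k t = 0" by (rule fourier_integral_eq_0_imp_AE_0)
  then show "AE t in lebesgue. t < 0 \<longrightarrow> g t = 0"
    by eventually_elim (auto simp: k_def lower_exp_def indicator_def)
next
  assume ae: "AE t in lebesgue. t < 0 \<longrightarrow> g t = 0"
  show "\<forall>z. 0 < Im z \<longrightarrow> cauchy_integral f (cnj z) = 0"
  proof (intro allI impI)
    fix z :: complex assume z: "0 < Im z"
    have "AE t in lebesgue. t \<noteq> (0::real)" by (intro AE_completion AE_lborel_singleton)
    with ae have "AE t in lebesgue. g t * lower_exp z t = 0"
      by eventually_elim (auto simp: lower_exp_def indicator_def)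
    then have "(LINT t|lebesgue. g t * lower_exp z t) = 0" by (rule integral_eq_zero_AE)
    then show "cauchy_integral f (cnj z) = 0"
      unfolding weak_fourier_lower_exp(2)[OF g z] by simp
  qed
qed

lemma poisson_integral_in_hardy_space:
  assumes p: "1 \<le> p" "p \<le> 2" "f \<in> Lp p" and hol: "poisson_integral f holomorphic_on upper_half_plane"
  shows "poisson_integral f \<in> hardy_space p"
  unfolding hardy_space_def mem_Collect_eq
proof (intro conjI hol allI impI)
  show "integrable lebesgue (\<lambda>x. norm (poisson_integral f (Complex x y)) powr p)" if "0 < y" for y
    by (rule poisson_integral_Lp_contraction[OF p that])
  show "bdd_above ((\<lambda>y. (LINT x|lebesgue. norm (poisson_integral f (Complex x y)) powr p) powr (1 / p)) ` {0<..})"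
    unfolding bdd_above_def using p
    by (intro exI[of _ "(LINT x|lebesgue. norm (f x) powr p) powr (1 / p)"])
       (auto intro!: powr_mono2 poisson_integral_Lp_contraction(2)[OF p] Bochner_Integration.integral_nonneg)
qed

theorem theoremC:
  fixes p :: real and f :: "real \<Rightarrow> complex"
  assumes "1 \<le> p" and "p \<le> 2" and "f \<in> Lp p"
  shows "(f \<in> hardy_boundary_space p \<longleftrightarrow> ess_support (fourier f) \<subseteq> {0..}) \<and>
    (f \<in> hardy_boundary_space p \<longrightarrow>
      (\<forall>F \<in> hardy_space p. has_boundary_function F f \<longrightarrow>
        (\<forall>z \<in> upper_half_plane.
          set_integrable lebesgue {0..} (\<lambda>t. exp (\<i> * complex_of_real t * z) * fourier f t) \<and>
          F z = 1 / complex_of_real (sqrt (2 * pi)) *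
            (LINT t:{0..}|lebesgue. exp (\<i> * complex_of_real t * z) * fourier f t))))"
proof -
  note p = assms
  have g: "weak_fourier f (fourier f)" by (rule weak_fourier_fourier[OF p])
  have lower: "cauchy_integral f (cnj z) = 0"
    if F: "F \<in> hardy_space p" "has_boundary_function F f" and z: "0 < Im z" for F z
  proof (rule cauchy_integral_lower_eq_0[OF p _ z])
    have "F holomorphic_on upper_half_plane" using F by (simp add: hardy_space_def)
    then show "poisson_integral f holomorphic_on upper_half_plane"
      by (rule holomorphic_transform)
         (simp add: upper_half_plane_def hardy_space_eq_poisson_integral[OF F(1) p F(2)])
  qed
  have iff: "f \<in> hardy_boundary_space p \<longleftrightarrow> ess_support (fourier f) \<subseteq> {0..}"
  proof
    assume "f \<in> hardy_boundary_space p"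
    then obtain F where "F \<in> hardy_space p" "has_boundary_function F f"
      by (auto simp: hardy_boundary_space_def)
    with lower show "ess_support (fourier f) \<subseteq> {0..}"
      unfolding ess_support_subset_nonneg_iff cauchy_lower_eq_0_iff_spectrum[OF g, symmetric] by blast
  next
    assume "ess_support (fourier f) \<subseteq> {0..}"
    then have 0: "cauchy_integral f (cnj z) = 0" if "0 < Im z" for z
      using that unfolding ess_support_subset_nonneg_iff cauchy_lower_eq_0_iff_spectrum[OF g, symmetric] by blast
    have "cauchy_integral f holomorphic_on upper_half_plane"
      by (rule holomorphic_on_subset[OF cauchy_integral_holomorphic[OF p]]) (auto simp: upper_half_plane_def)
    then have "poisson_integral f holomorphic_on upper_half_plane"
      by (rule holomorphic_transform) (simp add: upper_half_plane_def poisson_integral_eq_cauchy[OF p] 0)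
    then show "f \<in> hardy_boundary_space p"
      using poisson_integral_in_hardy_space[OF p] poisson_boundary_function[OF p]
      by (auto simp: hardy_boundary_space_def)
  qed
  have rep: "set_integrable lebesgue {0..} (\<lambda>t. exp (\<i> * complex_of_real t * z) * fourier f t) \<and>
          F z = 1 / complex_of_real (sqrt (2 * pi)) *
            (LINT t:{0..}|lebesgue. exp (\<i> * complex_of_real t * z) * fourier f t)"
    if F: "F \<in> hardy_space p" "has_boundary_function F f" and zU: "z \<in> upper_half_plane" for F z
  proof -
    have z: "0 < Im z" using zU by (simp add: upper_half_plane_def)
    have eq: "(\<lambda>t. indicator {0..} t *\<^sub>R (exp (\<i> * complex_of_real t * z) * fourier f t)) = (\<lambda>t. fourier f t * upper_exp z t)"
      by (auto simp: upper_exp_def indicator_def)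
    have "F z = poisson_integral f z" by (rule hardy_space_eq_poisson_integral[OF F(1) p F(2) z])
    also have "\<dots> = cauchy_integral f z"
      using poisson_integral_eq_cauchy[OF p z] lower[OF F z] by simp
    finally show ?thesis
      using weak_fourier_upper_exp[OF g z]
      unfolding set_integrable_def set_lebesgue_integral_def eq by simp
  qed
  show ?thesis using iff rep by blast
qed

end
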